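(* Let $(M_n,S_n)_{n\ge 0}$ be a Markov random walk whose driving chain $(M_n)_{n\ge0}$ is positive recurrent with at most countable state space $\mathcal S$, transition matrix $P=(p_{ij})_{i,j\in\mathcal S}$ and stationary distribution $\pi=(\pi_i)_{i\in\mathcal S}$. Let $\xi$ be the stationary law of $(M_n,X_n)_{n\in\mathbb Z}$. Suppose that the dual walk is positive divergent, i.e. $\lim_{n\to\infty}{}^{\#}S_n=\lim_{n\to\infty}(-S_{-n})=\infty$ a.s. Then the ladder chain $M^{>}=(M_n^{>})_{n\ge0}$ possesses the unique stationary distribution $\pi^{>}=(\pi_i^{>})_{i\in\mathcal S}$ defined by $$\pi_i^{>}:=\frac1c\,\mathbb E_\xi\Big(\frac{1}{\sigma_1-\sigma_0}\mathbf 1_{\{M_{\sigma_0}=i\}}\Big)=\frac1c\,\mathbb P_\xi(M_0=i,\sigma_0=0),\qquad i\in\mathcal S$$ (in particular the two expressions coincide), and $\pi^{>}$ has $\pi$-density $f(i)=c^{-1}\,\mathbb P_\xi(\sigma_0=0\mid M_0=i)$, $i\in\mathcal S$. Here $$c:=\mathbb E_\xi\Big(\frac1{\sigma_1-\sigma_0}\Big)=\mathbb P_\xi(\sigma_0=0)\in(0,1].$$ Moreover, the ladder chain is positive recurrent on $\mathcal S^{>}:=\{i\in\mathcal S:\pi_i^{>}>0\}$, and $$\mathbb P_i\big(\tau^{>}(\mathcal S^{>})<\infty\big)=1\quad\text{for all } i\in\mathcal S,$$ where $\tau^{>}(\mathcal S^{>}):=\inf\{n\ge1:M_n^{>}\in\mathcal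 S^{>}\}$.
   Context: Setting. $(M_n)_{n\ge 0}$ is an irreducible Markov chain on the at most countable set $\mathcal S$ with transition matrix $P=(p_{ij})$; if it is positive recurrent, $\pi$ is its unique stationary distribution, and all $\pi_i>0$. $(X_n)_{n\ge1}$ are real random variables, conditionally independent given $(M_n)_{n\ge0}$, with the conditional law of $X_n$ given $(M_k)_{k\ge0}$ equal to $F_{M_{n-1},M_n}$, where $(F_{ij})_{i,j\in\mathcal S}$ are given probability laws on $\mathbb R$. Thus $\mathbb P(M_{n+1}=j,X_{n+1}\le t\mid M_n=i,X_n=x)=p_{ij}F_{ij}(t)$. With $S_0:=0$, $S_n:=\sum_{k=1}^nX_k$, the process $(M_n,S_n)_{n\ge0}$ is called a Markov random walk with driving chain $(M_n)_{n\ge0}$. Write $\mathbb P_i=\mathbb P(\cdot\mid M_0=i)$ and $\mathbb P_\lambda=\sum_i\lambda_i\mathbb P_i$ for a measure $\lambda$ on $\mathcal S$. "A.s." means $\mathbb P_i$-a.s. for all $i\in\mathcal S$. Two-sided stationary version. Under $\mathbb P_\xi$, $(M_n,X_n)_{n\in\mathbb Z}$ is the doubly infinite stationary version of the Markov chain $(M_n,X_n)_{n\ge1}$ on $\mathcal S\times\mathbb R$ with transition kernel $Q((i,x),\{j\}\times(-\infty,t])=p_{ij}F_{ij}(t)$, $\xi$ being its stationary law on $\mathcal S\times\mathbb R$; so each $M_n$ has law $\pi$. Put $S_0=0$, $S_n=\sum_{k=1}^nX_k$ for $n\ge1$, $S_n=-\sum_{k=n+1}^0X_k$ for $n\le-1$.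 Dual. ${}^{\#}M_n:=M_{-n}$, ${}^{\#}X_n:=X_{-n+1}$, ${}^{\#}S_n:=-S_{-n}$. The dual sequence $({}^{\#}M_n,{}^{\#}X_n)$ is a Markov chain with transition kernel ${}^{\#}Q((i,x),\{j\}\times(-\infty,t])=\frac{\pi_jp_{ji}}{\pi_i}F_{ji}(t)$, and $({}^{\#}M_n,{}^{\#}S_n)_{n\ge0}$ is the corresponding Markov random walk. Two-sided ladder epochs. When the dual walk is positive divergent, there is with probability one a doubly infinite sequence $\dots<\sigma_{-1}<\sigma_0\le0<\sigma_1<\sigma_2<\dots$ enumerating all $k\in\mathbb Z$ with $S_k>\sup_{j<k}S_j$. In particular $\sigma_1=\inf\{k\ge1:S_k>\sup_{j<k}S_j\}$ and $\sigma_0=\sup\{k\le0:S_k>\sup_{j<k}S_j\}$. Ladder chain. $\sigma_0^{>}:=0$ and $\sigma_n^{>}:=\inf\{k>\sigma_{n-1}^{>}:S_k>S_{\sigma_{n-1}^{>}}\}$ for $n\ge1$ (equal to $\infty$ if $\sigma_{n-1}^{>}=\infty$ or if there is no such $k$). $M_n^{>}:=M_{\sigma_n^{>}}$ on $\{\sigma_n^{>}<\infty\}$. The ladder chain $(M_n^{>})_{n\ge0}$ is Markov with (a priori possibly substochastic) transition matrix $\big(\mathbb P_i(M_1^{>}=j,\sigma_1^{>}<\infty)\big)_{i,j\in\mathcal S}$; the event $\{M_n^{>}\in A\}$ is understood to include $\{\sigma_n^{>}<\infty\}$. "Positive recurrent on $\mathcal S^{>}$" means that the chain restricted to $\mathcal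 S^{>}$ is an irreducible positive recurrent Markov chain on $\mathcal S^{>}$. *)

theory Defs
  imports "HOL-Probability.Probability"
begin

(* The at most countable state space is a type 's :: countable. A process Z with values in
   's option is a chain on 's that may be killed; None is the cemetery. *)

definition stochastic_on :: "'s set \<Rightarrow> ('s \<Rightarrow> 's \<Rightarrow> real) \<Rightarrow> bool" where
  "stochastic_on C R \<longleftrightarrow> (\<forall>i\<in>C. (\<forall>j\<in>C. 0 \<le> R i j) \<and> (R i has_sum 1) C)"

definition stationary_distribution :: "('s \<Rightarrow> 's \<Rightarrow> real) \<Rightarrow> ('s \<Rightarrow> real) \<Rightarrow> bool" where
  "stationary_distribution R \<nu> \<longleftrightarrow>
     (\<forall>i. 0 \<le> \<nu> i) \<and> (\<nu> has_sum 1) UNIV \<and>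
     (\<forall>j. ((\<lambda>i. \<nu> i * R i j) has_sum \<nu> j) UNIV)"

definition markov_chain_from ::
    "'w measure \<Rightarrow> ('s \<Rightarrow> 's \<Rightarrow> real) \<Rightarrow> 's \<Rightarrow> (nat \<Rightarrow> 'w \<Rightarrow> 's option) \<Rightarrow> bool" where
  "markov_chain_from N R i Z \<longleftrightarrow>
     prob_space N \<and>
     (\<forall>n. Z n \<in> measurable N (count_space UNIV)) \<and>
     (AE \<omega> in N. Z 0 \<omega> = Some i) \<and>
     (\<forall>n h. measure N {\<omega> \<in> space N. \<forall>k\<le>Suc n. Z k \<omega> = Some (h k)} =
            measure N {\<omega> \<in> space N. \<forall>k\<le>n. Z k \<omega> = Some (h k)} * R (h n) (h (Suc n)))"

definition hitting_time :: "(nat \<Rightarrow> 'w \<Rightarrow> 's option) \<Rightarrow> 's set \<Rightarrow> 'w \<Rightarrow> enat" where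
  "hitting_time Z A \<omega> = Inf {enat n | n. 1 \<le> n \<and> Z n \<omega> \<in> Some ` A}"

(* The chain started in C is an irreducible positive recurrent Markov chain on C; that it never
   leaves C is contained in stochastic_on. Pr i is the law of the process started at i. *)
definition positive_recurrent_on ::
    "'s set \<Rightarrow> ('s \<Rightarrow> 's \<Rightarrow> real) \<Rightarrow> ('s \<Rightarrow> 'w measure) \<Rightarrow> (nat \<Rightarrow> 'w \<Rightarrow> 's option) \<Rightarrow> bool" where
  "positive_recurrent_on C R Pr Z \<longleftrightarrow>
     stochastic_on C R \<and>
     (\<forall>i\<in>C. markov_chain_from (Pr i) R i Z) \<and>
     (\<forall>i\<in>C. \<forall>j\<in>C. \<exists>n. 0 < measure (Pr i) {\<omega> \<in> space (Pr i). Z n \<omega> = Some j}) \<and>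
     (\<forall>i\<in>C. (\<integral>\<^sup>+ \<omega>. ennreal_of_enat (hitting_time Z {i} \<omega>) \<partial>Pr i) < \<infinity>)"

definition chain_algebra :: "'w measure \<Rightarrow> (nat \<Rightarrow> 'w \<Rightarrow> 's) \<Rightarrow> 'w measure" where
  "chain_algebra N M = sigma (space N) {M k -` {j} \<inter> space N | k j. True}"

(* Only X k with k \<ge> 1 is used. The last conjunct says that, given the whole driving chain, the
   X k are independent with laws F (M (k - 1)) (M k). *)
definition markov_random_walk ::
    "('s \<Rightarrow> 's \<Rightarrow> real) \<Rightarrow> ('s \<Rightarrow> 's \<Rightarrow> real measure) \<Rightarrow> ('s \<Rightarrow> 'w measure) \<Rightarrow>
     (nat \<Rightarrow> 'w \<Rightarrow> 's) \<Rightarrow> (nat \<Rightarrow> 'w \<Rightarrow> real) \<Rightarrow> bool" where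
  "markov_random_walk p F Pr M X \<longleftrightarrow>
     stochastic_on UNIV p \<and>
     (\<forall>i j. real_distribution (F i j)) \<and>
     (\<forall>i. markov_chain_from (Pr i) p i (\<lambda>n \<omega>. Some (M n \<omega>)) \<and>
          (\<forall>n. M n \<in> measurable (Pr i) (count_space UNIV)) \<and>
          (\<forall>n\<ge>1. X n \<in> borel_measurable (Pr i)) \<and>
          (\<forall>n B. (\<forall>k. B k \<in> sets borel) \<longrightarrow>
             (AE \<omega> in Pr i.
                real_cond_exp (Pr i) (chain_algebra (Pr i) M)
                  (indicator {\<omega> \<in> space (Pr i). \<forall>k\<in>{1..n}. X k \<omega> \<in> B k}) \<omega> =
                (\<Prod>k=1..n. measure (F (M (k - 1) \<omega>) (M k \<omega>)) (B k)))))"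

definition walk :: "(nat \<Rightarrow> 'w \<Rightarrow> real) \<Rightarrow> nat \<Rightarrow> 'w \<Rightarrow> real" where
  "walk X n \<omega> = (\<Sum>k=1..n. X k \<omega>)"

primrec ladder_epoch :: "(nat \<Rightarrow> 'w \<Rightarrow> real) \<Rightarrow> nat \<Rightarrow> 'w \<Rightarrow> enat" where
  "ladder_epoch X 0 \<omega> = 0"
| "ladder_epoch X (Suc n) \<omega> =
     (case ladder_epoch X n \<omega> of
        enat m \<Rightarrow> Inf {enat k | k. m < k \<and> walk X m \<omega> < walk X k \<omega>}
      | \<infinity> \<Rightarrow> \<infinity>)"

definition ladder_chain ::
    "(nat \<Rightarrow> 'w \<Rightarrow> 's) \<Rightarrow> (nat \<Rightarrow> 'w \<Rightarrow> real) \<Rightarrow> nat \<Rightarrow> 'w \<Rightarrow> 's option" where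
  "ladder_chain M X n \<omega> =
     (case ladder_epoch X n \<omega> of enat k \<Rightarrow> Some (M k \<omega>) | \<infinity> \<Rightarrow> None)"

definition ladder_matrix ::
    "('s \<Rightarrow> 'w measure) \<Rightarrow> (nat \<Rightarrow> 'w \<Rightarrow> 's) \<Rightarrow> (nat \<Rightarrow> 'w \<Rightarrow> real) \<Rightarrow> 's \<Rightarrow> 's \<Rightarrow> real" where
  "ladder_matrix Pr M X i j =
     measure (Pr i) {\<omega> \<in> space (Pr i). ladder_chain M X 1 \<omega> = Some j}"

(* The kernel Q((i,x), {j} \<times> B); it does not depend on x, and the rectangles {j} \<times> B determine it
   since the state space is countable. *)
definition mrw_kernel ::
    "('s \<Rightarrow> 's \<Rightarrow> real) \<Rightarrow> ('s \<Rightarrow> 's \<Rightarrow> real measure) \<Rightarrow> 's \<times> real \<Rightarrow> 's \<Rightarrow> real set \<Rightarrow> real" where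
  "mrw_kernel p F z j B = p (fst z) j * measure (F (fst z) j) B"

definition stationary_law ::
    "('s \<Rightarrow> 's \<Rightarrow> real) \<Rightarrow> ('s \<Rightarrow> 's \<Rightarrow> real measure) \<Rightarrow> ('s \<times> real) measure \<Rightarrow> bool" where
  "stationary_law p F \<xi> \<longleftrightarrow>
     prob_space \<xi> \<and> sets \<xi> = sets (count_space UNIV \<Otimes>\<^sub>M borel) \<and>
     (\<forall>j. \<forall>B\<in>sets borel. measure \<xi> ({j} \<times> B) = (\<integral>z. mrw_kernel p F z j B \<partial>\<xi>))"

definition past_algebra ::
    "'w measure \<Rightarrow> (int \<Rightarrow> 'w \<Rightarrow> 's) \<Rightarrow> (int \<Rightarrow> 'w \<Rightarrow> real) \<Rightarrow> int \<Rightarrow> 'w measure" where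
  "past_algebra N M X n = sigma (space N)
     ({M k -` {j} \<inter> space N | k j. k \<le> n} \<union>
      {X k -` B \<inter> space N | k B. k \<le> n \<and> B \<in> sets borel})"

(* A time-homogeneous Markov chain all of whose one-dimensional marginals equal \<xi>, hence a
   stationary process. *)
definition two_sided_stationary ::
    "('s \<Rightarrow> 's \<Rightarrow> real) \<Rightarrow> ('s \<Rightarrow> 's \<Rightarrow> real measure) \<Rightarrow> ('s \<times> real) measure \<Rightarrow>
     'v measure \<Rightarrow> (int \<Rightarrow> 'v \<Rightarrow> 's) \<Rightarrow> (int \<Rightarrow> 'v \<Rightarrow> real) \<Rightarrow> bool" where
  "two_sided_stationary p F \<xi> N M X \<longleftrightarrow>
     prob_space N \<and>
     (\<forall>n. M n \<in> measurable N (count_space UNIV)) \<and>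
     (\<forall>n. X n \<in> borel_measurable N) \<and>
     (\<forall>n. distr N (count_space UNIV \<Otimes>\<^sub>M borel) (\<lambda>\<omega>. (M n \<omega>, X n \<omega>)) = \<xi>) \<and>
     (\<forall>n j. \<forall>B\<in>sets borel. AE \<omega> in N.
        real_cond_exp N (past_algebra N M X n)
          (indicator {\<omega> \<in> space N. M (n + 1) \<omega> = j \<and> X (n + 1) \<omega> \<in> B}) \<omega> =
        mrw_kernel p F (M n \<omega>, X n \<omega>) j B)"

definition two_sided_walk :: "(int \<Rightarrow> 'v \<Rightarrow> real) \<Rightarrow> int \<Rightarrow> 'v \<Rightarrow> real" where
  "two_sided_walk X n \<omega> = (if 0 \<le> n then \<Sum>k=1..n. X k \<omega> else - (\<Sum>k=n+1..0. X k \<omega>))"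

definition dual_walk :: "(int \<Rightarrow> 'v \<Rightarrow> real) \<Rightarrow> int \<Rightarrow> 'v \<Rightarrow> real" where
  "dual_walk X n \<omega> = - two_sided_walk X (- n) \<omega>"

(* The supremum over the infinite past may be infinite and is taken in the extended reals. *)
definition two_sided_record :: "(int \<Rightarrow> 'v \<Rightarrow> real) \<Rightarrow> 'v \<Rightarrow> int \<Rightarrow> bool" where
  "two_sided_record X \<omega> k \<longleftrightarrow>
     (SUP j\<in>{..<k}. ereal (two_sided_walk X j \<omega>)) < ereal (two_sided_walk X k \<omega>)"

(* As Inf and Sup of sets of integers, these have their intended meaning when the sets are
   nonempty; for a positive divergent dual walk this holds almost surely. *)
definition sigma1 :: "(int \<Rightarrow> 'v \<Rightarrow> real) \<Rightarrow> 'v \<Rightarrow> int" where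
  "sigma1 X \<omega> = Inf {k. 1 \<le> k \<and> two_sided_record X \<omega> k}"

definition sigma0 :: "(int \<Rightarrow> 'v \<Rightarrow> real) \<Rightarrow> 'v \<Rightarrow> int" where
  "sigma0 X \<omega> = Sup {k. k \<le> 0 \<and> two_sided_record X \<omega> k}"

definition ladder_const :: "'v measure \<Rightarrow> (int \<Rightarrow> 'v \<Rightarrow> real) \<Rightarrow> real" where
  "ladder_const N X = (\<integral>\<omega>. 1 / real_of_int (sigma1 X \<omega> - sigma0 X \<omega>) \<partial>N)"

definition ladder_pi ::
    "'v measure \<Rightarrow> (int \<Rightarrow> 'v \<Rightarrow> 's) \<Rightarrow> (int \<Rightarrow> 'v \<Rightarrow> real) \<Rightarrow> 's \<Rightarrow> real" where
  "ladder_pi N M X i = 1 / ladder_const N X *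
     (\<integral>\<omega>. 1 / real_of_int (sigma1 X \<omega> - sigma0 X \<omega>) *
            indicator {\<omega>. M (sigma0 X \<omega>) \<omega> = i} \<omega> \<partial>N)"

definition ladder_states ::
    "'v measure \<Rightarrow> (int \<Rightarrow> 'v \<Rightarrow> 's) \<Rightarrow> (int \<Rightarrow> 'v \<Rightarrow> real) \<Rightarrow> 's set" where
  "ladder_states N M X = {i. 0 < ladder_pi N M X i}"

end

(* Call k a record if S_k > S_j for all j < k. The dual walk diverges to infinity, so there are
   records arbitrarily far in the past; a last record would occur at all times with the same
   probability, so there are also records arbitrarily far in the future.

   Given a record at 0, the next record is the first strict ladder epoch of the forward walk. Hence
   the states at successive records form the ladder chain, and stationarity of the two-sided walk
   makes i |-> P(M_0 = i, 0 is a record) an invariant measure of finite positive mass. Counting the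
   time in cycles between records gives the second formula for it.

   Started from any state, the forward ladder epochs beyond the first two-sided record coincide with
   the records. So every state is absorbed into the support of the invariant measure, and the
   probability of visiting a given state of the support infinitely often along the ladder does not
   depend on the starting time. If it is positive for one initial state, then so it is for all, by
   irreducibility of the driving chain, and by recurrence of stationary events it is positive for
   some. This gives irreducibility on the support and uniqueness; positive recurrence is Kac's
   bound. *)
theory Submission
  imports Defs
begin

section \<open>Countable Markov chains\<close>

text \<open>The one-sided walks under \<open>Pr i\<close> and the stationary walk under
  \<open>N\<close> live on unrelated probability spaces and share only \<open>p\<close> and
  \<open>F\<close>. The link is \<open>path_law i\<close>, the law of the forward path under
  \<open>Pr i\<close>: by \<open>markov_property\<close> it is the conditional law under
  \<open>N\<close> of the future after any time n, given the past and M'_n = i. Every state has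
  positive probability under \<open>N\<close>, so one can divide by it: what holds almost surely for
  the future under \<open>N\<close> holds under each \<open>Pr i\<close>. This is how the
  hypothesis, which concerns only the past of the stationary walk, acts on one-sided walks started
  anywhere; even the Markov property of the ladder chain is proved under \<open>N\<close> and then
  divided out. The ladder chain may be reducible on the whole state space, with states that it
  leaves for ever. Uniqueness of its stationary distribution therefore rests on a criterion that
  asks for one state accessible from every state, not for irreducibility. Records are described by
  sums of increments, because the walk is pinned to 0 at time 0 and is not stationary, whereas its
  increments are.\<close>

lemma (in prob_space) has_sum_measure_fibres:
  fixes f :: "'a \<Rightarrow> 'c::countable"
  assumes [measurable]: "Measurable.pred M P" "f \<in> measurable M (count_space UNIV)"
  shows "((\<lambda>i. measure M {\<omega>\<in>space M. P \<omega> \<and> f \<omega> = i}) has_sum measure M {\<omega>\<in>space M. P \<omega>}) UNIV"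
proof -
  let ?A = "\<lambda>n::nat. {\<omega>\<in>space M. P \<omega> \<and> to_nat (f \<omega>) = n}"
  have "(\<lambda>n. measure M (?A n)) sums measure M (\<Union>n. ?A n)"
    by (intro finite_measure_UNION) (auto simp: disjoint_family_on_def)
  moreover have "(\<Union>n. ?A n) = {\<omega>\<in>space M. P \<omega>}" by auto
  ultimately have "((\<lambda>n. measure M (?A n)) has_sum measure M {\<omega>\<in>space M. P \<omega>}) UNIV"
    by (intro sums_nonneg_imp_has_sum) auto
  then have "((\<lambda>n. measure M (?A n)) has_sum measure M {\<omega>\<in>space M. P \<omega>}) (range (to_nat :: 'c \<Rightarrow> nat))"
  proof (subst has_sum_cong_neutral[where T = UNIV and g = "\<lambda>n. measure M (?A n)"])
    fix n assume "n \<in> UNIV - range (to_nat :: 'c \<Rightarrow> nat)"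
    then have "?A n = {}" by auto
    then show "measure M (?A n) = 0" by (simp only: measure_empty)
  qed auto
  then show ?thesis
    by (subst (asm) has_sum_reindex) (auto simp: comp_def)
qed

text \<open>One term of the invariance equation bounds the whole from below, so positivity spreads
  along edges of positive weight. \<open>d\<close> may have any total mass, since the lemma is also
  applied to differences of distributions.\<close>

lemma invariant_positive:
  fixes R :: "'s \<Rightarrow> 's \<Rightarrow> real"
  assumes d: "\<And>i. 0 \<le> d i" "\<And>j. ((\<lambda>i. d i * R i j) has_sum d j) UNIV"
    and R: "\<And>i j. 0 \<le> R i j"
    and ab: "(a, b) \<in> {(a, b). 0 < R a b}\<^sup>*" "0 < d a"
  shows "0 < d b"
  using ab
proof (induction rule: rtrancl_induct)
  case (step y z)
  have "(\<Sum>i\<in>{y}. d i * R i z) \<le> d z"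
    by (rule has_sum_mono_neutral[OF has_sum_finite d(2)]) (use d R in auto)
  moreover have "0 < d y * R y z" using step by simp
  ultimately show ?case by simp
qed auto

text \<open>Let m be the pointwise minimum of the two distributions. Its image under
  \<open>R\<close> lies below both, hence below m, and has the same total mass since rows sum to 1;
  so m is invariant. The remainders of the two distributions over m are then invariant with disjoint
  supports. If both were nonzero, both would charge the accessible state \<open>j\<close>. So one
  distribution lies below the other, and equal mass makes them equal.\<close>

lemma stationary_distribution_unique:
  fixes R :: "'s \<Rightarrow> 's \<Rightarrow> real"
  assumes R: "stochastic_on UNIV R"
    and reach: "\<And>i. (i, j) \<in> {(a, b). 0 < R a b}\<^sup>*"
    and \<mu>: "stationary_distribution R \<mu>" and \<nu>: "stationary_distribution R \<nu>"
  shows "\<mu> = \<nu>"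
proof -
  define m where "m i = min (\<mu> i) (\<nu> i)" for i
  have \<mu>0: "0 \<le> \<mu> i" "(\<mu> has_sum 1) UNIV" "((\<lambda>i. \<mu> i * R i j) has_sum \<mu> j) UNIV" for i j
    using \<mu> by (auto simp: stationary_distribution_def)
  have \<nu>0: "0 \<le> \<nu> i" "(\<nu> has_sum 1) UNIV" "((\<lambda>i. \<nu> i * R i j) has_sum \<nu> j) UNIV" for i j
    using \<nu> by (auto simp: stationary_distribution_def)
  have R0: "0 \<le> R i j" "(R i has_sum 1) UNIV" for i j
    using R by (auto simp: stochastic_on_def)
  have m0: "0 \<le> m i" "m i \<le> \<mu> i" "m i \<le> \<nu> i" for i
    using \<mu>0 \<nu>0 by (auto simp: m_def)
  have msum: "m summable_on UNIV"
    by (rule summable_on_comparison_test[OF has_sum_imp_summable[OF \<mu>0(2)]]) (use m0 in auto)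
  have row: "((\<lambda>j. m i * R i j) has_sum m i) UNIV" for i
    using has_sum_cmult_right[OF R0(2)[of i], of "m i"] by simp
  \<comment> \<open>Fubini for the double sum: summing rows first gives the mass of
    \<open>m\<close>, summing columns first the mass of its image \<open>m'\<close>.\<close>
  have "(\<lambda>(i, j). m i * R i j) summable_on UNIV \<times> UNIV"
    by (rule summable_on_SigmaI[where g = m]) (use row msum m0 R0 in auto)
  then obtain S where S: "((\<lambda>(i, j). m i * R i j) has_sum S) (UNIV \<times> UNIV)"
    by (auto simp: summable_on_def)
  have mS: "(m has_sum S) UNIV"
    by (rule has_sum_SigmaD[OF S]) (use row in auto)
  define m' where "m' j = (\<Sum>\<^sub>\<infinity>i. m i * R i j)" for j
  have "(\<lambda>i. m i * R i j) summable_on UNIV" for j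
    by (rule summable_on_comparison_test[OF has_sum_imp_summable[OF \<mu>0(3)[of j]]])
       (use m0 R0 in \<open>auto intro: mult_right_mono\<close>)
  then have m': "((\<lambda>i. m i * R i j) has_sum m' j) UNIV" for j
    unfolding m'_def by (rule has_sum_infsum)
  have "((\<lambda>(j, i). m i * R i j) has_sum S) (UNIV \<times> UNIV)"
    using S by (subst has_sum_swap) (simp add: case_prod_unfold)
  then have m'S: "(m' has_sum S) UNIV"
    by (rule has_sum_SigmaD) (use m' in auto)
  have "m' j \<le> \<mu> j" "m' j \<le> \<nu> j" for j
    by (rule has_sum_mono[OF m' \<mu>0(3)] has_sum_mono[OF m' \<nu>0(3)];
        use m0 R0 in \<open>auto intro: mult_right_mono\<close>)+
  then have le: "m' j \<le> m j" for j by (simp add: m_def)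
  have eq: "m' j = m j" for j
  proof (rule ccontr)
    assume "m' j \<noteq> m j"
    then have "m' j < m j" using le[of j] by simp
    then have "S < S"
      using has_sum_strict_mono[OF m'S mS _ UNIV_I] le by blast
    then show False by simp
  qed
  have \<mu>m: "((\<lambda>i. (\<mu> i - m i) * R i j) has_sum (\<mu> j - m j)) UNIV"
    and \<nu>m: "((\<lambda>i. (\<nu> i - m i) * R i j) has_sum (\<nu> j - m j)) UNIV" for j
    using has_sum_add[OF \<mu>0(3)[of j] has_sum_uminusI[OF m'[of j]]]
      has_sum_add[OF \<nu>0(3)[of j] has_sum_uminusI[OF m'[of j]]]
    by (simp_all add: eq left_diff_distrib)
  have "(\<forall>i. \<mu> i - m i = 0) \<or> (\<forall>i. \<nu> i - m i = 0)"
  proof (rule ccontr)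
    assume "\<not> ?thesis"
    then obtain a b where "0 < \<mu> a - m a" "0 < \<nu> b - m b"
      using m0 by (metis diff_ge_0_iff_ge order_less_le)
    then have "0 < \<mu> j - m j" "0 < \<nu> j - m j"
      using invariant_positive[of "\<lambda>i. \<mu> i - m i", OF _ \<mu>m R0(1) reach]
        invariant_positive[of "\<lambda>i. \<nu> i - m i", OF _ \<nu>m R0(1) reach] m0
      by auto
    then show False by (auto simp: m_def)
  qed
  then have le': "(\<forall>i. \<mu> i \<le> \<nu> i) \<or> (\<forall>i. \<nu> i \<le> \<mu> i)"
    using m0 by (metis eq_iff_diff_eq_0)
  show ?thesis
    using le'
  proof
    assume *: "\<forall>i. \<mu> i \<le> \<nu> i"
    have "\<not> \<mu> i < \<nu> i" for i
      using has_sum_strict_mono[OF \<mu>0(2) \<nu>0(2) _ UNIV_I, of i] * by auto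
    then show ?thesis using * by (auto simp: order.order_iff_strict)
  next
    assume *: "\<forall>i. \<nu> i \<le> \<mu> i"
    have "\<not> \<nu> i < \<mu> i" for i
      using has_sum_strict_mono[OF \<nu>0(2) \<mu>0(2) _ UNIV_I, of i] * by auto
    then show ?thesis using * by (auto simp: order.order_iff_strict)
  qed
qed

lemma countable_restricted_functions:
  fixes J :: "'t set"
  assumes "finite J"
  shows "countable (PiE J (\<lambda>_. UNIV :: 's::countable set))"
  using assms by (intro countable_PiE) auto

text \<open>Each step of a path of positive probability has positive weight. If no such path led
  from \<open>i\<close> to \<open>j\<close>, the event would be covered, up to a null set, by
  countably many null path events. The definition of the chain speaks only of paths that stay alive,
  hence \<open>alive\<close>.\<close>

lemma markov_chain_from_reachable:
  fixes R :: "'s::countable \<Rightarrow> 's \<Rightarrow> real"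
  assumes chain: "markov_chain_from N R i Z"
    and pos: "0 < measure N {\<omega>\<in>space N. Z n \<omega> = Some j}"
    and alive: "AE \<omega> in N. \<forall>k. Z k \<omega> \<noteq> None"
  shows "(i, j) \<in> {(a, b). 0 < R a b}\<^sup>*"
proof -
  interpret prob_space N using chain by (simp add: markov_chain_from_def)
  have [measurable]: "Z k \<in> measurable N (count_space UNIV)" for k
    using chain by (simp add: markov_chain_from_def)
  define A where "A h n = {\<omega>\<in>space N. \<forall>k\<le>n. Z k \<omega> = Some (h k)}" for h n
  have [measurable]: "A h n \<in> sets N" for h n unfolding A_def by measurable
  have path: "(i, h n) \<in> {(a, b). 0 < R a b}\<^sup>*" if "0 < measure N (A h n)" for h n
    using that
  proof (induction n)
    case 0
    have "i = h 0"
    proof (rule ccontr)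
      assume neq: "i \<noteq> h 0"
      have "AE \<omega> in N. Z 0 \<omega> = Some i" using chain by (simp add: markov_chain_from_def)
      then have "AE \<omega> in N. \<not> (\<forall>k\<le>0. Z k \<omega> = Some (h k))"
        by eventually_elim (use neq in auto)
      then have "measure N (A h 0) = 0" unfolding A_def by (subst prob_eq_0) auto
      then show False using 0 by simp
    qed
    then show ?case by simp
  next
    case (Suc n)
    have "measure N (A h (Suc n)) = measure N (A h n) * R (h n) (h (Suc n))"
      using chain by (simp add: markov_chain_from_def A_def)
    with Suc.prems have "0 < measure N (A h n)" "0 < R (h n) (h (Suc n))"
      by (auto simp: zero_less_mult_iff not_less_iff_gr_or_eq[symmetric] dest: order.strict_trans2[OF _ measure_nonneg] leD)
    then show ?case using Suc.IH by (auto intro: rtrancl_into_rtrancl)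
  qed
  show ?thesis
  proof (rule ccontr)
    assume neg: "(i, j) \<notin> {(a, b). 0 < R a b}\<^sup>*"
    \<comment> \<open>Paths are restricted to times up to \<open>n\<close>, which makes their set
      countable.\<close>
    let ?H = "PiE {..n} (\<lambda>_. UNIV :: 's set) \<inter> {h. h n = j}"
    have "A h n \<in> null_sets N" if "h \<in> ?H" for h
      using that path[of h n] neg
      by (auto simp: null_sets_def emeasure_eq_measure zero_less_measure_iff)
    then have "(\<Union>h\<in>?H. A h n) \<in> null_sets N"
      by (intro null_sets_UN' countable_Int1 countable_restricted_functions) auto
    then have "AE \<omega> in N. \<omega> \<notin> (\<Union>h\<in>?H. A h n)" by (rule AE_not_in)
    then have "AE \<omega> in N. \<not> Z n \<omega> = Some j"
      using alive AE_space
    proof eventually_elim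
      case (elim \<omega>)
      show ?case
      proof
        assume *: "Z n \<omega> = Some j"
        let ?h = "restrict (\<lambda>k. the (Z k \<omega>)) {..n}"
        have "\<omega> \<in> A ?h n" "?h \<in> ?H" using elim * by (auto simp: A_def)
        then show False using elim(1) by blast
      qed
    qed
    then have "measure N {\<omega>\<in>space N. Z n \<omega> = Some j} = 0"
      by (simp add: prob_eq_0)
    then show False using pos by simp
  qed
qed

text \<open>The chain is defined by probabilities of single paths. Here the step is taken from an
  arbitrary event in the history up to \<open>n\<close>; the hypothesis on \<open>P\<close> says
  that it looks at no later time. The event is split over the countably many histories.\<close>

lemma markov_chain_from_step:
  fixes R :: "'s::countable \<Rightarrow> 's \<Rightarrow> real"
  assumes chain: "markov_chain_from N R i Z"
    and alive: "AE \<omega> in N. \<forall>k. Z k \<omega> \<noteq> None"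
    and P: "\<And>h h'. (\<And>k. k \<le> n \<Longrightarrow> h k = h' k) \<Longrightarrow> P h = P h'"
  shows "measure N {\<omega>\<in>space N. P (\<lambda>k. Z k \<omega>) \<and> Z n \<omega> = Some x \<and> Z (Suc n) \<omega> = Some y} =
         measure N {\<omega>\<in>space N. P (\<lambda>k. Z k \<omega>) \<and> Z n \<omega> = Some x} * R x y"
proof -
  interpret prob_space N using chain by (simp add: markov_chain_from_def)
  have [measurable]: "Z k \<in> measurable N (count_space UNIV)" for k
    using chain by (simp add: markov_chain_from_def)
  \<comment> \<open>As a list the history has a countable type, which also makes \<open>P\<close>, a
    function of it, measurable.\<close>
  define f where "f \<omega> = map (\<lambda>k. Z k \<omega>) [0..<Suc n]" for \<omega>
  have fk: "f \<omega> = l \<longleftrightarrow> length l = Suc n \<and> (\<forall>k\<le>n. Z k \<omega> = l ! k)" for \<omega> l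
    by (auto simp: f_def list_eq_iff_nth_eq less_Suc_eq_le simp del: upt_Suc)
  have [measurable]: "f \<in> measurable N (count_space UNIV)"
    by (rule measurable_count_space_eq_countable[THEN iffD2]) (auto simp: vimage_def Int_def fk conj_commute)
  have [measurable]: "Measurable.pred N (\<lambda>\<omega>. P (\<lambda>k. Z k \<omega>))"
  proof -
    have "P (\<lambda>k. Z k \<omega>) \<longleftrightarrow> f \<omega> \<in> {l. P (\<lambda>k. l ! k)}" for \<omega>
      using P[of "\<lambda>k. Z k \<omega>" "\<lambda>k. f \<omega> ! k"] fk[of \<omega> "f \<omega>"] by auto
    then show ?thesis by simp
  qed
  have "measure N {\<omega>\<in>space N. (P (\<lambda>k. Z k \<omega>) \<and> Z n \<omega> = Some x \<and> Z (Suc n) \<omega> = Some y) \<and> f \<omega> = l} =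
        measure N {\<omega>\<in>space N. (P (\<lambda>k. Z k \<omega>) \<and> Z n \<omega> = Some x) \<and> f \<omega> = l} * R x y" for l
  proof (cases "length l = Suc n \<and> P (\<lambda>k. l ! k) \<and> l ! n = Some x \<and> (\<forall>k\<le>n. l ! k \<noteq> None)")
    case True
    define h where "h k = (if k = Suc n then y else the (l ! k))" for k
    have h: "l ! k = Some (h k)" if "k \<le> n" for k using True that by (auto simp: h_def)
    have hn: "h n = x" "h (Suc n) = y" using True by (auto simp: h_def)
    have Pf: "P (\<lambda>k. Z k \<omega>)" if "\<forall>k\<le>n. Z k \<omega> = l ! k" for \<omega>
      using P[of "\<lambda>k. Z k \<omega>" "\<lambda>k. l ! k"] that True by auto
    have "{\<omega>\<in>space N. (P (\<lambda>k. Z k \<omega>) \<and> Z n \<omega> = Some x) \<and> f \<omega> = l} =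
        {\<omega>\<in>space N. \<forall>k\<le>n. Z k \<omega> = Some (h k)}"
      using True Pf h hn by (auto simp: fk)
    moreover have "{\<omega>\<in>space N. (P (\<lambda>k. Z k \<omega>) \<and> Z n \<omega> = Some x \<and> Z (Suc n) \<omega> = Some y) \<and> f \<omega> = l} =
        {\<omega>\<in>space N. \<forall>k\<le>Suc n. Z k \<omega> = Some (h k)}"
      using True Pf h hn by (auto simp: fk le_Suc_eq)
    ultimately show ?thesis
      using chain hn by (simp add: markov_chain_from_def)
  next
    case False
    \<comment> \<open>All other lists contradict the event or meet the cemetery, so both sides
      vanish.\<close>
    have "AE \<omega> in N. \<not> ((P (\<lambda>k. Z k \<omega>) \<and> Z n \<omega> = Some x) \<and> f \<omega> = l)"
      using alive
    proof eventually_elim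
      case (elim \<omega>)
      show ?case
      proof
        assume *: "(P (\<lambda>k. Z k \<omega>) \<and> Z n \<omega> = Some x) \<and> f \<omega> = l"
        then have l: "length l = Suc n" "\<And>k. k \<le> n \<Longrightarrow> Z k \<omega> = l ! k" using fk[of \<omega> l] by auto
        have "P (\<lambda>k. l ! k)" using P[of "\<lambda>k. Z k \<omega>" "\<lambda>k. l ! k", OF l(2)] * by auto
        moreover have "\<forall>k\<le>n. l ! k \<noteq> None" using elim l(2) by metis
        ultimately show False using False l * by auto
      qed
    qed
    then have "measure N {\<omega>\<in>space N. (P (\<lambda>k. Z k \<omega>) \<and> Z n \<omega> = Some x) \<and> f \<omega> = l} = 0"
      and "measure N {\<omega>\<in>space N. (P (\<lambda>k. Z k \<omega>) \<and> Z n \<omega> = Some x \<and> Z (Suc n) \<omega> = Some y) \<and> f \<omega> = l} = 0"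
      by (subst prob_eq_0; auto elim!: eventually_mono)+
    then show ?thesis by simp
  qed
  then have "((\<lambda>l. measure N {\<omega>\<in>space N. (P (\<lambda>k. Z k \<omega>) \<and> Z n \<omega> = Some x) \<and> f \<omega> = l} * R x y) has_sum
      measure N {\<omega>\<in>space N. P (\<lambda>k. Z k \<omega>) \<and> Z n \<omega> = Some x \<and> Z (Suc n) \<omega> = Some y}) UNIV"
    using has_sum_measure_fibres[of "\<lambda>\<omega>. P (\<lambda>k. Z k \<omega>) \<and> Z n \<omega> = Some x \<and> Z (Suc n) \<omega> = Some y" f] by simp
  moreover have "((\<lambda>l. measure N {\<omega>\<in>space N. (P (\<lambda>k. Z k \<omega>) \<and> Z n \<omega> = Some x) \<and> f \<omega> = l} * R x y) has_sum
      measure N {\<omega>\<in>space N. P (\<lambda>k. Z k \<omega>) \<and> Z n \<omega> = Some x} * R x y) UNIV"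
    by (intro has_sum_cmult_left has_sum_measure_fibres) measurable
  ultimately show ?thesis by (rule has_sum_unique)
qed

section \<open>Hitting times and Kac's bound\<close>

lemma Inf_enat_mem:
  fixes S :: "enat set"
  assumes "S \<noteq> {}" shows "Inf S \<in> S"
proof -
  from assms obtain x where "x \<in> S" by auto
  then have "(LEAST x. x \<in> S) \<in> S" by (rule LeastI)
  then show ?thesis using assms by (simp add: Inf_enat_def)
qed

lemma hitting_time_less_iff: "enat t < hitting_time Z A \<omega> \<longleftrightarrow> (\<forall>k\<in>{1..t}. Z k \<omega> \<notin> Some ` A)"
proof -
  let ?S = "{enat n |n. 1 \<le> n \<and> Z n \<omega> \<in> Some ` A}"
  have "hitting_time Z A \<omega> \<le> enat t \<longleftrightarrow> (\<exists>k\<in>{1..t}. Z k \<omega> \<in> Some ` A)"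
  proof
    assume *: "hitting_time Z A \<omega> \<le> enat t"
    have "?S \<noteq> {}"
    proof
      assume "?S = {}"
      then have "hitting_time Z A \<omega> = \<infinity>" unfolding hitting_time_def by (simp add: Inf_enat_def)
      then show False using * by simp
    qed
    then have "Inf ?S \<in> ?S" by (rule Inf_enat_mem)
    with * show "\<exists>k\<in>{1..t}. Z k \<omega> \<in> Some ` A" by (auto simp: hitting_time_def)
  next
    assume "\<exists>k\<in>{1..t}. Z k \<omega> \<in> Some ` A"
    then obtain k where "1 \<le> k" "k \<le> t" "Z k \<omega> \<in> Some ` A" by auto
    then have "Inf ?S \<le> enat k" by (intro Inf_lower) auto
    then show "hitting_time Z A \<omega> \<le> enat t"
      using \<open>k \<le> t\<close> by (simp add: hitting_time_def order_trans[OF _ enat_ord_simps(1)[THEN iffD2]])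
  qed
  then show ?thesis by (meson not_le)
qed

text \<open>The tail events determine each value: a finite one is a difference of two tails,
  \<infinity> is the intersection of all.\<close>

lemma measurable_count_space_enat:
  assumes "\<And>t. {\<omega>\<in>space N. enat t < f \<omega>} \<in> sets N"
  shows "f \<in> measurable N (count_space UNIV)"
proof (subst measurable_count_space_eq_countable, simp, safe)
  fix a :: enat
  show "f -` {a} \<inter> space N \<in> sets N"
  proof (cases a)
    case (enat t)
    have eq: "f -` {a} \<inter> space N =
        (if t = 0 then space N else {\<omega>\<in>space N. enat (t - 1) < f \<omega>}) - {\<omega>\<in>space N. enat t < f \<omega>}"
    proof (intro set_eqI)
      fix \<omega>
      show "\<omega> \<in> f -` {a} \<inter> space N \<longleftrightarrow> \<omega> \<in> (if t = 0 then space N else {\<omega>\<in>space N. enat (t - 1) < f \<omega>}) - {\<omega>\<in>space N. enat t < f \<omega>}"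
        by (cases "f \<omega>") (auto simp: enat)
    qed
    show ?thesis unfolding eq using assms by auto
  next
    case infinity
    have "f -` {a} \<inter> space N = (\<Inter>t. {\<omega>\<in>space N. enat t < f \<omega>})"
    proof (intro set_eqI)
      fix \<omega>
      show "\<omega> \<in> f -` {a} \<inter> space N \<longleftrightarrow> \<omega> \<in> (\<Inter>t. {\<omega>\<in>space N. enat t < f \<omega>})"
        by (cases "f \<omega>") (auto simp: infinity)
    qed
    then show ?thesis using assms by auto
  qed
qed auto

lemma has_sum_sum_finite:
  fixes f :: "'i \<Rightarrow> 'a \<Rightarrow> real"
  assumes "finite I" "\<And>i. i \<in> I \<Longrightarrow> (f i has_sum S i) A"
  shows "((\<lambda>x. \<Sum>i\<in>I. f i x) has_sum (\<Sum>i\<in>I. S i)) A"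
  using assms by (induction I rule: finite_induct) (auto intro: has_sum_add)

text \<open>Let v_n(y) be the probability of being at y at time n without having visited a at times
  1 to n. Induction shows that \<pi>(a) times the sum of v_0, ..., v_n at y is at most \<pi>(y).
  Summing over y bounds the sum of the tail probabilities of the return time, hence its mean, by
  1/\<pi>(a).\<close>

lemma markov_chain_from_return_time_finite:
  fixes R :: "'s::countable \<Rightarrow> 's \<Rightarrow> real"
  assumes chain: "markov_chain_from N R a Z"
    and alive: "AE \<omega> in N. \<forall>k. Z k \<omega> \<noteq> None"
    and \<pi>: "stationary_distribution R \<pi>" "0 < \<pi> a"
    and R: "\<And>i j. 0 \<le> R i j"
  shows "(\<integral>\<^sup>+ \<omega>. ennreal_of_enat (hitting_time Z {a} \<omega>) \<partial>N) < \<infinity>"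
proof -
  interpret prob_space N using chain by (simp add: markov_chain_from_def)
  have [measurable]: "Z k \<in> measurable N (count_space UNIV)" for k
    using chain by (simp add: markov_chain_from_def)
  define v where "v n y = measure N {\<omega>\<in>space N. (\<forall>k\<in>{1..n}. Z k \<omega> \<noteq> Some a) \<and> Z n \<omega> = Some y}" for n y
  define s where "s n y = (\<Sum>k\<le>n. v k y)" for n y
  have v_sum: "(v n has_sum measure N {\<omega>\<in>space N. \<forall>k\<in>{1..n}. Z k \<omega> \<noteq> Some a}) UNIV" for n
  proof -
    have "((\<lambda>o'. measure N {\<omega>\<in>space N. (\<forall>k\<in>{1..n}. Z k \<omega> \<noteq> Some a) \<and> Z n \<omega> = o'}) has_sum
        measure N {\<omega>\<in>space N. \<forall>k\<in>{1..n}. Z k \<omega> \<noteq> Some a}) UNIV"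
      by (intro has_sum_measure_fibres) measurable
    moreover have "measure N {\<omega>\<in>space N. (\<forall>k\<in>{1..n}. Z k \<omega> \<noteq> Some a) \<and> Z n \<omega> = None} = 0"
      using alive by (subst prob_eq_0) (auto elim!: eventually_mono)
    ultimately have "((\<lambda>o'. measure N {\<omega>\<in>space N. (\<forall>k\<in>{1..n}. Z k \<omega> \<noteq> Some a) \<and> Z n \<omega> = o'}) has_sum
        measure N {\<omega>\<in>space N. \<forall>k\<in>{1..n}. Z k \<omega> \<noteq> Some a}) (range Some)"
      by (subst has_sum_cong_neutral[where T = UNIV]) (auto simp: notin_range_Some)
    then show ?thesis
      by (subst (asm) has_sum_reindex) (auto simp: comp_def v_def[abs_def])
  qed
  \<comment> \<open>For \<open>y\<close> different from \<open>a\<close>, arriving at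
    \<open>y\<close> keeps the taboo, so the restriction at time n + 1 is automatic.\<close>
  have v_step: "((\<lambda>x. v n x * R x y) has_sum v (Suc n) y) UNIV" if "y \<noteq> a" for n y
  proof -
    let ?P = "\<lambda>\<omega>. (\<forall>k\<in>{1..n}. Z k \<omega> \<noteq> Some a) \<and> Z (Suc n) \<omega> = Some y"
    have "((\<lambda>o'. measure N {\<omega>\<in>space N. ?P \<omega> \<and> Z n \<omega> = o'}) has_sum measure N {\<omega>\<in>space N. ?P \<omega>}) UNIV"
      by (intro has_sum_measure_fibres) measurable
    moreover have "measure N {\<omega>\<in>space N. ?P \<omega> \<and> Z n \<omega> = None} = 0"
      using alive by (subst prob_eq_0) (auto elim!: eventually_mono)
    ultimately have "((\<lambda>o'. measure N {\<omega>\<in>space N. ?P \<omega> \<and> Z n \<omega> = o'}) has_sum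
        measure N {\<omega>\<in>space N. ?P \<omega>}) (range Some)"
      by (subst has_sum_cong_neutral[where T = UNIV]) (auto simp: notin_range_Some)
    then have *: "((\<lambda>x. measure N {\<omega>\<in>space N. ?P \<omega> \<and> Z n \<omega> = Some x}) has_sum
        measure N {\<omega>\<in>space N. ?P \<omega>}) UNIV"
      by (subst (asm) has_sum_reindex) (auto simp: comp_def)
    have eq1: "measure N {\<omega>\<in>space N. ?P \<omega> \<and> Z n \<omega> = Some x} = v n x * R x y" for x
      using markov_chain_from_step[OF chain alive, of n "\<lambda>h. \<forall>k\<in>{1..n}. h k \<noteq> Some a" x y]
      by (simp add: v_def conj_commute conj_left_commute)
    have eq2: "measure N {\<omega>\<in>space N. ?P \<omega>} = v (Suc n) y"
      unfolding v_def using that by (intro arg_cong[where f = "measure N"]) (auto simp: le_Suc_eq)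
    show ?thesis using * unfolding eq1 eq2 .
  qed
  have v0: "v 0 y \<le> (if y = a then 1 else 0)" for y
  proof (cases "y = a")
    case False
    have "AE \<omega> in N. Z 0 \<omega> = Some a" using chain by (simp add: markov_chain_from_def)
    then have "AE \<omega> in N. \<not> Z 0 \<omega> = Some y" by eventually_elim (use False in auto)
    then have "v 0 y = 0" unfolding v_def by (subst prob_eq_0) auto
    then show ?thesis using False by simp
  qed (auto simp: v_def)
  have va: "v (Suc n) a = 0" for n
  proof -
    have "{\<omega>\<in>space N. (\<forall>k\<in>{1..Suc n}. Z k \<omega> \<noteq> Some a) \<and> Z (Suc n) \<omega> = Some a} = {}" by auto
    then show ?thesis unfolding v_def by (simp only: measure_empty)
  qed
  have \<pi>0: "0 \<le> \<pi> i" "(\<pi> has_sum 1) UNIV" "((\<lambda>i. \<pi> i * R i j) has_sum \<pi> j) UNIV" for i j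
    using \<pi> by (auto simp: stationary_distribution_def)
  \<comment> \<open>At \<open>a\<close> only the term for time 0 survives, and it is at most 1.
    Elsewhere the recursion \<open>v_step\<close> pushes the induction hypothesis through
    \<open>R\<close>, and \<pi> is invariant.\<close>
  have s_le: "\<pi> a * s n y \<le> \<pi> y" for n y
  proof (induction n arbitrary: y)
    case 0
    show ?case
      using mult_left_mono[OF v0[of y] \<pi>0(1)[of a]] \<pi>0(1)[of y]
      by (auto simp: s_def split: if_splits)
  next
    case (Suc n)
    show ?case
    proof (cases "y = a")
      case True
      have "s (Suc n) y = v 0 a"
        using True by (simp add: s_def sum.atMost_Suc_shift va del: sum.atMost_Suc)
      then show ?thesis using v0[of a] True mult_left_mono[of "v 0 a" 1 "\<pi> a"] \<pi>0(1)[of a] by simp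
    next
      case False
      have "v 0 y = 0" using v0[of y] False by (simp add: v_def measure_le_0_iff)
      then have "s (Suc n) y = (\<Sum>k\<le>n. v (Suc k) y)"
        by (simp add: s_def sum.atMost_Suc_shift del: sum.atMost_Suc)
      moreover have "((\<lambda>x. \<Sum>k\<le>n. v k x * R x y) has_sum (\<Sum>k\<le>n. v (Suc k) y)) UNIV"
        using v_step[OF False] by (intro has_sum_sum_finite) auto
      ultimately have "((\<lambda>x. \<pi> a * (s n x * R x y)) has_sum \<pi> a * s (Suc n) y) UNIV"
        by (intro has_sum_cmult_right) (simp add: s_def sum_distrib_right)
      then show ?thesis
        by (rule has_sum_mono[OF _ \<pi>0(3)]) (use Suc R in \<open>auto simp: mult.assoc[symmetric] intro!: mult_right_mono\<close>)
    qed
  qed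
  have partial: "(\<Sum>k\<le>n. measure N {\<omega>\<in>space N. \<forall>j\<in>{1..k}. Z j \<omega> \<noteq> Some a}) \<le> 1 / \<pi> a" for n
  proof -
    have "(s n has_sum (\<Sum>k\<le>n. measure N {\<omega>\<in>space N. \<forall>j\<in>{1..k}. Z j \<omega> \<noteq> Some a})) UNIV"
      unfolding s_def using v_sum by (intro has_sum_sum_finite) auto
    from has_sum_mono[OF has_sum_cmult_right[OF this, of "\<pi> a"] \<pi>0(2)]
    show ?thesis using s_le \<pi> by (simp add: field_simps)
  qed
  have gt: "{\<omega>\<in>space N. enat t < hitting_time Z {a} \<omega>} = {\<omega>\<in>space N. \<forall>j\<in>{1..t}. Z j \<omega> \<noteq> Some a}" for t
    by (auto simp: hitting_time_less_iff)
  have "hitting_time Z {a} \<in> measurable N (count_space UNIV)"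
    by (rule measurable_count_space_enat) (simp only: gt, measurable)
  then have "(\<integral>\<^sup>+ \<omega>. ennreal_of_enat (hitting_time Z {a} \<omega>) \<partial>N) =
      (\<Sum>t. emeasure N {\<omega>\<in>space N. \<forall>j\<in>{1..t}. Z j \<omega> \<noteq> Some a})"
    by (simp add: nn_integral_enat_function gt)
  also have "\<dots> \<le> ennreal (1 / \<pi> a)"
  proof (rule suminf_le_const)
    fix n
    have "(\<Sum>t<n. emeasure N {\<omega>\<in>space N. \<forall>j\<in>{1..t}. Z j \<omega> \<noteq> Some a}) \<le>
      (\<Sum>t\<le>n. emeasure N {\<omega>\<in>space N. \<forall>j\<in>{1..t}. Z j \<omega> \<noteq> Some a})"
      by (intro sum_mono2) auto
    also have "\<dots> = ennreal (\<Sum>t\<le>n. measure N {\<omega>\<in>space N. \<forall>j\<in>{1..t}. Z j \<omega> \<noteq> Some a})"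
      by (simp add: emeasure_eq_measure sum_ennreal)
    also have "\<dots> \<le> ennreal (1 / \<pi> a)" by (intro ennreal_leI partial)
    finally show "(\<Sum>t<n. emeasure N {\<omega>\<in>space N. \<forall>j\<in>{1..t}. Z j \<omega> \<noteq> Some a}) \<le> ennreal (1 / \<pi> a)" .
  qed simp
  also have "\<dots> < \<infinity>" by simp
  finally show ?thesis .
qed

section \<open>Laws of paths\<close>

abbreviation path_space :: "('t \<Rightarrow> 's \<times> real) measure" where
  "path_space \<equiv> PiM UNIV (\<lambda>_. count_space UNIV \<Otimes>\<^sub>M borel)"

text \<open>States are prescribed exactly rather than by sets: with the law at the first time given,
  the probability of a cylinder is then a product of transition probabilities and step laws.\<close>

definition cylinder :: "'t set \<Rightarrow> ('t \<Rightarrow> 's) \<Rightarrow> ('t \<Rightarrow> real set) \<Rightarrow> ('t \<Rightarrow> 's \<times> real) set" where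
  "cylinder J h B = {y. \<forall>k\<in>J. fst (y k) = h k \<and> snd (y k) \<in> B k}"

lemma space_path_space [simp]: "space path_space = UNIV"
  by (auto simp: space_PiM space_pair_measure)

lemma measurable_path_component [measurable]: "(\<lambda>y. y k) \<in> measurable path_space (count_space UNIV \<Otimes>\<^sub>M borel)"
  by (rule measurable_component_singleton) simp

lemma sets_cylinder:
  fixes h :: "'t \<Rightarrow> 's::countable"
  assumes "finite J" "\<And>k. B k \<in> sets borel"
  shows "cylinder J h B \<in> sets path_space"
proof -
  note [measurable] = assms(2)
  have "{y \<in> space path_space. \<forall>k\<in>J. fst (y k) = h k \<and> snd (y k) \<in> B k} \<in> sets path_space"
    using assms(1) by measurable
  then show ?thesis by (simp add: cylinder_def)
qed

text \<open>Exhausting the index set by finite \<open>J n\<close> covers times in the naturals and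
  in the integers alike. Two cylinders over nested index sets either prescribe conflicting states
  and are disjoint, or meet in a cylinder over the larger set; hence the empty set is added to the
  generator. The empty \<open>J 0\<close> makes the whole space a cylinder.\<close>

lemma path_measure_eqI:
  fixes \<mu> \<nu> :: "('t \<Rightarrow> 's::countable \<times> real) measure"
  assumes J: "incseq J" "J 0 = {}" "(\<Union>n. J n) = UNIV" "\<And>n. finite (J n)"
    and sets: "sets \<mu> = sets path_space" "sets \<nu> = sets path_space"
    and fin: "finite_measure \<mu>"
    and eq: "\<And>n h B. (\<And>k. B k \<in> sets borel) \<Longrightarrow> emeasure \<mu> (cylinder (J n) h B) = emeasure \<nu> (cylinder (J n) h B)"
  shows "\<mu> = \<nu>"
proof -
  define G :: "('t \<Rightarrow> 's \<times> real) set set" where "G = insert {} {cylinder (J n) h B |n h B. \<forall>k. B k \<in> sets (borel :: real measure)}"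
  have G_I: "cylinder (J n) h B \<in> G" if "\<And>k. B k \<in> sets borel" for n h B
    using that by (auto simp: G_def)
  have int: "cylinder (J n) h B \<inter> cylinder (J m) h' B' \<in> G"
    if "n \<le> m" and B: "\<And>k. B k \<in> sets borel" "\<And>k. B' k \<in> sets borel" for n m h B h' B'
  proof (cases "\<forall>k\<in>J n. h k = h' k")
    case True
    have sub: "J n \<subseteq> J m" using J(1) that by (auto simp: incseq_def)
    have "cylinder (J n) h B \<inter> cylinder (J m) h' B' =
        cylinder (J m) h' (\<lambda>k. if k \<in> J n then B k \<inter> B' k else B' k)"
      using True sub by (auto simp: cylinder_def; metis)
    then show ?thesis using B by (auto intro!: G_I)
  next
    case False
    then obtain k where "k \<in> J n" "h k \<noteq> h' k" by auto
    moreover have "k \<in> J m" using J(1) \<open>n \<le> m\<close> \<open>k \<in> J n\<close> by (auto simp: incseq_def)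
    ultimately have "cylinder (J n) h B \<inter> cylinder (J m) h' B' = {}" by (auto simp: cylinder_def)
    then show ?thesis by (simp add: G_def)
  qed
  have stable: "Int_stable G"
  proof (rule Int_stableI)
    fix a b assume "a \<in> G" "b \<in> G"
    show "a \<inter> b \<in> G"
    proof (cases "a = {} \<or> b = {}")
      case True
      then show ?thesis by (auto simp: G_def)
    next
      case False
      obtain n h B where a: "a = cylinder (J n) h B" "\<And>k. B k \<in> sets borel"
        using \<open>a \<in> G\<close> False unfolding G_def by blast
      obtain m h' B' where b: "b = cylinder (J m) h' B'" "\<And>k. B' k \<in> sets borel"
        using \<open>b \<in> G\<close> False unfolding G_def by blast
      note * = a b
      show ?thesis
      proof (cases "n \<le> m")
        case True then show ?thesis using int[of n m B B' h h'] * by simp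
      next
        case False then show ?thesis using int[of m n B' B h' h] * by (simp add: Int_commute)
      qed
    qed
  qed
  have G_sub: "G \<subseteq> sets path_space"
    by (auto simp: G_def intro!: sets_cylinder J)
  have "(\<lambda>y. y) \<in> measurable (sigma UNIV G) (path_space :: ('t \<Rightarrow> 's \<times> real) measure)"
  proof (rule measurable_PiM_single')
    fix k :: 't
    obtain n where n: "k \<in> J n" using J(3) by auto
    let ?H = "PiE (J n) (\<lambda>_. UNIV :: 's set)"
    have H: "countable ?H" using J(4) by (rule countable_restricted_functions)
    have rep: "y \<in> cylinder (J n) (restrict (\<lambda>k. fst (y k)) (J n)) B \<longleftrightarrow> (\<forall>k\<in>J n. snd (y k) \<in> B k)"
      for y :: "'t \<Rightarrow> 's \<times> real" and B by (auto simp: cylinder_def)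
    have 1: "{y :: 't \<Rightarrow> 's \<times> real. fst (y k) = a} \<in> sigma_sets UNIV G" for a
    proof -
      \<comment> \<open>The union over all state assignments on \<open>J n\<close> with value
        \<open>a\<close> at \<open>k\<close> lifts the prescription at the other times; it is
        countable because \<open>J n\<close> is finite.\<close>
      have "{y :: 't \<Rightarrow> 's \<times> real. fst (y k) = a} = (\<Union>h\<in>?H \<inter> {h. h k = a}. cylinder (J n) h (\<lambda>_. UNIV))"
      proof (intro equalityI subsetI)
        fix y :: "'t \<Rightarrow> 's \<times> real" assume "y \<in> {y. fst (y k) = a}"
        then show "y \<in> (\<Union>h\<in>?H \<inter> {h. h k = a}. cylinder (J n) h (\<lambda>_. UNIV))"
          using n by (intro UN_I[of "restrict (\<lambda>k. fst (y k)) (J n)"]) (auto simp: rep)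
      qed (use n in \<open>auto simp: cylinder_def\<close>)
      also have "\<dots> \<in> sigma_sets UNIV G"
        by (intro sigma_sets_UNION countable_image countable_Int1 H) (auto intro!: sigma_sets.Basic G_I)
      finally show ?thesis .
    qed
    have 2: "{y :: 't \<Rightarrow> 's \<times> real. snd (y k) \<in> B} \<in> sigma_sets UNIV G" if B: "B \<in> sets borel" for B
    proof -
      let ?B = "(\<lambda>_. UNIV)(k := B)"
      have "{y :: 't \<Rightarrow> 's \<times> real. snd (y k) \<in> B} = (\<Union>h\<in>?H. cylinder (J n) h ?B)"
      proof (intro equalityI subsetI)
        fix y :: "'t \<Rightarrow> 's \<times> real" assume "y \<in> {y. snd (y k) \<in> B}"
        then show "y \<in> (\<Union>h\<in>?H. cylinder (J n) h ?B)"
          by (intro UN_I[of "restrict (\<lambda>k. fst (y k)) (J n)"]) (auto simp: rep)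
      qed (use n in \<open>force simp: cylinder_def\<close>)
      also have "\<dots> \<in> sigma_sets UNIV G"
        by (intro sigma_sets_UNION countable_image H) (auto intro!: sigma_sets.Basic G_I B)
      finally show ?thesis .
    qed
    have m1: "(\<lambda>y :: 't \<Rightarrow> 's \<times> real. fst (y k)) \<in> measurable (sigma UNIV G) (count_space UNIV)"
      by (subst measurable_count_space_eq_countable) (auto simp: vimage_def 1)
    have m2: "(\<lambda>y :: 't \<Rightarrow> 's \<times> real. snd (y k)) \<in> measurable (sigma UNIV G) borel"
      by (rule measurableI) (auto simp: vimage_def 2)
    show "(\<lambda>y :: 't \<Rightarrow> 's \<times> real. y k) \<in> measurable (sigma UNIV G) (count_space UNIV \<Otimes>\<^sub>M borel)"
      using measurable_Pair[OF m1 m2] by simp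
  qed (auto simp: space_pair_measure)
  then have sub: "sets (path_space :: ('t \<Rightarrow> 's \<times> real) measure) \<subseteq> sigma_sets UNIV G"
    by (auto dest: measurable_sets)
  have gen: "sets (path_space :: ('t \<Rightarrow> 's \<times> real) measure) = sigma_sets UNIV G"
  proof
    show "sigma_sets UNIV G \<subseteq> sets path_space"
      using sets.sigma_sets_subset[OF G_sub] by simp
  qed (rule sub)
  have univ: "UNIV \<in> G"
  proof -
    have "cylinder (J 0) undefined (\<lambda>_. UNIV) \<in> G" by (intro G_I) auto
    then show ?thesis by (simp add: cylinder_def J(2))
  qed
  show ?thesis
  proof (rule measure_eqI_generator_eq[OF stable, of UNIV _ _ "\<lambda>_. UNIV"])
    show "emeasure \<mu> X = emeasure \<nu> X" if "X \<in> G" for X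
      using that by (auto simp: G_def intro: eq)
    show "emeasure \<mu> UNIV \<noteq> \<infinity>" for i :: nat
      using finite_measure.emeasure_finite[OF fin, of UNIV] by simp
  qed (use sets gen univ in auto)
qed

section \<open>Ladder epochs and records of a path\<close>

text \<open>Time 0 is vacuously a record. The finite ladder epochs are exactly these times, by
  \<open>forward_record_ladder_epoch\<close> and \<open>ladder_epoch_forward_record\<close>; a
  condition on a single time is easier to compare with two-sided records than the recursion.\<close>

definition forward_record :: "(nat \<Rightarrow> 'w \<Rightarrow> real) \<Rightarrow> nat \<Rightarrow> 'w \<Rightarrow> bool" where
  "forward_record X k \<omega> \<longleftrightarrow> (\<forall>j<k. walk X j \<omega> < walk X k \<omega>)"

lemma ladder_epoch_Suc_eq_iff:
  assumes "ladder_epoch X n \<omega> = enat l"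
  shows "ladder_epoch X (Suc n) \<omega> = enat m \<longleftrightarrow>
    l < m \<and> walk X l \<omega> < walk X m \<omega> \<and> (\<forall>k. l < k \<and> k < m \<longrightarrow> walk X k \<omega> \<le> walk X l \<omega>)"
proof -
  let ?S = "{enat k |k. l < k \<and> walk X l \<omega> < walk X k \<omega>}"
  have "Inf ?S = enat m \<longleftrightarrow> l < m \<and> walk X l \<omega> < walk X m \<omega> \<and> (\<forall>k. l < k \<and> k < m \<longrightarrow> walk X k \<omega> \<le> walk X l \<omega>)"
  proof
    assume *: "Inf ?S = enat m"
    have "?S \<noteq> {}" using * by (metis Inf_empty enat.distinct(1) top_enat_def)
    then have "Inf ?S \<in> ?S" by (rule Inf_enat_mem)
    then have "enat m \<in> ?S" by (simp only: *)
    moreover have "walk X k \<omega> \<le> walk X l \<omega>" if "l < k" "k < m" for k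
    proof (rule ccontr)
      assume "\<not> ?thesis"
      then have "Inf ?S \<le> enat k" using that by (intro Inf_lower) auto
      then show False using * that by simp
    qed
    ultimately show "l < m \<and> walk X l \<omega> < walk X m \<omega> \<and> (\<forall>k. l < k \<and> k < m \<longrightarrow> walk X k \<omega> \<le> walk X l \<omega>)"
      by auto
  next
    assume *: "l < m \<and> walk X l \<omega> < walk X m \<omega> \<and> (\<forall>k. l < k \<and> k < m \<longrightarrow> walk X k \<omega> \<le> walk X l \<omega>)"
    show "Inf ?S = enat m"
    proof (rule antisym)
      show "Inf ?S \<le> enat m" using * by (intro Inf_lower) auto
      show "enat m \<le> Inf ?S"
        using * by (intro Inf_greatest) (auto simp: not_le[symmetric])
    qed
  qed
  then show ?thesis using assms by simp
qed

lemma ladder_epoch_SucE: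
  assumes "ladder_epoch X (Suc n) \<omega> = enat m"
  obtains l where "ladder_epoch X n \<omega> = enat l" "l < m" "walk X l \<omega> < walk X m \<omega>"
    "\<And>k. l < k \<Longrightarrow> k < m \<Longrightarrow> walk X k \<omega> \<le> walk X l \<omega>"
proof (cases "ladder_epoch X n \<omega>")
  case (enat l)
  then show ?thesis using ladder_epoch_Suc_eq_iff[OF enat, of m] assms that by auto
qed (use assms in auto)

text \<open>All quantifiers are bounded by \<open>m\<close>: the event depends only on the walk up
  to time \<open>m\<close>, as its measurability with respect to the past requires.\<close>

lemma ladder_epoch_Suc_eq_iff_ex:
  "ladder_epoch X (Suc n) \<omega> = enat m \<longleftrightarrow>
    (\<exists>l<m. ladder_epoch X n \<omega> = enat l \<and> walk X l \<omega> < walk X m \<omega> \<and>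
      (\<forall>k\<in>{l<..<m}. walk X k \<omega> \<le> walk X l \<omega>))"
proof
  assume "ladder_epoch X (Suc n) \<omega> = enat m"
  then show "\<exists>l<m. ladder_epoch X n \<omega> = enat l \<and> walk X l \<omega> < walk X m \<omega> \<and>
      (\<forall>k\<in>{l<..<m}. walk X k \<omega> \<le> walk X l \<omega>)"
    by (rule ladder_epoch_SucE) auto
next
  assume "\<exists>l<m. ladder_epoch X n \<omega> = enat l \<and> walk X l \<omega> < walk X m \<omega> \<and>
      (\<forall>k\<in>{l<..<m}. walk X k \<omega> \<le> walk X l \<omega>)"
  then obtain l where "l < m" "ladder_epoch X n \<omega> = enat l" "walk X l \<omega> < walk X m \<omega>"
      "\<forall>k\<in>{l<..<m}. walk X k \<omega> \<le> walk X l \<omega>" by auto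
  then show "ladder_epoch X (Suc n) \<omega> = enat m" by (subst ladder_epoch_Suc_eq_iff) auto
qed

lemma forward_record_ladder_epoch:
  "ladder_epoch X n \<omega> = enat m \<Longrightarrow> forward_record X m \<omega>"
proof (induction n arbitrary: m)
  case 0
  then show ?case by (simp add: forward_record_def zero_enat_def)
next
  case (Suc n)
  from Suc.prems obtain l where l: "ladder_epoch X n \<omega> = enat l" "l < m" "walk X l \<omega> < walk X m \<omega>"
    "\<And>k. l < k \<Longrightarrow> k < m \<Longrightarrow> walk X k \<omega> \<le> walk X l \<omega>"
    by (rule ladder_epoch_SucE) blast
  show ?case unfolding forward_record_def
  proof safe
    fix j assume "j < m"
    have "walk X j \<omega> \<le> walk X l \<omega>"
      using l(4)[of j] \<open>j < m\<close> Suc.IH[OF l(1)]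
      by (cases j l rule: linorder_cases) (auto simp: forward_record_def less_imp_le)
    then show "walk X j \<omega> < walk X m \<omega>" using l(3) by simp
  qed
qed

text \<open>The last record \<open>l\<close> before \<open>k\<close> is a ladder epoch by induction.
  In between the walk cannot exceed its value at \<open>l\<close>, because the first time at which
  it did would be a record. So \<open>k\<close> is the next ladder epoch.\<close>

lemma ladder_epoch_forward_record:
  "forward_record X k \<omega> \<Longrightarrow> \<exists>n. ladder_epoch X n \<omega> = enat k"
proof (induction k rule: less_induct)
  case (less k)
  show ?case
  proof (cases "k = 0")
    case True
    then show ?thesis by (intro exI[of _ 0]) (simp add: zero_enat_def)
  next
    case False
    define l where "l = Max {j. j < k \<and> forward_record X j \<omega>}"
    have "l \<in> {j. j < k \<and> forward_record X j \<omega>}"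
      unfolding l_def by (rule Max_in) (use False in \<open>auto simp: forward_record_def intro!: exI[of _ 0]\<close>)
    then have l: "l < k" "forward_record X l \<omega>" by auto
    have l_max: "\<not> forward_record X j \<omega>" if "l < j" "j < k" for j
    proof
      assume "forward_record X j \<omega>"
      then have "j \<le> l" unfolding l_def using that by (intro Max_ge) auto
      then show False using that by simp
    qed
    obtain n where n: "ladder_epoch X n \<omega> = enat l" using less.IH[OF l] by auto
    have below: "walk X j \<omega> \<le> walk X l \<omega>" if "l < j" "j < k" for j
      using that
    proof (induction j rule: less_induct)
      case (less j)
      show ?case
      proof (rule ccontr)
        assume *: "\<not> ?thesis"
        have "forward_record X j \<omega>" unfolding forward_record_def
        proof safe
          fix i assume "i < j"
          have "walk X i \<omega> \<le> walk X l \<omega>"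
            using less.IH[of i] less.prems \<open>i < j\<close> l(2)
            by (cases i l rule: linorder_cases) (auto simp: forward_record_def less_imp_le)
          then show "walk X i \<omega> < walk X j \<omega>" using * by simp
        qed
        then show False using l_max less.prems by auto
      qed
    qed
    have "walk X l \<omega> < walk X k \<omega>" using less.prems l(1) by (simp add: forward_record_def)
    then have "ladder_epoch X (Suc n) \<omega> = enat k"
      unfolding ladder_epoch_Suc_eq_iff[OF n] using l(1) below by auto
    then show ?thesis by blast
  qed
qed

lemma ladder_epoch_finite:
  assumes "\<And>n. \<exists>k>n. forward_record X k \<omega>"
  shows "\<exists>m. ladder_epoch X n \<omega> = enat m"
proof (induction n)
  case 0
  then show ?case by (simp add: zero_enat_def)
next
  case (Suc n)
  then obtain l where l: "ladder_epoch X n \<omega> = enat l" by auto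
  obtain k where k: "l < k" "forward_record X k \<omega>" using assms by auto
  let ?S = "{enat k |k. l < k \<and> walk X l \<omega> < walk X k \<omega>}"
  have "enat k \<in> ?S" using k by (auto simp: forward_record_def)
  then have "Inf ?S \<in> ?S" by (intro Inf_enat_mem) auto
  then have "\<exists>m. Inf ?S = enat m" by auto
  then show ?case using l by simp
qed

lemma walk_cong: "(\<And>k. 1 \<le> k \<Longrightarrow> X k \<omega> = X' k \<omega>') \<Longrightarrow> walk X n \<omega> = walk X' n \<omega>'"
  by (simp add: walk_def)

text \<open>The increment with index 0 never enters, so \<open>forward_path\<close> may alter
  it.\<close>

lemma ladder_epoch_cong:
  assumes "\<And>k. 1 \<le> k \<Longrightarrow> X k \<omega> = X' k \<omega>'"
  shows "ladder_epoch X n \<omega> = ladder_epoch X' n \<omega>'"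
proof (induction n)
  case (Suc n)
  have walk: "walk X m \<omega> = walk X' m \<omega>'" for m using assms by (rule walk_cong)
  show ?case by (simp only: ladder_epoch.simps Suc walk)
qed simp

lemma walk_shift: "walk X (l + k) \<omega> = walk X l \<omega> + walk (\<lambda>k. X (l + k)) k \<omega>"
  by (induction k) (simp_all add: walk_def)

lemma ladder_epoch_1_iff:
  "ladder_epoch X 1 \<omega> = enat m \<longleftrightarrow> 0 < m \<and> forward_record X m \<omega> \<and> (\<forall>k. 0 < k \<and> k < m \<longrightarrow> \<not> forward_record X k \<omega>)"
proof -
  have 0: "ladder_epoch X 0 \<omega> = enat 0" by (simp add: zero_enat_def)
  show ?thesis
  proof
  assume *: "ladder_epoch X 1 \<omega> = enat m"
  note a = * [unfolded One_nat_def ladder_epoch_Suc_eq_iff[OF 0]]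
  then show "0 < m \<and> forward_record X m \<omega> \<and> (\<forall>k. 0 < k \<and> k < m \<longrightarrow> \<not> forward_record X k \<omega>)"
    using forward_record_ladder_epoch[OF *] by (auto simp: forward_record_def leD)
next
  assume *: "0 < m \<and> forward_record X m \<omega> \<and> (\<forall>k. 0 < k \<and> k < m \<longrightarrow> \<not> forward_record X k \<omega>)"
  have below: "walk X k \<omega> \<le> walk X 0 \<omega>" if "k < m" for k
    using that
  proof (induction k rule: less_induct)
    case (less k)
    show ?case
    proof (rule ccontr)
      assume "\<not> ?thesis"
      then have "forward_record X k \<omega>" "0 < k"
        using less by (force simp: forward_record_def, cases k) auto
      then show False using * less.prems by auto
    qed
  qed
  have "walk X 0 \<omega> < walk X m \<omega>" using * by (simp add: forward_record_def)
  then show "ladder_epoch X 1 \<omega> = enat m"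
    unfolding One_nat_def ladder_epoch_Suc_eq_iff[OF 0] using below * by simp
  qed
qed

text \<open>Only differences to the level at \<open>l\<close> matter for the next ladder epoch, so
  it is the first ladder epoch of the walk shifted by \<open>l\<close>. Together with the Markov
  property at fixed times this replaces a strong Markov property.\<close>

lemma ladder_chain_shift:
  assumes n: "ladder_epoch X n \<omega> = enat l"
  shows "ladder_chain M X (Suc n) \<omega> = ladder_chain (\<lambda>k. M (l + k)) (\<lambda>k. X (l + k)) 1 \<omega>"
proof -
  let ?X = "\<lambda>k. X (l + k)"
  have 0: "ladder_epoch ?X 0 \<omega> = enat 0" by (simp add: zero_enat_def)
  have shift: "walk X (l + k) \<omega> = walk X l \<omega> + walk ?X k \<omega>" for k
    by (rule walk_shift)
  have shift0: "walk ?X 0 \<omega> = 0" by (simp add: walk_def)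
  have iff: "ladder_epoch X (Suc n) \<omega> = enat (l + k) \<longleftrightarrow> ladder_epoch ?X 1 \<omega> = enat k" for k
    unfolding ladder_epoch_Suc_eq_iff[OF n] One_nat_def ladder_epoch_Suc_eq_iff[OF 0]
  proof (intro iffI conjI allI impI; (elim conjE)?)
    assume a: "l < l + k" "walk X l \<omega> < walk X (l + k) \<omega>"
      "\<forall>j. l < j \<and> j < l + k \<longrightarrow> walk X j \<omega> \<le> walk X l \<omega>"
    show "0 < k" using a(1) by simp
    show "walk ?X 0 \<omega> < walk ?X k \<omega>" using a(2) shift[of k] shift0 by simp
    fix j assume "0 < j" "j < k"
    then show "walk ?X j \<omega> \<le> walk ?X 0 \<omega>" using a(3)[rule_format, of "l + j"] shift[of j] shift0 by simp
  next
    assume a: "0 < k" "walk ?X 0 \<omega> < walk ?X k \<omega>"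
      "\<forall>j. 0 < j \<and> j < k \<longrightarrow> walk ?X j \<omega> \<le> walk ?X 0 \<omega>"
    show "l < l + k" using a(1) by simp
    show "walk X l \<omega> < walk X (l + k) \<omega>" using a(2) shift[of k] shift0 by simp
    fix j assume "l < j" "j < l + k"
    then show "walk X j \<omega> \<le> walk X l \<omega>"
      using a(3)[rule_format, of "j - l"] shift[of "j - l"] shift0 by simp
  qed
  show ?thesis
  proof (cases "ladder_epoch X (Suc n) \<omega>")
    case (enat m)
    then obtain l' where "ladder_epoch X n \<omega> = enat l'" "l' < m" by (rule ladder_epoch_SucE) blast
    then have "l < m" using n by simp
    then obtain k where k: "m = l + k" using less_imp_add_positive by blast
    then show ?thesis using enat iff[of k] k by (simp add: ladder_chain_def del: ladder_epoch.simps)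
  next
    case infinity
    have "ladder_epoch ?X 1 \<omega> \<noteq> enat k" for k using iff[of k] infinity by (auto simp del: ladder_epoch.simps)
    then have "ladder_epoch ?X 1 \<omega> = \<infinity>" by (cases "ladder_epoch ?X 1 \<omega>") auto
    then show ?thesis using infinity by (simp add: ladder_chain_def del: ladder_epoch.simps)
  qed
qed

text \<open>Sums of increments instead of values of the walk, so that the notion commutes with time
  shifts (\<open>past_record_shift\<close>). It demands less than \<open>two_sided_record\<close>,
  where the supremum over the past must be exceeded; \<open>two_sided_record_iff\<close> closes the
  gap.\<close>

definition past_record :: "(int \<Rightarrow> real) \<Rightarrow> int \<Rightarrow> bool" where
  "past_record x k \<longleftrightarrow> (\<forall>j<k. 0 < sum x {j<..k})"

lemma sum_int_split:
  fixes x :: "int \<Rightarrow> real"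
  assumes "j \<le> l" "l \<le> k"
  shows "sum x {j<..k} = sum x {j<..l} + sum x {l<..k}"
proof -
  have "{j<..k} = {j<..l} \<union> {l<..k}" using assms by auto
  then show ?thesis by (auto intro!: sum.union_disjoint)
qed

lemma walk_two_sided: "walk (\<lambda>k. X (m + int k)) n \<omega> = (\<Sum>k\<in>{m<..m + int n}. X k \<omega>)"
proof (induction n)
  case (Suc n)
  have "{m<..m + int (Suc n)} = insert (m + int (Suc n)) {m<..m + int n}" by auto
  then show ?case using Suc by (simp add: walk_def)
qed (simp add: walk_def)

lemma two_sided_walk_diff:
  assumes "j \<le> k"
  shows "two_sided_walk X k \<omega> - two_sided_walk X j \<omega> = (\<Sum>l\<in>{j<..k}. X l \<omega>)"
proof -
  have iv: "{n + 1..k} = {n<..k}" for n k :: int by auto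
  have iv1: "{1..k} = {0<..k}" for k :: int by auto
  show ?thesis
    using assms sum_int_split[of j 0 k "\<lambda>l. X l \<omega>"] sum_int_split[of 0 j k "\<lambda>l. X l \<omega>"]
      sum_int_split[of j k 0 "\<lambda>l. X l \<omega>"]
    by (auto simp: two_sided_walk_def iv iv1)
qed

lemma past_record_iff: "past_record (\<lambda>k. X k \<omega>) k \<longleftrightarrow> (\<forall>j<k. two_sided_walk X j \<omega> < two_sided_walk X k \<omega>)"
proof -
  have "0 < (\<Sum>l\<in>{j<..k}. X l \<omega>) \<longleftrightarrow> two_sided_walk X j \<omega> < two_sided_walk X k \<omega>" if "j < k" for j
    using two_sided_walk_diff[of j k X \<omega>] that by auto
  then show ?thesis by (auto simp: past_record_def)
qed

lemma past_record_shift: "past_record (\<lambda>k. x (m + k)) k \<longleftrightarrow> past_record x (m + k)"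
proof -
  have "sum (\<lambda>k. x (m + k)) {j<..k} = sum x {m + j<..m + k}" for j
    by (rule sum.reindex_bij_witness[where i = "\<lambda>i. i - m" and j = "\<lambda>i. m + i"]) auto
  moreover have "(\<forall>j<m + k. P j) \<longleftrightarrow> (\<forall>j<k. P (m + j))" for P :: "int \<Rightarrow> bool"
  proof safe
    fix j assume "\<forall>j<k. P (m + j)" "j < m + k"
    then have "P (m + (j - m))" by (metis add.commute less_diff_eq diff_less_eq)
    then show "P j" by simp
  qed simp
  ultimately show ?thesis by (simp add: past_record_def)
qed

text \<open>A past record at \<open>m + int r\<close> is above all earlier times, in particular
  above the stretch before \<open>m\<close> that the forward walk does not see. A forward record
  from \<open>r\<close> on is at least as high, hence above that stretch as well.\<close>

lemma forward_record_iff_past_record: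
  assumes "past_record (\<lambda>k. X k \<omega>) (m + int r)" "r \<le> n"
  shows "forward_record (\<lambda>k. X (m + int k)) n \<omega> \<longleftrightarrow> past_record (\<lambda>k. X k \<omega>) (m + int n)"
proof -
  let ?x = "\<lambda>k. X k \<omega>" and ?X = "\<lambda>k. X (m + int k)"
  have diff: "walk ?X n \<omega> - walk ?X j \<omega> = sum ?x {m + int j<..m + int n}" if "j \<le> n" for j
    using sum_int_split[of m "m + int j" "m + int n" ?x] that by (simp add: walk_two_sided)
  show ?thesis
  proof
    assume *: "past_record ?x (m + int n)"
    show "forward_record ?X n \<omega>" unfolding forward_record_def
    proof safe
      fix j assume "j < n"
      then have "0 < sum ?x {m + int j<..m + int n}" using * by (simp add: past_record_def)
      then show "walk ?X j \<omega> < walk ?X n \<omega>" using diff[of j] \<open>j < n\<close> by simp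
    qed
  next
    assume *: "forward_record ?X n \<omega>"
    have pos: "0 < sum ?x {m + int j<..m + int n}" if "j < n" for j
    proof -
      have "walk ?X j \<omega> < walk ?X n \<omega>" using * that by (simp add: forward_record_def)
      then show ?thesis using diff[of j] that by linarith
    qed
    show "past_record ?x (m + int n)" unfolding past_record_def
    proof safe
      fix j assume j: "j < m + int n"
      show "0 < sum ?x {j<..m + int n}"
      proof (cases "m \<le> j")
        case True
        then show ?thesis using pos[of "nat (j - m)"] j by simp
      next
        case False
        have "0 < sum ?x {j<..m + int r}" using assms(1) False by (simp add: past_record_def)
        moreover have "0 \<le> sum ?x {m + int r<..m + int n}"
          using pos[of r] assms(2) by (cases "r = n") auto
        ultimately show ?thesis
          using sum_int_split[of j "m + int r" "m + int n" ?x] False assms(2) by simp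
      qed
    qed
  qed
qed

lemma past_record_imp_forward_record:
  "past_record (\<lambda>k. X k \<omega>) (m + int n) \<Longrightarrow> forward_record (\<lambda>k. X (m + int k)) n \<omega>"
  using forward_record_iff_past_record[of X \<omega> m n n] by simp

lemma dual_divergent_below:
  assumes "filterlim (\<lambda>n. dual_walk X (int n) \<omega>) at_top sequentially"
  obtains n :: nat where "\<And>j. j \<le> - int n \<Longrightarrow> two_sided_walk X j \<omega> \<le> a"
proof -
  have "eventually (\<lambda>n. - a \<le> dual_walk X (int n) \<omega>) sequentially"
    using assms by (simp add: filterlim_at_top)
  then obtain n where n: "\<And>k. n \<le> k \<Longrightarrow> - a \<le> dual_walk X (int k) \<omega>"
    by (auto simp: eventually_sequentially)
  have "two_sided_walk X j \<omega> \<le> a" if "j \<le> - int n" for j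
    using n[of "nat (- j)"] that by (simp add: dual_walk_def)
  then show ?thesis by (rule that)
qed

text \<open>In the far past the walk is at most S_k - 1, so the supremum over the past is governed
  by that bound and finitely many values; being above each value then means being above the
  supremum.\<close>

lemma two_sided_record_iff:
  assumes "filterlim (\<lambda>n. dual_walk X (int n) \<omega>) at_top sequentially"
  shows "two_sided_record X \<omega> k \<longleftrightarrow> past_record (\<lambda>k. X k \<omega>) k"
  unfolding past_record_iff
proof
  let ?S = "\<lambda>j. two_sided_walk X j \<omega>"
  assume *: "two_sided_record X \<omega> k"
  show "\<forall>j<k. ?S j < ?S k"
  proof safe
    fix j assume "j < k"
    then have "ereal (?S j) \<le> (SUP j\<in>{..<k}. ereal (?S j))" by (intro SUP_upper) auto
    then show "?S j < ?S k" using * 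
      unfolding two_sided_record_def by (metis le_less_trans less_ereal.simps(1))
  qed
next
  let ?S = "\<lambda>j. two_sided_walk X j \<omega>"
  assume *: "\<forall>j<k. ?S j < ?S k"
  obtain n :: nat where n: "\<And>j. j \<le> - int n \<Longrightarrow> ?S j \<le> ?S k - 1"
    using dual_divergent_below[OF assms, of "?S k - 1"] by blast
  define b where "b = Max (insert (?S k - 1) (?S ` {- int n..<k}))"
  have "b < ?S k" unfolding b_def using * by (subst Max_less_iff) auto
  have "?S j \<le> b" if "j < k" for j
  proof (cases "j \<le> - int n")
    case True
    then have "?S j \<le> ?S k - 1" by (rule n)
    also have "\<dots> \<le> b" unfolding b_def by (rule Max_ge) auto
    finally show ?thesis .
  next
    case False
    then show ?thesis unfolding b_def using that by (intro Max_ge) auto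
  qed
  then have "(SUP j\<in>{..<k}. ereal (?S j)) \<le> ereal b" by (intro SUP_least) auto
  also have "\<dots> < ereal (?S k)" using \<open>b < ?S k\<close> by simp
  finally show "two_sided_record X \<omega> k" by (simp add: two_sided_record_def)
qed

text \<open>Far back the walk is below its value at 0, so its maximum over times up to 0 is attained
  in a finite window. The earliest maximiser is a record; taking the earliest makes the inequalities
  strict.\<close>

lemma past_record_exists:
  assumes "filterlim (\<lambda>n. dual_walk X (int n) \<omega>) at_top sequentially"
  shows "\<exists>k\<le>0. past_record (\<lambda>k. X k \<omega>) k"
proof -
  let ?S = "\<lambda>j. two_sided_walk X j \<omega>"
  obtain n :: nat where n: "\<And>j. j \<le> - int n \<Longrightarrow> ?S j \<le> ?S 0 - 1"
    using dual_divergent_below[OF assms, of "?S 0 - 1"] by blast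
  define m where "m = Max (?S ` {- int n..0})"
  have "m \<in> ?S ` {- int n..0}" unfolding m_def by (intro Max_in) auto
  then have ne: "{k\<in>{- int n..0}. ?S k = m} \<noteq> {}" by auto
  define k where "k = Min {k\<in>{- int n..0}. ?S k = m}"
  have "k \<in> {k\<in>{- int n..0}. ?S k = m}" 
    unfolding k_def by (rule Min_in[OF _ ne]) (rule finite_subset[of _ "{- int n..0}"], auto)
  then have k: "- int n \<le> k" "k \<le> 0" "?S k = m" by auto
  have "?S j < m" if "j < k" for j
  proof (cases "- int n \<le> j")
    case True
    have "?S j \<le> m" unfolding m_def using True that k by (intro Max_ge) auto
    moreover have "?S j \<noteq> m"
    proof
      assume "?S j = m"
      then have "k \<le> j" unfolding k_def using True that k
        by (intro Min_le) (auto intro: finite_subset[of _ "{- int n..0}"])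
      then show False using that by simp
    qed
    ultimately show ?thesis by simp
  next
    case False
    then have "?S j \<le> ?S 0 - 1" by (intro n) auto
    moreover have "?S 0 \<le> m" unfolding m_def by (intro Max_ge) auto
    ultimately show ?thesis by simp
  qed
  then show ?thesis using k by (intro exI[of _ k]) (simp add: past_record_iff)
qed

section \<open>The Markov property of the two-sided walk\<close>

lemma measurable_walk:
  assumes "\<And>k. 1 \<le> k \<Longrightarrow> k \<le> n \<Longrightarrow> X k \<in> borel_measurable N"
  shows "walk X n \<in> borel_measurable N"
proof -
  have "walk X n = (\<lambda>\<omega>. \<Sum>k=1..n. X k \<omega>)" by (simp add: fun_eq_iff walk_def)
  then show ?thesis using assms by simp
qed

text \<open>Measurability is assumed only for the increments up to \<open>m\<close>, so that
  \<open>N\<close> can be the past algebra at time \<open>m\<close>.\<close>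

lemma pred_ladder_epoch_eq:
  assumes "\<And>k. 1 \<le> k \<Longrightarrow> k \<le> m \<Longrightarrow> X k \<in> borel_measurable N"
  shows "Measurable.pred N (\<lambda>\<omega>. ladder_epoch X n \<omega> = enat m)"
  using assms
proof (induction n arbitrary: m)
  case 0
  then show ?case by simp
next
  case (Suc n)
  have [measurable]: "Measurable.pred N (\<lambda>\<omega>. ladder_epoch X n \<omega> = enat l)" if "l \<in> {..<m}" for l
    using Suc.prems that by (intro Suc.IH) auto
  have W: "walk X k \<in> borel_measurable N" if "k \<le> m" for k
    using Suc.prems that by (intro measurable_walk) auto
  have [measurable]: "Measurable.pred N (\<lambda>\<omega>. walk X l \<omega> < walk X m \<omega>)" if "l \<in> {..<m}" for l
  proof -
    have [measurable]: "walk X l \<in> borel_measurable N" "walk X m \<in> borel_measurable N" using W that by auto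
    show ?thesis by measurable
  qed
  have [measurable]: "Measurable.pred N (\<lambda>\<omega>. walk X k \<omega> \<le> walk X l \<omega>)" if "l \<in> {..<m}" "k \<in> {l<..<m}" for l k
  proof -
    have [measurable]: "walk X l \<in> borel_measurable N" "walk X k \<in> borel_measurable N" using W that by auto
    show ?thesis by measurable
  qed
  have "Measurable.pred N (\<lambda>\<omega>. \<exists>l\<in>{..<m}. ladder_epoch X n \<omega> = enat l \<and> walk X l \<omega> < walk X m \<omega> \<and>
      (\<forall>k\<in>{l<..<m}. walk X k \<omega> \<le> walk X l \<omega>))"
    by (intro pred_intros_finite pred_intros_logic) (auto, measurable)
  then show ?case by (simp only: ladder_epoch_Suc_eq_iff_ex Bex_def lessThan_iff)
qed

lemma pred_forward_record:
  assumes "\<And>k. 1 \<le> k \<Longrightarrow> k \<le> m \<Longrightarrow> X k \<in> borel_measurable N"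
  shows "Measurable.pred N (forward_record X m)"
proof -
  have W: "walk X k \<in> borel_measurable N" if "k \<le> m" for k
    using assms that by (intro measurable_walk) auto
  have "Measurable.pred N (\<lambda>\<omega>. walk X k \<omega> < walk X m \<omega>)" if "k \<in> {..<m}" for k
  proof -
    have [measurable]: "walk X k \<in> borel_measurable N" "walk X m \<in> borel_measurable N" using W that by auto
    show ?thesis by measurable
  qed
  then have "Measurable.pred N (\<lambda>\<omega>. \<forall>k\<in>{..<m}. walk X k \<omega> < walk X m \<omega>)"
    by (intro pred_intros_finite) auto
  moreover have "forward_record X m = (\<lambda>\<omega>. \<forall>k\<in>{..<m}. walk X k \<omega> < walk X m \<omega>)"
    by (simp add: fun_eq_iff forward_record_def Ball_def)
  ultimately show ?thesis by simp
qed

lemma ladder_chain_eq_Some_iff: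
  "ladder_chain M X n \<omega> = Some j \<longleftrightarrow> (\<exists>m. ladder_epoch X n \<omega> = enat m \<and> M m \<omega> = j)"
  by (cases "ladder_epoch X n \<omega>") (simp_all add: ladder_chain_def)

lemma measurable_ladder_chain:
  fixes M :: "nat \<Rightarrow> 'w \<Rightarrow> 's::countable"
  assumes X: "\<And>k. 1 \<le> k \<Longrightarrow> X k \<in> borel_measurable N"
    and [measurable]: "\<And>k. M k \<in> measurable N (count_space UNIV)"
  shows "ladder_chain M X n \<in> measurable N (count_space UNIV)"
proof (subst measurable_count_space_eq_countable, simp, safe)
  have [measurable]: "Measurable.pred N (\<lambda>\<omega>. ladder_epoch X n \<omega> = enat m)" for m
    using X by (intro pred_ladder_epoch_eq) auto
  have Some: "{\<omega>\<in>space N. \<exists>m. ladder_epoch X n \<omega> = enat m \<and> M m \<omega> = j} \<in> sets N" for j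
    by measurable
  have None: "{\<omega>\<in>space N. \<forall>m. ladder_epoch X n \<omega> \<noteq> enat m} \<in> sets N"
    by measurable
  fix a
  show "ladder_chain M X n -` {a} \<inter> space N \<in> sets N"
  proof (cases a)
    case (Some j)
    have "ladder_chain M X n -` {a} \<inter> space N = {\<omega>\<in>space N. \<exists>m. ladder_epoch X n \<omega> = enat m \<and> M m \<omega> = j}"
      by (auto simp: Some ladder_chain_eq_Some_iff)
    then show ?thesis using \<open>\<And>j. _ j \<in> sets N\<close> by simp
  next
    case None
    have "ladder_chain M X n -` {a} \<inter> space N = {\<omega>\<in>space N. \<forall>m. ladder_epoch X n \<omega> \<noteq> enat m}"
      by (auto simp: None ladder_chain_def split: enat.splits)
    then show ?thesis using \<open>{\<omega>\<in>space N. \<forall>m. ladder_epoch X n \<omega> \<noteq> enat m} \<in> sets N\<close> by simp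
  qed
qed auto

text \<open>The entry 0 replaces the increment with index 0, which is not part of the walk and need not be
  measurable.\<close>
definition forward_path :: "(nat \<Rightarrow> 'w \<Rightarrow> 's) \<Rightarrow> (nat \<Rightarrow> 'w \<Rightarrow> real) \<Rightarrow> 'w \<Rightarrow> nat \<Rightarrow> 's \<times> real" where
  "forward_path M X \<omega> k = (M k \<omega>, if k = 0 then 0 else X k \<omega>)"

abbreviation path_state :: "'t \<Rightarrow> ('t \<Rightarrow> 's \<times> real) \<Rightarrow> 's" where
  "path_state k y \<equiv> fst (y k)"

abbreviation path_increment :: "'t \<Rightarrow> ('t \<Rightarrow> 's \<times> real) \<Rightarrow> real" where
  "path_increment k y \<equiv> snd (y k)"

lemma ladder_epoch_forward_path:
  "ladder_epoch path_increment n (forward_path M X \<omega>) = ladder_epoch X n \<omega>"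
  by (rule ladder_epoch_cong) (simp add: forward_path_def)

lemma ladder_chain_forward_path:
  "ladder_chain path_state path_increment n (forward_path M X \<omega>) = ladder_chain M X n \<omega>"
  by (cases "ladder_epoch X n \<omega>") (simp_all add: ladder_chain_def ladder_epoch_forward_path, simp add: forward_path_def)

lemma forward_record_forward_path:
  "forward_record path_increment n (forward_path M X \<omega>) = forward_record X n \<omega>"
proof -
  have "walk path_increment k (forward_path M X \<omega>) = walk X k \<omega>" for k
    by (rule walk_cong) (simp add: forward_path_def)
  then show ?thesis by (simp add: forward_record_def)
qed

lemma measurable_forward_path:
  fixes M :: "nat \<Rightarrow> 'w \<Rightarrow> 's::countable"
  assumes X: "\<And>k. 1 \<le> k \<Longrightarrow> X k \<in> borel_measurable N"
    and [measurable]: "\<And>k. M k \<in> measurable N (count_space UNIV)"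
  shows "forward_path M X \<in> measurable N path_space"
proof (rule measurable_PiM_single')
  fix k :: nat
  have "(\<lambda>\<omega>. if k = 0 then 0 else X k \<omega>) \<in> borel_measurable N"
    using X[of k] by (cases "k = 0") auto
  then show "(\<lambda>\<omega>. forward_path M X \<omega> k) \<in> measurable N (count_space UNIV \<Otimes>\<^sub>M borel)"
    unfolding forward_path_def by measurable
qed (auto simp: space_pair_measure)

lemma subalgebra_sigma:
  assumes "G \<subseteq> sets N"
  shows "subalgebra N (sigma (space N) G)"
proof -
  have "G \<subseteq> Pow (space N)" using assms sets.sets_into_space by blast
  then show ?thesis using assms by (simp add: subalgebra_def sets.sigma_sets_subset space_measure_of_conv)
qed

section \<open>The one-sided and the two-sided walk together\<close>

locale dual_divergent_mrw =
  fixes p :: "'s::countable \<Rightarrow> 's \<Rightarrow> real"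
    and F :: "'s \<Rightarrow> 's \<Rightarrow> real measure"
    and \<pi> :: "'s \<Rightarrow> real"
    and Pr :: "'s \<Rightarrow> 'w measure"
    and M :: "nat \<Rightarrow> 'w \<Rightarrow> 's" and X :: "nat \<Rightarrow> 'w \<Rightarrow> real"
    and \<xi> :: "('s \<times> real) measure"
    and N :: "'v measure"
    and M' :: "int \<Rightarrow> 'v \<Rightarrow> 's" and X' :: "int \<Rightarrow> 'v \<Rightarrow> real"
  assumes mrw: "markov_random_walk p F Pr M X"
    and pos_rec: "positive_recurrent_on UNIV p Pr (\<lambda>n \<omega>. Some (M n \<omega>))"
    and \<pi>: "stationary_distribution p \<pi>"
    and two_sided: "two_sided_stationary p F \<xi> N M' X'"
    and divergent: "AE \<omega> in N. filterlim (\<lambda>n. dual_walk X' (int n) \<omega>) at_top sequentially"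
begin

sublocale N: prob_space N
  using two_sided by (simp add: two_sided_stationary_def)

lemma prob_Pr: "prob_space (Pr i)"
  using mrw by (simp add: markov_random_walk_def markov_chain_from_def)

lemma measurable_M [measurable]: "M k \<in> measurable (Pr i) (count_space UNIV)"
  using mrw by (simp add: markov_random_walk_def)

lemma measurable_X: "1 \<le> k \<Longrightarrow> X k \<in> borel_measurable (Pr i)"
  using mrw by (simp add: markov_random_walk_def)

lemma measurable_M' [measurable]: "M' k \<in> measurable N (count_space UNIV)"
  using two_sided by (simp add: two_sided_stationary_def)

lemma measurable_X' [measurable]: "X' k \<in> borel_measurable N"
  using two_sided by (simp add: two_sided_stationary_def)

lemma p_nonneg: "0 \<le> p i j"
  using mrw by (simp add: markov_random_walk_def stochastic_on_def)

definition path_weight :: "(nat \<Rightarrow> 's) \<Rightarrow> (nat \<Rightarrow> real set) \<Rightarrow> nat \<Rightarrow> real" where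
  "path_weight h B n = (\<Prod>k=1..n. p (h (k - 1)) (h k) * measure (F (h (k - 1)) (h k)) (B k))"

definition path_law :: "'s \<Rightarrow> (nat \<Rightarrow> 's \<times> real) measure" where
  "path_law i = distr (Pr i) path_space (forward_path M X)"

lemma measurable_path [measurable]: "forward_path M X \<in> measurable (Pr i) path_space"
  by (intro measurable_forward_path measurable_X measurable_M)

lemma measure_driving_path:
  "measure (Pr i) {\<omega>\<in>space (Pr i). \<forall>k\<le>n. M k \<omega> = h k} = of_bool (h 0 = i) * (\<Prod>k=1..n. p (h (k - 1)) (h k))"
proof (induction n)
  case 0
  interpret prob_space "Pr i" by (rule prob_Pr)
  have M0: "AE \<omega> in Pr i. M 0 \<omega> = i"
    using mrw by (simp add: markov_random_walk_def markov_chain_from_def)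
  show ?case
  proof (cases "h 0 = i")
    case True
    then show ?thesis using M0 by (simp add: prob_eq_1)
  next
    case False
    have "AE \<omega> in Pr i. M 0 \<omega> \<noteq> h 0" using M0 by eventually_elim (use False in auto)
    then show ?thesis using False by (simp add: prob_eq_0)
  qed
next
  case (Suc n)
  have "measure (Pr i) {\<omega>\<in>space (Pr i). \<forall>k\<le>Suc n. Some (M k \<omega>) = Some (h k)} =
      measure (Pr i) {\<omega>\<in>space (Pr i). \<forall>k\<le>n. Some (M k \<omega>) = Some (h k)} * p (h n) (h (Suc n))"
    using mrw unfolding markov_random_walk_def markov_chain_from_def by blast
  then show ?case using Suc by simp
qed

text \<open>On the event that fixes the states up to \<open>n\<close> the conditional probability
  given the driving chain is a constant product of step laws, so integrating over that event just
  multiplies its probability.\<close>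

lemma measure_forward_cylinder:
  assumes B: "\<And>k. B k \<in> sets borel"
  shows "measure (Pr i) {\<omega>\<in>space (Pr i). \<forall>k\<le>n. M k \<omega> = h k \<and> (k \<noteq> 0 \<longrightarrow> X k \<omega> \<in> B k)} =
    of_bool (h 0 = i) * path_weight h B n"
proof -
  interpret prob_space "Pr i" by (rule prob_Pr)
  let ?C = "chain_algebra (Pr i) M"
  let ?G = "{M k -` {j} \<inter> space (Pr i) | k j. True}"
  have "?G \<subseteq> sets (Pr i)" by auto
  then have sub: "subalgebra (Pr i) ?C"
    unfolding chain_algebra_def by (rule subalgebra_sigma)
  interpret finite_measure_subalgebra "Pr i" ?C
    by standard (rule sub)
  let ?A = "{\<omega>\<in>space (Pr i). \<forall>k\<le>n. M k \<omega> = h k}"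
  let ?E = "{\<omega>\<in>space (Pr i). \<forall>k\<in>{1..n}. X k \<omega> \<in> B k}"
  have A: "?A \<in> sets ?C"
  proof -
    have "?A = (\<Inter>k\<in>{..n}. M k -` {h k} \<inter> space (Pr i))" by auto
    also have "\<dots> \<in> sets ?C" unfolding chain_algebra_def
      by (intro sets.finite_INT) (auto intro!: in_measure_of)
    finally show ?thesis .
  qed
  have A': "?A \<in> sets (Pr i)" by measurable
  have E: "?E \<in> sets (Pr i)"
  proof -
    have "Measurable.pred (Pr i) (\<lambda>\<omega>. X k \<omega> \<in> B k)" if "k \<in> {1..n}" for k
      using measurable_X[of k i] B that by (auto intro: measurable_sets pred_sets2)
    then have "Measurable.pred (Pr i) (\<lambda>\<omega>. \<forall>k\<in>{1..n}. X k \<omega> \<in> B k)"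
      by (intro pred_intros_finite) auto
    then show ?thesis by (rule predE)
  qed
  have ce: "AE \<omega> in Pr i. real_cond_exp (Pr i) ?C (indicator ?E) \<omega> =
      (\<Prod>k=1..n. measure (F (M (k - 1) \<omega>) (M k \<omega>)) (B k))"
    using mrw B unfolding markov_random_walk_def by blast
  let ?w = "\<Prod>k=1..n. measure (F (h (k - 1)) (h k)) (B k)"
  have "measure (Pr i) (?A \<inter> ?E) = (\<integral>\<omega>. indicator (?A \<inter> ?E) \<omega> \<partial>Pr i)"
    using A' E by simp
  also have "\<dots> = (\<integral>\<omega>\<in>?A. indicator ?E \<omega> \<partial>Pr i)"
    unfolding set_lebesgue_integral_def
    by (intro Bochner_Integration.integral_cong) (auto split: split_indicator)
  also have "\<dots> = (\<integral>\<omega>\<in>?A. real_cond_exp (Pr i) ?C (indicator ?E) \<omega> \<partial>Pr i)"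
    by (rule real_cond_exp_intA[OF integrable_real_indicator[OF E] A]) (simp add: emeasure_eq_measure)
  also have "\<dots> = (\<integral>\<omega>. indicator ?A \<omega> * ?w \<partial>Pr i)"
    unfolding set_lebesgue_integral_def
  proof (rule integral_cong_AE)
    show "AE \<omega> in Pr i. indicator ?A \<omega> *\<^sub>R real_cond_exp (Pr i) ?C (indicator ?E) \<omega> = indicator ?A \<omega> * ?w"
      using ce
    proof eventually_elim
      case (elim \<omega>)
      show ?case
      proof (cases "\<omega> \<in> ?A")
        case True
        then have "(\<Prod>k=1..n. measure (F (M (k - 1) \<omega>) (M k \<omega>)) (B k)) = ?w"
          by (intro prod.cong) auto
        then show ?thesis using elim by simp
      qed simp
    qed
  qed (use A' in measurable)
  also have "\<dots> = measure (Pr i) ?A * ?w" using A' by simp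
  also have "?A \<inter> ?E = {\<omega>\<in>space (Pr i). \<forall>k\<le>n. M k \<omega> = h k \<and> (k \<noteq> 0 \<longrightarrow> X k \<omega> \<in> B k)}"
    by (auto simp: Suc_le_eq)
  finally show ?thesis
    by (simp add: measure_driving_path path_weight_def prod.distrib)
qed

text \<open>The condition \<open>0 \<in> B 0\<close> comes from the entry 0 that
  \<open>forward_path\<close> puts at index 0.\<close>

lemma emeasure_path_law_cylinder:
  assumes B: "\<And>k. B k \<in> sets borel"
  shows "emeasure (path_law i) (cylinder {..<Suc n} h B) =
    ennreal (of_bool (h 0 = i \<and> 0 \<in> B 0) * path_weight h B n)"
proof -
  interpret prob_space "Pr i" by (rule prob_Pr)
  have c: "cylinder {..<Suc n} h B \<in> sets path_space" using B by (intro sets_cylinder) auto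
  have "emeasure (path_law i) (cylinder {..<Suc n} h B) =
      measure (Pr i) (forward_path M X -` cylinder {..<Suc n} h B \<inter> space (Pr i))"
    unfolding path_law_def using c by (simp add: emeasure_distr emeasure_eq_measure)
  also have "forward_path M X -` cylinder {..<Suc n} h B \<inter> space (Pr i) =
      (if 0 \<in> B 0 then {\<omega>\<in>space (Pr i). \<forall>k\<le>n. M k \<omega> = h k \<and> (k \<noteq> 0 \<longrightarrow> X k \<omega> \<in> B k)} else {})"
    by (auto simp: cylinder_def forward_path_def less_Suc_eq_le split: if_splits)
  finally show ?thesis using measure_forward_cylinder[OF B, of i n h] by (simp split: if_splits)
qed

lemma past_algebra_subalgebra: "subalgebra N (past_algebra N M' X' n)"
proof -
  have "{M' k -` {j} \<inter> space N | k j. k \<le> n} \<union> {X' k -` B \<inter> space N | k B. k \<le> n \<and> B \<in> sets borel} \<subseteq> sets N"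
    by auto
  then show ?thesis
    unfolding past_algebra_def by (rule subalgebra_sigma)
qed

lemma space_past [simp]: "space (past_algebra N M' X' n) = space N"
  using past_algebra_subalgebra by (simp add: subalgebra_def)

lemma sets_past: "A \<in> sets (past_algebra N M' X' n) \<Longrightarrow> A \<in> sets N"
  using past_algebra_subalgebra by (auto simp: subalgebra_def)

lemma sets_past_iff:
  "sets (past_algebra N M' X' n) = sigma_sets (space N) ({M' k -` {j} \<inter> space N | k j. k \<le> n} \<union>
      {X' k -` B \<inter> space N | k B. k \<le> n \<and> B \<in> sets borel})"
  unfolding past_algebra_def by (rule sets_measure_of) auto

lemma measurable_M'_past: "k \<le> n \<Longrightarrow> M' k \<in> measurable (past_algebra N M' X' n) (count_space UNIV)"
  by (subst measurable_count_space_eq_countable) (auto simp: sets_past_iff intro!: sigma_sets.Basic)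

lemma measurable_X'_past: "k \<le> n \<Longrightarrow> X' k \<in> borel_measurable (past_algebra N M' X' n)"
  by (rule measurableI) (auto simp: sets_past_iff intro!: sigma_sets.Basic)

lemma sets_past_mono:
  assumes "n \<le> m"
  shows "sets (past_algebra N M' X' n) \<subseteq> sets (past_algebra N M' X' m)"
  unfolding sets_past_iff
proof (intro sigma_sets_mono' Un_mono subsetI; (elim CollectE exE conjE)?)
  fix A k j assume "A = M' k -` {j} \<inter> space N" "k \<le> n"
  then show "A \<in> {M' k -` {j} \<inter> space N |k j. k \<le> m}" using assms order_trans by blast
next
  fix A k B assume "A = X' k -` B \<inter> space N" "k \<le> n" "B \<in> sets borel"
  then show "A \<in> {X' k -` B \<inter> space N |k B. k \<le> m \<and> B \<in> sets borel}"
    using assms order_trans by blast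
qed

text \<open>Fixing the state at time \<open>n\<close> turns the kernel in the conditional
  probability into a constant.\<close>

lemma measure_two_sided_step:
  assumes A: "A \<in> sets (past_algebra N M' X' n)" and B: "B \<in> sets borel"
  shows "measure N (A \<inter> {\<omega>\<in>space N. M' n \<omega> = i} \<inter> {\<omega>\<in>space N. M' (n + 1) \<omega> = j \<and> X' (n + 1) \<omega> \<in> B}) =
    measure N (A \<inter> {\<omega>\<in>space N. M' n \<omega> = i}) * (p i j * measure (F i j) B)"
proof -
  let ?C = "past_algebra N M' X' n"
  interpret finite_measure_subalgebra N ?C
    by standard (rule past_algebra_subalgebra)
  let ?A = "A \<inter> {\<omega>\<in>space N. M' n \<omega> = i}"
  let ?E = "{\<omega>\<in>space N. M' (n + 1) \<omega> = j \<and> X' (n + 1) \<omega> \<in> B}"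
  have "{\<omega>\<in>space ?C. M' n \<omega> = i} \<in> sets ?C"
    using measurable_M'_past[of n n] by measurable
  then have A: "?A \<in> sets ?C" using A by auto
  have A': "?A \<in> sets N" using A by (rule sets_past)
  have E: "?E \<in> sets N" using B by measurable
  have ce: "AE \<omega> in N. real_cond_exp N ?C (indicator ?E) \<omega> = mrw_kernel p F (M' n \<omega>, X' n \<omega>) j B"
    using two_sided B unfolding two_sided_stationary_def by blast
  let ?w = "p i j * measure (F i j) B"
  have "measure N (?A \<inter> ?E) = (\<integral>\<omega>. indicator (?A \<inter> ?E) \<omega> \<partial>N)"
    using A' E by simp
  also have "\<dots> = (\<integral>\<omega>\<in>?A. indicator ?E \<omega> \<partial>N)"
    unfolding set_lebesgue_integral_def
    by (intro Bochner_Integration.integral_cong) (auto split: split_indicator)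
  also have "\<dots> = (\<integral>\<omega>\<in>?A. real_cond_exp N ?C (indicator ?E) \<omega> \<partial>N)"
    by (rule real_cond_exp_intA[OF integrable_real_indicator[OF E] A]) (simp add: N.emeasure_eq_measure)
  also have "\<dots> = (\<integral>\<omega>. indicator ?A \<omega> * ?w \<partial>N)"
    unfolding set_lebesgue_integral_def
  proof (rule integral_cong_AE)
    show "AE \<omega> in N. indicator ?A \<omega> *\<^sub>R real_cond_exp N ?C (indicator ?E) \<omega> = indicator ?A \<omega> * ?w"
      using ce by eventually_elim (auto simp: mrw_kernel_def split: split_indicator)
  qed (use A' in measurable)
  also have "\<dots> = measure N ?A * ?w" using A' by simp
  finally show ?thesis .
qed

text \<open>The states and increments prescribed so far join the past event, which is then
  measurable at time n + m, and one more step contributes one more factor of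
  \<open>path_weight\<close>.\<close>

lemma measure_two_sided_cylinder:
  assumes A: "A \<in> sets (past_algebra N M' X' n)" and B: "\<And>k. B k \<in> sets borel"
  shows "measure N (A \<inter> {\<omega>\<in>space N. M' n \<omega> = h 0} \<inter>
      {\<omega>\<in>space N. \<forall>k\<in>{1..m}. M' (n + int k) \<omega> = h k \<and> X' (n + int k) \<omega> \<in> B k}) =
    measure N (A \<inter> {\<omega>\<in>space N. M' n \<omega> = h 0}) * path_weight h B m"
proof (induction m)
  case 0
  have "A \<inter> {\<omega>\<in>space N. M' n \<omega> = h 0} \<inter> space N = A \<inter> {\<omega>\<in>space N. M' n \<omega> = h 0}" by auto
  then show ?case by (simp add: path_weight_def)
next
  case (Suc m)
  let ?G = "\<lambda>m. {\<omega>\<in>space N. M' n \<omega> = h 0} \<inter>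
      {\<omega>\<in>space N. \<forall>k\<in>{1..m}. M' (n + int k) \<omega> = h k \<and> X' (n + int k) \<omega> \<in> B k}"
  let ?C = "past_algebra N M' X' (n + int m)"
  have "{\<omega>\<in>space ?C. M' n \<omega> = h 0 \<and> (\<forall>k\<in>{1..m}. M' (n + int k) \<omega> = h k \<and> X' (n + int k) \<omega> \<in> B k)} \<in> sets ?C"
  proof -
    have 1: "Measurable.pred ?C (\<lambda>\<omega>. M' (n + int k) \<omega> = h k)" if "k \<le> m" for k
    proof -
      have [measurable]: "M' (n + int k) \<in> measurable ?C (count_space UNIV)"
        using that by (intro measurable_M'_past) simp
      show ?thesis by measurable
    qed
    have 2: "Measurable.pred ?C (\<lambda>\<omega>. X' (n + int k) \<omega> \<in> B k)" if "k \<le> m" for k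
      using measurable_X'_past[of "n + int k" "n + int m"] B that by (auto intro: pred_sets2)
    show ?thesis
      using 1[of 0] 1 2 by (intro predE pred_intros_logic pred_intros_finite) auto
  qed
  moreover have "{\<omega>\<in>space ?C. M' n \<omega> = h 0 \<and> (\<forall>k\<in>{1..m}. M' (n + int k) \<omega> = h k \<and> X' (n + int k) \<omega> \<in> B k)} = ?G m"
    by auto
  ultimately have G: "A \<inter> ?G m \<in> sets ?C"
    using A sets_past_mono[of n "n + int m"] by auto
  \<comment> \<open>The state at time n + m is already fixed, by the last prescription or, for m =
    0, by the initial one, so the one-step formula applies with the state
    \<open>h m\<close>.\<close>
  have m: "A \<inter> ?G m \<inter> {\<omega>\<in>space N. M' (n + int m) \<omega> = h m} = A \<inter> ?G m"
  proof -
    have "M' (n + int m) \<omega> = h m" if "\<omega> \<in> ?G m" for \<omega>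
    proof (cases "m = 0")
      case False
      then have "m \<in> {1..m}" by simp
      then show ?thesis using that by blast
    qed (use that in simp)
    then show ?thesis by blast
  qed
  have "A \<inter> ?G (Suc m) = A \<inter> ?G m \<inter> {\<omega>\<in>space N. M' (n + int m) \<omega> = h m} \<inter>
      {\<omega>\<in>space N. M' (n + int m + 1) \<omega> = h (Suc m) \<and> X' (n + int m + 1) \<omega> \<in> B (Suc m)}"
  proof -
    have all: "(\<forall>k\<in>{1..Suc m}. P k) \<longleftrightarrow> (\<forall>k\<in>{1..m}. P k) \<and> P (Suc m)" for P
      by (auto simp: atLeastAtMostSuc_conv)
    have "n + int (Suc m) = n + int m + 1" by simp
    then show ?thesis unfolding m all by (simp only:) blast
  qed
  then have "measure N (A \<inter> ?G (Suc m)) =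
      measure N (A \<inter> ?G m) * (p (h m) (h (Suc m)) * measure (F (h m) (h (Suc m))) (B (Suc m)))"
    using measure_two_sided_step[OF G B[of "Suc m"], of "h m" "h (Suc m)"] by (simp only: m)
  then show ?case using Suc by (simp add: Int_assoc path_weight_def)
qed

text \<open>The increment at time \<open>n\<close> belongs to the past; \<open>forward_path\<close>
  masks it, so that the past enters only through the state at \<open>n\<close>.\<close>

definition future_path :: "int \<Rightarrow> 'v \<Rightarrow> nat \<Rightarrow> 's \<times> real" where
  "future_path n = forward_path (\<lambda>k. M' (n + int k)) (\<lambda>k. X' (n + int k))"

lemma measurable_future_path [measurable]: "future_path n \<in> measurable N path_space"
  unfolding future_path_def by (intro measurable_forward_path) auto

text \<open>As functions of \<open>E\<close> both sides are finite measures on path space, and on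
  cylinders they agree by \<open>measure_two_sided_cylinder\<close> and
  \<open>emeasure_path_law_cylinder\<close>.\<close>

lemma markov_property:
  assumes A: "A \<in> sets (past_algebra N M' X' n)" and E: "E \<in> sets path_space"
  shows "measure N (A \<inter> {\<omega>\<in>space N. M' n \<omega> = i \<and> future_path n \<omega> \<in> E}) =
    measure N (A \<inter> {\<omega>\<in>space N. M' n \<omega> = i}) * measure (path_law i) E"
proof -
  let ?G = "A \<inter> {\<omega>\<in>space N. M' n \<omega> = i}"
  have A': "A \<in> sets N" using A by (rule sets_past)
  have G: "?G \<in> sets N" using A' by auto
  interpret L: prob_space "path_law i"
    unfolding path_law_def by (intro prob_space.prob_space_distr prob_Pr) measurable
  let ?\<mu> = "distr (density N (indicator ?G)) path_space (future_path n)"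
  let ?\<nu> = "scale_measure (measure N ?G) (path_law i)"
  have em: "emeasure ?\<mu> C = measure N (A \<inter> {\<omega>\<in>space N. M' n \<omega> = i \<and> future_path n \<omega> \<in> C})"
    if C: "C \<in> sets path_space" for C
  proof -
    have "future_path n -` C \<inter> space N \<in> sets N" using C by measurable
    then have "emeasure ?\<mu> C = emeasure N (?G \<inter> (future_path n -` C \<inter> space N))"
      using C G by (simp add: emeasure_distr emeasure_restricted)
    also have "?G \<inter> (future_path n -` C \<inter> space N) = A \<inter> {\<omega>\<in>space N. M' n \<omega> = i \<and> future_path n \<omega> \<in> C}"
      by auto
    finally show ?thesis by (simp add: N.emeasure_eq_measure)
  qed
  have "?\<mu> = ?\<nu>"
  proof (rule path_measure_eqI[where J = "\<lambda>n. {..<n}"])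
    show "finite_measure ?\<mu>"
    proof (rule finite_measureI)
      have "UNIV \<in> sets (path_space :: (nat \<Rightarrow> 's \<times> real) measure)"
        using sets.top[of "path_space :: (nat \<Rightarrow> 's \<times> real) measure"] by simp
      then show "emeasure ?\<mu> (space ?\<mu>) \<noteq> \<infinity>" by (simp add: em)
    qed
    fix m and h :: "nat \<Rightarrow> 's" and B :: "nat \<Rightarrow> real set" assume B: "\<And>k. B k \<in> sets borel"
    have c: "cylinder {..<m} h B \<in> sets path_space" using B by (intro sets_cylinder) auto
    show "emeasure ?\<mu> (cylinder {..<m} h B) = emeasure ?\<nu> (cylinder {..<m} h B)"
    proof (cases m)
      case 0
      have "A \<inter> {\<omega>\<in>space N. M' n \<omega> = i \<and> future_path n \<omega> \<in> UNIV} = ?G" by auto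
      then show ?thesis using c L.emeasure_space_1
        by (simp add: em 0 cylinder_def emeasure_scale_measure path_law_def)
    next
      case (Suc m')
      have eq: "A \<inter> {\<omega>\<in>space N. M' n \<omega> = i \<and> future_path n \<omega> \<in> cylinder {..<m} h B} =
        (if h 0 = i \<and> 0 \<in> B 0 then A \<inter> {\<omega>\<in>space N. M' n \<omega> = h 0} \<inter>
          {\<omega>\<in>space N. \<forall>k\<in>{1..m'}. M' (n + int k) \<omega> = h k \<and> X' (n + int k) \<omega> \<in> B k} else {})"
      proof -
        have "future_path n \<omega> \<in> cylinder {..<m} h B \<longleftrightarrow> M' n \<omega> = h 0 \<and> 0 \<in> B 0 \<and>
          (\<forall>k\<in>{1..m'}. M' (n + int k) \<omega> = h k \<and> X' (n + int k) \<omega> \<in> B k)" for \<omega>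
        proof -
          have "{..<m} = insert 0 {1..m'}" using Suc by auto
          then show ?thesis by (auto simp: cylinder_def future_path_def forward_path_def)
        qed
        then show ?thesis by auto
      qed
      have meas: "measure N (A \<inter> {\<omega>\<in>space N. M' n \<omega> = i \<and> future_path n \<omega> \<in> cylinder {..<m} h B}) =
          measure N ?G * (of_bool (h 0 = i \<and> 0 \<in> B 0) * path_weight h B m')"
        unfolding eq using measure_two_sided_cylinder[where B = B and h = h and m = m', OF A B] by auto
      have "path_weight h B m' \<ge> 0" by (auto simp: path_weight_def p_nonneg intro!: prod_nonneg)
      then show ?thesis
        unfolding em[OF c] meas using emeasure_path_law_cylinder[where B = B and h = h and n = m' and i = i, OF B]
        by (simp add: emeasure_scale_measure Suc ennreal_mult)
    qed
  qed (auto simp: incseq_def path_law_def)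
  then have "emeasure ?\<mu> E = emeasure ?\<nu> E" by simp
  then show ?thesis using E
    by (simp add: em emeasure_scale_measure L.emeasure_eq_measure ennreal_mult''[symmetric])
qed

definition two_sided_path :: "int \<Rightarrow> 'v \<Rightarrow> int \<Rightarrow> 's \<times> real" where
  "two_sided_path m \<omega> k = (M' (m + k) \<omega>, X' (m + k) \<omega>)"

lemma measurable_two_sided_path [measurable]: "two_sided_path m \<in> measurable N path_space"
  unfolding two_sided_path_def[abs_def] by (rule measurable_PiM_single') (auto simp: space_pair_measure)

text \<open>From equal marginals to a stationary process: on a symmetric window the probability of a
  cylinder is a \<xi>-mass at the left end times a product of kernel values, and neither depends on
  the shift.\<close>

lemma distr_two_sided_path:
  "distr N path_space (two_sided_path m) = distr N path_space (two_sided_path 0)"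
proof (rule path_measure_eqI[where J = "\<lambda>n. {- int n<..<int n}"])
  show "finite_measure (distr N path_space (two_sided_path m))"
    by (intro prob_space.finite_measure N.prob_space_distr) measurable
  show "incseq (\<lambda>n. {- int n<..<int n})" by (auto simp: incseq_def)
  show "(\<Union>n. {- int n<..<int n}) = UNIV"
  proof (intro equalityI subsetI)
    fix k :: int assume "k \<in> UNIV"
    show "k \<in> (\<Union>n. {- int n<..<int n})"
      by (rule UN_I[of "nat (\<bar>k\<bar> + 1)"]) auto
  qed simp
next
  fix n and h :: "int \<Rightarrow> 's" and B :: "int \<Rightarrow> real set" assume B: "\<And>k. B k \<in> sets borel"
  let ?C = "cylinder {- int n<..<int n} h B"
  have c: "?C \<in> sets path_space" using B by (intro sets_cylinder) auto
  have em: "emeasure (distr N path_space (two_sided_path m)) ?C = measure N {\<omega>\<in>space N. two_sided_path m \<omega> \<in> ?C}" for m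
  proof -
    have "two_sided_path m -` ?C \<inter> space N = {\<omega>\<in>space N. two_sided_path m \<omega> \<in> ?C}" by auto
    then show ?thesis using c by (simp add: emeasure_distr N.emeasure_eq_measure)
  qed
  show "emeasure (distr N path_space (two_sided_path m)) ?C = emeasure (distr N path_space (two_sided_path 0)) ?C"
  proof (cases n)
    case 0
    then show ?thesis unfolding em by (simp add: cylinder_def)
  next
    case (Suc n')
    let ?h = "\<lambda>k. h (int k - int n')" and ?B = "\<lambda>k. B (int k - int n')"
    have "measure N {\<omega>\<in>space N. two_sided_path m \<omega> \<in> ?C} =
        measure \<xi> ({h (- int n')} \<times> B (- int n')) * path_weight ?h ?B (2 * n')" for m
    proof -
      \<comment> \<open>With n = n' + 1 the window runs from m - n' to m + n', which takes 2 n'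
        steps from its left end.\<close>
      let ?l = "m - int n'"
      let ?A = "X' ?l -` B (- int n') \<inter> space N"
      have A: "?A \<in> sets (past_algebra N M' X' ?l)"
        using measurable_sets[OF measurable_X'_past[of ?l ?l] B] by simp
      have "{- int n<..<int n} = insert (- int n') ((\<lambda>k. int k - int n') ` {1..2 * n'})"
      proof (intro equalityI subsetI)
        fix k assume k: "k \<in> {- int n<..<int n}"
        show "k \<in> insert (- int n') ((\<lambda>k. int k - int n') ` {1..2 * n'})"
        proof (cases "k = - int n'")
          case False
          then have "k = int (nat (k + int n')) - int n'" "nat (k + int n') \<in> {1..2 * n'}" using k Suc by auto
          then show ?thesis by blast
        qed simp
      qed (use Suc in auto)
      then have "{\<omega>\<in>space N. two_sided_path m \<omega> \<in> ?C} = ?A \<inter> {\<omega>\<in>space N. M' ?l \<omega> = ?h 0} \<inter>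
          {\<omega>\<in>space N. \<forall>k\<in>{1..2 * n'}. M' (?l + int k) \<omega> = ?h k \<and> X' (?l + int k) \<omega> \<in> ?B k}"
        by (auto simp: cylinder_def two_sided_path_def algebra_simps)
      then have "measure N {\<omega>\<in>space N. two_sided_path m \<omega> \<in> ?C} =
          measure N (?A \<inter> {\<omega>\<in>space N. M' ?l \<omega> = ?h 0}) * path_weight ?h ?B (2 * n')"
        using measure_two_sided_cylinder[OF A, of ?B ?h "2 * n'"] B by simp
      also have "measure N (?A \<inter> {\<omega>\<in>space N. M' ?l \<omega> = ?h 0}) = measure \<xi> ({h (- int n')} \<times> B (- int n'))"
      proof -
        have "\<xi> = distr N (count_space UNIV \<Otimes>\<^sub>M borel) (\<lambda>\<omega>. (M' ?l \<omega>, X' ?l \<omega>))"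
          using two_sided by (simp add: two_sided_stationary_def)
        then have "measure \<xi> ({h (- int n')} \<times> B (- int n')) =
            measure N ((\<lambda>\<omega>. (M' ?l \<omega>, X' ?l \<omega>)) -` ({h (- int n')} \<times> B (- int n')) \<inter> space N)"
          using B by (simp add: measure_distr)
        also have "(\<lambda>\<omega>. (M' ?l \<omega>, X' ?l \<omega>)) -` ({h (- int n')} \<times> B (- int n')) \<inter> space N =
            ?A \<inter> {\<omega>\<in>space N. M' ?l \<omega> = ?h 0}" by auto
        finally show ?thesis by simp
      qed
      finally show ?thesis .
    qed
    then show ?thesis by (simp add: em)
  qed
qed (auto)

end

section \<open>Records of the two-sided walk\<close>

lemma pred_past_record:
  assumes "\<And>l. l \<le> k \<Longrightarrow> X l \<in> borel_measurable N"
  shows "Measurable.pred N (\<lambda>\<omega>. past_record (\<lambda>l. X l \<omega>) k)"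
proof -
  have "Measurable.pred N (\<lambda>\<omega>. j < k \<longrightarrow> 0 < (\<Sum>l\<in>{j<..k}. X l \<omega>))" for j
  proof (cases "j < k")
    case True
    have [measurable]: "(\<lambda>\<omega>. \<Sum>l\<in>{j<..k}. X l \<omega>) \<in> borel_measurable N"
      using assms by (intro borel_measurable_sum) auto
    show ?thesis by measurable
  qed simp
  then have "Measurable.pred N (\<lambda>\<omega>. \<forall>j. j < k \<longrightarrow> 0 < (\<Sum>l\<in>{j<..k}. X l \<omega>))"
    by (rule pred_intros_countable)
  then show ?thesis by (simp only: past_record_def)
qed

lemma pred_path_record [measurable]: "Measurable.pred path_space (\<lambda>y. past_record (\<lambda>l. path_increment l y) k)"
  by (rule pred_past_record) measurable

section \<open>Least and greatest integers with a property\<close>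

lemma int_least:
  fixes P :: "int \<Rightarrow> bool"
  assumes "P k" "a \<le> k"
  obtains l where "a \<le> l" "P l" "\<And>j. a \<le> j \<Longrightarrow> j < l \<Longrightarrow> \<not> P j"
proof -
  define n where "n = (LEAST n. P (a + int n))"
  have ex: "P (a + int (nat (k - a)))" using assms by simp
  have "P (a + int n)" unfolding n_def by (rule LeastI, rule ex)
  moreover have "\<not> P j" if "a \<le> j" "j < a + int n" for j
  proof
    assume "P j"
    then have "P (a + int (nat (j - a)))" using that by simp
    then have "n \<le> nat (j - a)" unfolding n_def by (rule Least_le)
    then show False using that by simp
  qed
  ultimately show ?thesis using that[of "a + int n"] by simp
qed

lemma int_greatest:
  fixes P :: "int \<Rightarrow> bool"
  assumes "P k" "k \<le> a"
  obtains l where "l \<le> a" "P l" "\<And>j. l < j \<Longrightarrow> j \<le> a \<Longrightarrow> \<not> P j"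
proof -
  obtain l where "- a \<le> l" "P (- l)" "\<And>j. - a \<le> j \<Longrightarrow> j < l \<Longrightarrow> \<not> P (- j)"
    using int_least[of "\<lambda>k. P (- k)" "- k" "- a"] assms by auto
  then show ?thesis using that[of "- l"] by (metis minus_le_iff minus_less_iff minus_minus neg_le_iff_le)
qed

lemma Inf_int_eq:
  fixes P :: "int \<Rightarrow> bool"
  assumes "a \<le> l" "P l" "\<And>j. a \<le> j \<Longrightarrow> j < l \<Longrightarrow> \<not> P j"
  shows "Inf {k. a \<le> k \<and> P k} = l"
proof (rule cInf_eq_minimum)
  fix x assume "x \<in> {k. a \<le> k \<and> P k}"
  then show "l \<le> x" using assms(3)[of x] by (cases "x < l") auto
qed (use assms in simp)

lemma Sup_int_eq:
  fixes P :: "int \<Rightarrow> bool"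
  assumes "l \<le> a" "P l" "\<And>j. l < j \<Longrightarrow> j \<le> a \<Longrightarrow> \<not> P j"
  shows "Sup {k. k \<le> a \<and> P k} = l"
proof (rule cSup_eq_maximum)
  fix x assume "x \<in> {k. k \<le> a \<and> P k}"
  then show "x \<le> l" using assms(3)[of x] by (cases "l < x") auto
qed (use assms in simp)

lemma measurable_Inf_int:
  fixes P :: "'w \<Rightarrow> int \<Rightarrow> bool"
  assumes [measurable]: "\<And>k. Measurable.pred N (\<lambda>\<omega>. P \<omega> k)"
  shows "(\<lambda>\<omega>. Inf {k. a \<le> k \<and> P \<omega> k}) \<in> measurable N (count_space UNIV)"
proof (subst measurable_count_space_eq_countable, simp, safe)
  fix b
  \<comment> \<open>If there is no admissible \<open>k\<close>, the infimum is the default value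
    \<open>Inf {}\<close>, the same for all \<omega>; hence the second alternative.\<close>
  have "Inf {k. a \<le> k \<and> P \<omega> k} = b \<longleftrightarrow>
      (a \<le> b \<and> P \<omega> b \<and> (\<forall>l. a \<le> l \<and> l < b \<longrightarrow> \<not> P \<omega> l)) \<or> ((\<forall>l. a \<le> l \<longrightarrow> \<not> P \<omega> l) \<and> Inf {} = b)" for \<omega>
  proof (cases "\<exists>k\<ge>a. P \<omega> k")
    case True
    then obtain l where l: "a \<le> l" "P \<omega> l" "\<And>j. a \<le> j \<Longrightarrow> j < l \<Longrightarrow> \<not> P \<omega> j"
      using int_least[of "P \<omega>" _ a] by metis
    then have "Inf {k. a \<le> k \<and> P \<omega> k} = l" by (rule Inf_int_eq)
    then show ?thesis using l True by (metis linorder_neqE_linordered_idom)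
  next
    case False
    then have empty: "{k. a \<le> k \<and> P \<omega> k} = {}" by auto
    show ?thesis unfolding empty using False by auto
  qed
  then have "(\<lambda>\<omega>. Inf {k. a \<le> k \<and> P \<omega> k}) -` {b} \<inter> space N = {\<omega>\<in>space N.
      (a \<le> b \<and> P \<omega> b \<and> (\<forall>l. a \<le> l \<and> l < b \<longrightarrow> \<not> P \<omega> l)) \<or> ((\<forall>l. a \<le> l \<longrightarrow> \<not> P \<omega> l) \<and> Inf {} = b)}"
    by blast
  also have "\<dots> \<in> sets N" by measurable
  finally show "(\<lambda>\<omega>. Inf {k. a \<le> k \<and> P \<omega> k}) -` {b} \<inter> space N \<in> sets N" .
qed auto

lemma measurable_Sup_int:
  fixes P :: "'w \<Rightarrow> int \<Rightarrow> bool"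
  assumes [measurable]: "\<And>k. Measurable.pred N (\<lambda>\<omega>. P \<omega> k)"
  shows "(\<lambda>\<omega>. Sup {k. k \<le> a \<and> P \<omega> k}) \<in> measurable N (count_space UNIV)"
proof (subst measurable_count_space_eq_countable, simp, safe)
  fix b
  have "Sup {k. k \<le> a \<and> P \<omega> k} = b \<longleftrightarrow>
      (b \<le> a \<and> P \<omega> b \<and> (\<forall>l. l \<le> a \<and> b < l \<longrightarrow> \<not> P \<omega> l)) \<or> ((\<forall>l. l \<le> a \<longrightarrow> \<not> P \<omega> l) \<and> Sup {} = b)" for \<omega>
  proof (cases "\<exists>k\<le>a. P \<omega> k")
    case True
    then obtain l where l: "l \<le> a" "P \<omega> l" "\<And>j. l < j \<Longrightarrow> j \<le> a \<Longrightarrow> \<not> P \<omega> j"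
      using int_greatest[of "P \<omega>" _ a] by metis
    then have "Sup {k. k \<le> a \<and> P \<omega> k} = l" by (rule Sup_int_eq)
    then show ?thesis using l True by (metis linorder_neqE_linordered_idom)
  next
    case False
    then have empty: "{k. k \<le> a \<and> P \<omega> k} = {}" by auto
    show ?thesis unfolding empty using False by auto
  qed
  then have "(\<lambda>\<omega>. Sup {k. k \<le> a \<and> P \<omega> k}) -` {b} \<inter> space N = {\<omega>\<in>space N.
      (b \<le> a \<and> P \<omega> b \<and> (\<forall>l. l \<le> a \<and> b < l \<longrightarrow> \<not> P \<omega> l)) \<or> ((\<forall>l. l \<le> a \<longrightarrow> \<not> P \<omega> l) \<and> Sup {} = b)}"
    by blast
  also have "\<dots> \<in> sets N" by measurable
  finally show "(\<lambda>\<omega>. Sup {k. k \<le> a \<and> P \<omega> k}) -` {b} \<inter> space N \<in> sets N" .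
qed auto

lemma measurable_two_sided_walk:
  assumes [measurable]: "\<And>k. X k \<in> borel_measurable N"
  shows "two_sided_walk X k \<in> borel_measurable N"
proof -
  have "two_sided_walk X k = (\<lambda>\<omega>. if 0 \<le> k then \<Sum>k=1..k. X k \<omega> else - (\<Sum>k=k+1..0. X k \<omega>))"
    by (simp add: fun_eq_iff two_sided_walk_def)
  then show ?thesis by simp
qed

lemma pred_two_sided_record:
  assumes "\<And>k. X k \<in> borel_measurable N"
  shows "Measurable.pred N (\<lambda>\<omega>. two_sided_record X \<omega> k)"
proof -
  note [measurable] = measurable_two_sided_walk[OF assms]
  have [measurable]: "(\<lambda>\<omega>. SUP j\<in>{..<k}. ereal (two_sided_walk X j \<omega>)) \<in> borel_measurable N"
    by (intro borel_measurable_SUP) auto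
  show ?thesis unfolding two_sided_record_def by measurable
qed

section \<open>Occurrence of records under the stationary law\<close>

context dual_divergent_mrw
begin

definition record_at :: "int \<Rightarrow> 'v \<Rightarrow> bool" where
  "record_at k \<omega> \<longleftrightarrow> past_record (\<lambda>k. X' k \<omega>) k"

lemma record_at_eq: "record_at k = (\<lambda>\<omega>. past_record (\<lambda>l. X' l \<omega>) k)"
  by (simp add: fun_eq_iff record_at_def)

lemma record_two_sided_path:
  "past_record (\<lambda>l. path_increment l (two_sided_path m \<omega>)) k \<longleftrightarrow> record_at (m + k) \<omega>"
  unfolding record_at_def two_sided_path_def snd_conv by (rule past_record_shift)

lemma pred_record [measurable]: "Measurable.pred N (record_at k)"
  using pred_past_record[of k X' N] by (simp add: record_at_eq)

lemma pred_record_past: "k \<le> n \<Longrightarrow> Measurable.pred (past_algebra N M' X' n) (record_at k)"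
  unfolding record_at_eq by (intro pred_past_record measurable_X'_past) simp

lemma prob_shift:
  assumes [measurable]: "Measurable.pred path_space P"
  shows "measure N {\<omega>\<in>space N. P (two_sided_path m \<omega>)} = measure N {\<omega>\<in>space N. P (two_sided_path 0 \<omega>)}"
proof -
  have "{y\<in>space path_space. P y} \<in> sets path_space" by measurable
  then have E: "{y. P y} \<in> sets path_space" by simp
  have "measure N {\<omega>\<in>space N. P (two_sided_path m \<omega>)} = measure (distr N path_space (two_sided_path m)) {y. P y}" for m
    using E by (subst measure_distr) (auto intro!: arg_cong[where f = "measure N"])
  then show ?thesis by (simp only: distr_two_sided_path[of m])
qed

lemma AE_shift:
  assumes [measurable]: "Measurable.pred path_space P" and "AE \<omega> in N. P (two_sided_path 0 \<omega>)"
  shows "AE \<omega> in N. P (two_sided_path m \<omega>)"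
proof -
  have E: "{y\<in>space path_space. P y} \<in> sets path_space" by measurable
  have "AE y in distr N path_space (two_sided_path 0). P y"
    using assms(2) by (simp only: AE_distr_iff[OF measurable_two_sided_path E])
  then have "AE y in distr N path_space (two_sided_path m). P y" by (simp only: distr_two_sided_path[of m])
  then show ?thesis by (simp only: AE_distr_iff[OF measurable_two_sided_path E])
qed

lemma nn_integral_shift:
  assumes [measurable]: "f \<in> borel_measurable path_space"
  shows "(\<integral>\<^sup>+ \<omega>. f (two_sided_path m \<omega>) \<partial>N) = (\<integral>\<^sup>+ \<omega>. f (two_sided_path 0 \<omega>) \<partial>N)"
proof -
  have "(\<integral>\<^sup>+ \<omega>. f (two_sided_path m \<omega>) \<partial>N) = (\<integral>\<^sup>+ y. f y \<partial>distr N path_space (two_sided_path m))" for m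
    by (subst nn_integral_distr) auto
  then show ?thesis by (simp only: distr_two_sided_path[of m])
qed

lemma prob_record: "measure N {\<omega>\<in>space N. record_at k \<omega> \<and> M' k \<omega> \<in> J} = measure N {\<omega>\<in>space N. record_at 0 \<omega> \<and> M' 0 \<omega> \<in> J}"
  using prob_shift[of "\<lambda>y. past_record (\<lambda>l. path_increment l y) 0 \<and> fst (y 0) \<in> J" k]
  by (simp add: record_two_sided_path) (simp add: two_sided_path_def)

text \<open>Divergence gives a record at or before 0; stationarity moves this to every n, at the
  cost of countably many null sets.\<close>

lemma AE_record_before: "AE \<omega> in N. \<forall>n. \<exists>k\<le>n. record_at k \<omega>"
proof -
  have "AE \<omega> in N. \<exists>k\<le>0. record_at k \<omega>"
    using divergent by eventually_elim (auto simp: record_at_def dest: past_record_exists)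
  then have "AE \<omega> in N. \<exists>k\<le>0. past_record (\<lambda>l. path_increment l (two_sided_path 0 \<omega>)) k"
    by (simp add: record_two_sided_path)
  then have "AE \<omega> in N. \<exists>k\<le>0. past_record (\<lambda>l. path_increment l (two_sided_path n \<omega>)) k" for n
    by (rule AE_shift[rotated]) measurable
  then have "AE \<omega> in N. \<forall>n. \<exists>k\<le>0. record_at (n + k) \<omega>"
    by (simp add: AE_all_countable record_two_sided_path)
  then show ?thesis
    by eventually_elim (metis add_le_same_cancel1)
qed

text \<open>The events that the last record with state in \<open>J\<close> occurs at \<open>k\<close> are disjoint and, by
  stationarity, equally likely.\<close>
lemma AE_record_again:
  "AE \<omega> in N. \<forall>k. record_at k \<omega> \<and> M' k \<omega> \<in> J \<longrightarrow> (\<exists>l>k. record_at l \<omega> \<and> M' l \<omega> \<in> J)"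
proof -
  let ?L = "\<lambda>k. {\<omega>\<in>space N. (record_at k \<omega> \<and> M' k \<omega> \<in> J) \<and> (\<forall>l>k. \<not> (record_at l \<omega> \<and> M' l \<omega> \<in> J))}"
  let ?P = "\<lambda>y. (past_record (\<lambda>l. path_increment l y) 0 \<and> fst (y 0) \<in> J) \<and>
    (\<forall>l>0. \<not> (past_record (\<lambda>i. path_increment i y) l \<and> fst (y l) \<in> J))"
  have L: "{\<omega>\<in>space N. ?P (two_sided_path k \<omega>)} = ?L k" for k
  proof -
    have "(\<forall>l>0. Q (k + l)) \<longleftrightarrow> (\<forall>l>k. Q l)" for Q :: "int \<Rightarrow> bool"
    proof safe
      fix l assume "\<forall>l>0. Q (k + l)" "k < l"
      then have "Q (k + (l - k))" by (metis diff_gt_0_iff_gt)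
      then show "Q l" by simp
    qed simp
    from this[of "\<lambda>l. \<not> (record_at l _ \<and> M' l _ \<in> J)"] show ?thesis
      unfolding record_two_sided_path by (simp add: two_sided_path_def)
  qed
  have [measurable]: "?L k \<in> sets N" for k by measurable
  have same: "measure N (?L k) = measure N (?L 0)" for k
    using prob_shift[of ?P k] unfolding L by simp
  have disj: "disjoint_family (\<lambda>n::nat. ?L (int n))"
    unfolding disjoint_family_on_def
  proof (intro ballI impI)
    fix m n :: nat assume "m \<noteq> n"
    then have "int m < int n \<or> int n < int m" by auto
    then show "?L (int m) \<inter> ?L (int n) = {}" by blast
  qed
  have "(\<lambda>n. measure N (?L (int n))) sums measure N (\<Union>n. ?L (int n))"
    using disj by (intro N.finite_measure_UNION) auto
  then have "summable (\<lambda>n::nat. measure N (?L 0))"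
    unfolding same[of "int _"] by (rule sums_summable)
  then have "measure N (?L 0) = 0" by (simp add: summable_const_iff)
  then have "measure N (?L k) = 0" for k by (simp only: same[of k])
  then have "AE \<omega> in N. \<not> ((record_at k \<omega> \<and> M' k \<omega> \<in> J) \<and> (\<forall>l>k. \<not> (record_at l \<omega> \<and> M' l \<omega> \<in> J)))" for k
    by (simp add: N.prob_Collect_eq_0)
  then have "AE \<omega> in N. \<forall>k. \<not> ((record_at k \<omega> \<and> M' k \<omega> \<in> J) \<and> (\<forall>l>k. \<not> (record_at l \<omega> \<and> M' l \<omega> \<in> J)))"
    by (subst AE_all_countable) blast
  then show ?thesis by eventually_elim blast
qed

text \<open>Iterating \<open>AE_record_again\<close> moves forward by at least one each time.
  \<open>J = UNIV\<close> yields records after every time, \<open>J = {j}\<close> the recurrence of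
  the state \<open>j\<close> along the records.\<close>

lemma AE_record_infinitely_often:
  "AE \<omega> in N. (\<exists>k. record_at k \<omega> \<and> M' k \<omega> \<in> J) \<longrightarrow> (\<forall>n. \<exists>k>n. record_at k \<omega> \<and> M' k \<omega> \<in> J)"
  using AE_record_again[of J]
proof eventually_elim
  case (elim \<omega>)
  show ?case
  proof (intro impI allI)
    fix n assume "\<exists>k. record_at k \<omega> \<and> M' k \<omega> \<in> J"
    then obtain r where r: "record_at r \<omega> \<and> M' r \<omega> \<in> J" by auto
    have "\<exists>k\<ge>r + int d. record_at k \<omega> \<and> M' k \<omega> \<in> J" for d
    proof (induction d)
      case (Suc d)
      then obtain k where "r + int d \<le> k" "record_at k \<omega> \<and> M' k \<omega> \<in> J" by auto
      moreover from this elim obtain l where "k < l" "record_at l \<omega> \<and> M' l \<omega> \<in> J" by blast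
      ultimately show ?case by (intro exI[of _ l]) auto
    qed (use r in auto)
    then obtain k where k: "r + int (nat (n - r + 1)) \<le> k" "record_at k \<omega> \<and> M' k \<omega> \<in> J" by blast
    then have "n < k" by linarith
    then show "\<exists>k>n. record_at k \<omega> \<and> M' k \<omega> \<in> J" using k(2) by blast
  qed
qed

lemma AE_record_after: "AE \<omega> in N. \<forall>n. \<exists>k>n. record_at k \<omega>"
  using AE_record_infinitely_often[of UNIV] AE_record_before by eventually_elim auto

text \<open>If the record event at 0 were null, stationarity would exclude records at all times,
  against their almost sure existence.\<close>

lemma prob_record_pos: "0 < measure N {\<omega>\<in>space N. record_at 0 \<omega>}"
proof (rule ccontr)
  assume "\<not> ?thesis"
  then have "measure N {\<omega>\<in>space N. record_at k \<omega>} = 0" for k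
    using prob_record[of k UNIV] by (simp add: zero_less_measure_iff)
  then have "AE \<omega> in N. \<forall>k. \<not> record_at k \<omega>"
    by (subst AE_all_countable) (simp add: N.prob_eq_0)
  then have "AE \<omega> in N. False" using AE_record_before by eventually_elim auto
  then show False by simp
qed

text \<open>Records on both sides make the infimum and the supremum attained, and divergence turns
  \<open>two_sided_record\<close> into \<open>record_at\<close>.\<close>

lemma AE_sigma:
  "AE \<omega> in N. sigma0 X' \<omega> \<le> 0 \<and> record_at (sigma0 X' \<omega>) \<omega> \<and> (\<forall>l. sigma0 X' \<omega> < l \<and> l \<le> 0 \<longrightarrow> \<not> record_at l \<omega>) \<and>
    1 \<le> sigma1 X' \<omega> \<and> record_at (sigma1 X' \<omega>) \<omega> \<and> (\<forall>l. 1 \<le> l \<and> l < sigma1 X' \<omega> \<longrightarrow> \<not> record_at l \<omega>)"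
  using divergent AE_record_before AE_record_after
proof eventually_elim
  case (elim \<omega>)
  have iff: "two_sided_record X' \<omega> k \<longleftrightarrow> record_at k \<omega>" for k
    using two_sided_record_iff[OF elim(1)] by (simp add: record_at_def)
  obtain k where "k \<le> 0" "record_at k \<omega>" using elim(2) by auto
  then obtain l where l: "l \<le> 0" "record_at l \<omega>" "\<And>j. l < j \<Longrightarrow> j \<le> 0 \<Longrightarrow> \<not> record_at j \<omega>"
    using int_greatest[of "\<lambda>k. record_at k \<omega>" k 0] by metis
  have s0: "sigma0 X' \<omega> = l"
    unfolding sigma0_def iff by (rule Sup_int_eq[where P = "\<lambda>k. record_at k \<omega>", OF l])
  obtain k where "0 < k" "record_at k \<omega>" using elim(3) by auto
  then obtain m where m: "1 \<le> m" "record_at m \<omega>" "\<And>j. 1 \<le> j \<Longrightarrow> j < m \<Longrightarrow> \<not> record_at j \<omega>"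
    using int_least[of "\<lambda>k. record_at k \<omega>" k 1] by (metis int_one_le_iff_zero_less)
  have s1: "sigma1 X' \<omega> = m"
    unfolding sigma1_def iff by (rule Inf_int_eq[where P = "\<lambda>k. record_at k \<omega>", OF m])
  show ?case using l m by (auto simp: s0 s1)
qed

lemma measurable_sigma0 [measurable]: "sigma0 X' \<in> measurable N (count_space UNIV)"
proof -
  have "sigma0 X' = (\<lambda>\<omega>. Sup {k. k \<le> 0 \<and> two_sided_record X' \<omega> k})" by (simp add: fun_eq_iff sigma0_def)
  moreover have "(\<lambda>\<omega>. Sup {k. k \<le> 0 \<and> two_sided_record X' \<omega> k}) \<in> measurable N (count_space UNIV)"
    by (intro measurable_Sup_int pred_two_sided_record measurable_X')
  ultimately show ?thesis by simp
qed

lemma measurable_sigma1 [measurable]: "sigma1 X' \<in> measurable N (count_space UNIV)"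
proof -
  have "sigma1 X' = (\<lambda>\<omega>. Inf {k. 1 \<le> k \<and> two_sided_record X' \<omega> k})" by (simp add: fun_eq_iff sigma1_def)
  moreover have "(\<lambda>\<omega>. Inf {k. 1 \<le> k \<and> two_sided_record X' \<omega> k}) \<in> measurable N (count_space UNIV)"
    by (intro measurable_Inf_int pred_two_sided_record measurable_X')
  ultimately show ?thesis by simp
qed

lemma prob_sigma0:
  "measure N {\<omega>\<in>space N. M' 0 \<omega> \<in> J \<and> sigma0 X' \<omega> = 0} = measure N {\<omega>\<in>space N. record_at 0 \<omega> \<and> M' 0 \<omega> \<in> J}"
proof (rule N.finite_measure_eq_AE)
  show "AE \<omega> in N. \<omega> \<in> {\<omega>\<in>space N. M' 0 \<omega> \<in> J \<and> sigma0 X' \<omega> = 0} \<longleftrightarrow> \<omega> \<in> {\<omega>\<in>space N. record_at 0 \<omega> \<and> M' 0 \<omega> \<in> J}"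
    using AE_sigma
  proof eventually_elim
    case (elim \<omega>)
    then have "sigma0 X' \<omega> = 0 \<longleftrightarrow> record_at 0 \<omega>" by (metis order_le_less order_refl)
    then show ?case by auto
  qed
qed measurable

section \<open>Mass transport between times and records\<close>

definition next_record :: "(int \<Rightarrow> 's \<times> real) \<Rightarrow> nat" where
  "next_record y = (LEAST n. 0 < n \<and> past_record (\<lambda>l. path_increment l y) (int n))"

lemma measurable_next_record [measurable]: "next_record \<in> measurable path_space (count_space UNIV)"
  unfolding next_record_def[abs_def] by measurable

text \<open>What a record at 0 with state in \<open>J\<close> receives from time \<open>a\<close>:
  the condition \<open>a < next_record y\<close> says that time \<open>a\<close> lies in the cycle
  which this record starts.\<close>

definition record_share :: "'s set \<Rightarrow> nat \<Rightarrow> (int \<Rightarrow> 's \<times> real) \<Rightarrow> ennreal" where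
  "record_share J a y = (if past_record (\<lambda>l. path_increment l y) 0 \<and> fst (y 0) \<in> J \<and> a < next_record y
     then ennreal (1 / real (next_record y)) else 0)"

lemma measurable_record_share [measurable]: "record_share J a \<in> borel_measurable path_space"
  unfolding record_share_def[abs_def] by measurable

lemma next_record_two_sided_path:
  assumes "0 < n" "record_at (m + int n) \<omega>" "\<And>l. 0 < l \<Longrightarrow> l < n \<Longrightarrow> \<not> record_at (m + int l) \<omega>"
  shows "next_record (two_sided_path m \<omega>) = n"
  unfolding next_record_def record_two_sided_path
proof (rule Least_equality)
  fix l assume "0 < l \<and> record_at (m + int l) \<omega>"
  then show "n \<le> l" using assms(3)[of l] by (metis not_le)
qed (use assms in auto)

text \<open>What time 0 hands out, summed over the possible distances \<open>a\<close> back to the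
  receiving record. Only the record sigma_0, which starts the cycle containing 0, receives
  something.\<close>

lemma AE_record_share:
  "AE \<omega> in N. (\<Sum>a. record_share J a (two_sided_path (- int a) \<omega>)) =
     ennreal (1 / real_of_int (sigma1 X' \<omega> - sigma0 X' \<omega>) * indicator {\<omega>. M' (sigma0 X' \<omega>) \<omega> \<in> J} \<omega>)"
  using AE_sigma
proof eventually_elim
  case (elim \<omega>)
  define s t where "s = sigma0 X' \<omega>" and "t = sigma1 X' \<omega>"
  have s: "s \<le> 0" "record_at s \<omega>" "\<And>l. s < l \<Longrightarrow> l \<le> 0 \<Longrightarrow> \<not> record_at l \<omega>"
    and t: "1 \<le> t" "record_at t \<omega>" "\<And>l. 1 \<le> l \<Longrightarrow> l < t \<Longrightarrow> \<not> record_at l \<omega>"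
    using elim by (auto simp: s_def t_def)
  \<comment> \<open>A record at -a other than sigma_0 precedes sigma_0, which is at most 0, so the
    cycle started at -a is over by time 0.\<close>
  have zero: "record_share J a (two_sided_path (- int a) \<omega>) = 0" if "a \<noteq> nat (- s)" for a
  proof (cases "record_at (- int a) \<omega>")
    case True
    then have "- int a < s" using s(3)[of "- int a"] that s(1) by (cases "- int a" s rule: linorder_cases) auto
    then have "next_record (two_sided_path (- int a) \<omega>) \<le> nat (s + int a)"
      unfolding next_record_def record_two_sided_path using s(2) by (intro Least_le) auto
    also have "\<dots> \<le> a" using s(1) by simp
    finally show ?thesis by (simp add: record_share_def)
  qed (simp add: record_share_def record_two_sided_path)
  have next_eq: "next_record (two_sided_path s \<omega>) = nat (t - s)"
  proof (rule next_record_two_sided_path)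
    fix l assume "0 < l" "l < nat (t - s)"
    then show "\<not> record_at (s + int l) \<omega>"
      using s(3)[of "s + int l"] t(3)[of "s + int l"] by (cases "s + int l \<le> 0") auto
  qed (use s t in auto)
  have "(\<Sum>a. record_share J a (two_sided_path (- int a) \<omega>)) =
      (\<Sum>a\<in>{nat (- s)}. record_share J a (two_sided_path (- int a) \<omega>))"
    by (rule suminf_finite) (use zero in auto)
  also have "\<dots> = record_share J (nat (- s)) (two_sided_path s \<omega>)" using s(1) by simp
  also have "\<dots> = ennreal (1 / real_of_int (t - s) * indicator {\<omega>. M' (sigma0 X' \<omega>) \<omega> \<in> J} \<omega>)"
  proof -
    have "nat (- s) < nat (t - s)" "real (nat (t - s)) = real_of_int (t - s)" using s(1) t(1) by auto
    moreover have "past_record (\<lambda>l. path_increment l (two_sided_path s \<omega>)) 0"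
      using s(2) by (simp add: record_two_sided_path)
    moreover have "fst (two_sided_path s \<omega> 0) = M' s \<omega>" by (simp add: two_sided_path_def)
    ultimately show ?thesis unfolding record_share_def next_eq
      by (simp add: s_def[symmetric] split: split_indicator)
  qed
  finally show ?case by (simp add: s_def t_def)
qed

text \<open>What a record at 0 receives: if the next record is at t, each of the t times of its
  cycle contributes 1/t.\<close>

lemma sum_record_share:
  assumes "\<exists>k>0. record_at k \<omega>" and in_space: "\<omega> \<in> space N"
  shows "(\<Sum>a. record_share J a (two_sided_path 0 \<omega>)) = indicator {\<omega>\<in>space N. record_at 0 \<omega> \<and> M' 0 \<omega> \<in> J} \<omega>"
proof -
  obtain k where "0 < k" "record_at k \<omega>" using assms(1) by auto
  then have "1 \<le> k" "record_at k \<omega>" by auto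
  then obtain t where t: "1 \<le> t" "record_at t \<omega>" "\<And>l. 1 \<le> l \<Longrightarrow> l < t \<Longrightarrow> \<not> record_at l \<omega>"
    using int_least[of "\<lambda>k. record_at k \<omega>" k 1] by metis
  have n: "next_record (two_sided_path 0 \<omega>) = nat t"
    by (rule next_record_two_sided_path) (use t in auto)
  have "(\<Sum>a. record_share J a (two_sided_path 0 \<omega>)) = (\<Sum>a<nat t. record_share J a (two_sided_path 0 \<omega>))"
    by (rule suminf_finite) (auto simp: record_share_def n)
  also have "\<dots> = (\<Sum>a<nat t. indicator {\<omega>\<in>space N. record_at 0 \<omega> \<and> M' 0 \<omega> \<in> J} \<omega> * ennreal (1 / real (nat t)))"
  proof (intro sum.cong refl)
    fix a assume "a \<in> {..<nat t}"
    then show "record_share J a (two_sided_path 0 \<omega>) =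
        indicator {\<omega>\<in>space N. record_at 0 \<omega> \<and> M' 0 \<omega> \<in> J} \<omega> * ennreal (1 / real (nat t))"
      using in_space unfolding record_share_def n record_two_sided_path
      by (simp add: two_sided_path_def split: split_indicator)
  qed
  also have "\<dots> = indicator {\<omega>\<in>space N. record_at 0 \<omega> \<and> M' 0 \<omega> \<in> J} \<omega> * (ennreal (real (nat t)) * ennreal (1 / real (nat t)))"
    by (simp only: sum_constant card_lessThan ennreal_of_nat_eq_real_of_nat mult.left_commute)
  also have "ennreal (real (nat t)) * ennreal (1 / real (nat t)) = 1"
    using t(1) by (subst ennreal_mult[symmetric]) auto
  finally show ?thesis by simp
qed

text \<open>Mass transport: every time in a cycle between consecutive records hands the share one over the
  length of the cycle to the record that starts it.\<close>
lemma integral_record_share: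
  "(\<integral>\<omega>. 1 / real_of_int (sigma1 X' \<omega> - sigma0 X' \<omega>) * indicator {\<omega>. M' (sigma0 X' \<omega>) \<omega> \<in> J} \<omega> \<partial>N) =
    measure N {\<omega>\<in>space N. record_at 0 \<omega> \<and> M' 0 \<omega> \<in> J}"
proof -
  let ?f = "\<lambda>\<omega>. 1 / real_of_int (sigma1 X' \<omega> - sigma0 X' \<omega>) * indicator {\<omega>. M' (sigma0 X' \<omega>) \<omega> \<in> J} \<omega>"
  have "(\<lambda>\<omega>. M' (sigma0 X' \<omega>) \<omega>) \<in> measurable N (count_space UNIV)"
    by (rule measurable_compose_countable) measurable
  then have [measurable]: "Measurable.pred N (\<lambda>\<omega>. M' (sigma0 X' \<omega>) \<omega> \<in> J)" by measurable
  have f: "?f \<in> borel_measurable N"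
    by (subst indicator_def) measurable
  have "(\<integral>\<^sup>+ \<omega>. ennreal (?f \<omega>) \<partial>N) = (\<integral>\<^sup>+ \<omega>. (\<Sum>a. record_share J a (two_sided_path (- int a) \<omega>)) \<partial>N)"
    by (rule nn_integral_cong_AE) (use AE_record_share[of J] in \<open>eventually_elim, simp\<close>)
  also have "\<dots> = (\<Sum>a. \<integral>\<^sup>+ \<omega>. record_share J a (two_sided_path (- int a) \<omega>) \<partial>N)"
    by (rule nn_integral_suminf) measurable
  \<comment> \<open>Stationarity replaces the path seen from -a by the path seen from 0: expected
    mass handed out becomes expected mass received.\<close>
  also have "\<dots> = (\<Sum>a. \<integral>\<^sup>+ \<omega>. record_share J a (two_sided_path 0 \<omega>) \<partial>N)"
    by (intro suminf_cong nn_integral_shift) measurable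
  also have "\<dots> = (\<integral>\<^sup>+ \<omega>. (\<Sum>a. record_share J a (two_sided_path 0 \<omega>)) \<partial>N)"
    by (rule nn_integral_suminf[symmetric]) measurable
  also have "\<dots> = (\<integral>\<^sup>+ \<omega>. indicator {\<omega>\<in>space N. record_at 0 \<omega> \<and> M' 0 \<omega> \<in> J} \<omega> \<partial>N)"
    by (rule nn_integral_cong_AE)
      (use AE_record_after AE_space in \<open>eventually_elim, simp add: sum_record_share del: indicator_simps\<close>)
  also have "\<dots> = ennreal (measure N {\<omega>\<in>space N. record_at 0 \<omega> \<and> M' 0 \<omega> \<in> J})"
    by (simp add: N.emeasure_eq_measure)
  finally have nn: "(\<integral>\<^sup>+ \<omega>. ennreal (?f \<omega>) \<partial>N) = ennreal (measure N {\<omega>\<in>space N. record_at 0 \<omega> \<and> M' 0 \<omega> \<in> J})" .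
  have "AE \<omega> in N. 0 \<le> ?f \<omega>" using AE_sigma by eventually_elim auto
  then show ?thesis using f nn by (subst integral_eq_nn_integral) auto
qed

lemma ladder_const_eq: "ladder_const N X' = measure N {\<omega>\<in>space N. record_at 0 \<omega>}"
  using integral_record_share[of UNIV] by (simp add: ladder_const_def)

lemma ladder_pi_eq:
  "ladder_pi N M' X' i = 1 / ladder_const N X' * measure N {\<omega>\<in>space N. record_at 0 \<omega> \<and> M' 0 \<omega> = i}"
  using integral_record_share[of "{i}"] by (simp add: ladder_pi_def)

lemma ladder_const_pos: "0 < ladder_const N X'"
  unfolding ladder_const_eq by (rule prob_record_pos)

lemma ladder_states_eq: "ladder_states N M' X' = {i. 0 < measure N {\<omega>\<in>space N. record_at 0 \<omega> \<and> M' 0 \<omega> = i}}"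
  using ladder_const_pos by (auto simp: ladder_states_def ladder_pi_eq zero_less_mult_iff zero_less_divide_iff)

end

section \<open>The ladder chain\<close>

lemma ladder_epoch_mono:
  assumes "ladder_epoch X n \<omega> = enat m" "k \<le> n"
  shows "\<exists>l\<le>m. ladder_epoch X k \<omega> = enat l"
  using assms(2)
proof (induction rule: inc_induct)
  case base
  then show ?case using assms(1) by blast
next
  case (step k)
  then obtain l where l: "l \<le> m" "ladder_epoch X (Suc k) \<omega> = enat l" by auto
  from l(2) obtain l' where "ladder_epoch X k \<omega> = enat l'" "l' < l" by (rule ladder_epoch_SucE) blast
  then show ?case using l(1) by (intro exI[of _ l']) auto
qed

lemma hitting_time_finite_iff: "hitting_time Z A \<omega> < \<infinity> \<longleftrightarrow> (\<exists>n\<ge>1. Z n \<omega> \<in> Some ` A)"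
proof
  assume "hitting_time Z A \<omega> < \<infinity>"
  then obtain t where "\<not> enat t < hitting_time Z A \<omega>"
    by (cases "hitting_time Z A \<omega>") auto
  then show "\<exists>n\<ge>1. Z n \<omega> \<in> Some ` A" unfolding hitting_time_less_iff by auto
next
  assume "\<exists>n\<ge>1. Z n \<omega> \<in> Some ` A"
  then obtain n where "1 \<le> n" "Z n \<omega> \<in> Some ` A" by auto
  then have "\<not> enat n < hitting_time Z A \<omega>" unfolding hitting_time_less_iff by auto
  then show "hitting_time Z A \<omega> < \<infinity>" by (cases "hitting_time Z A \<omega>") auto
qed

lemma measurable_path_ladder_chain [measurable]:
  "ladder_chain path_state path_increment n \<in>
    measurable (path_space :: (nat \<Rightarrow> 's::countable \<times> real) measure) (count_space UNIV)"
  by (rule measurable_ladder_chain) measurable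

lemma pred_path_forward_record [measurable]:
  "Measurable.pred path_space (forward_record path_increment n)"
  by (rule pred_forward_record) measurable

context dual_divergent_mrw
begin

abbreviation path_ladder :: "nat \<Rightarrow> (nat \<Rightarrow> 's \<times> real) \<Rightarrow> 's option" where
  "path_ladder \<equiv> ladder_chain path_state path_increment"

abbreviation R :: "'s \<Rightarrow> 's \<Rightarrow> real" where
  "R \<equiv> ladder_matrix Pr M X"

lemma measure_path_law:
  assumes [measurable]: "Measurable.pred path_space P"
  shows "measure (path_law i) {y. P y} = measure (Pr i) {\<omega>\<in>space (Pr i). P (forward_path M X \<omega>)}"
proof -
  have "{y\<in>space path_space. P y} \<in> sets path_space" by measurable
  then have E: "{y. P y} \<in> sets path_space" by simp
  have "forward_path M X -` {y. P y} \<inter> space (Pr i) = {\<omega>\<in>space (Pr i). P (forward_path M X \<omega>)}" by auto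
  then show ?thesis unfolding path_law_def using E by (simp add: measure_distr)
qed

lemma ladder_matrix_eq: "R i j = measure (path_law i) {y. path_ladder 1 y = Some j}"
  by (subst measure_path_law) (simp_all add: ladder_matrix_def ladder_chain_forward_path)

lemma markov_property_pred:
  assumes "Measurable.pred (past_algebra N M' X' n) A" and [measurable]: "Measurable.pred path_space P"
  shows "measure N {\<omega>\<in>space N. A \<omega> \<and> M' n \<omega> = i \<and> P (future_path n \<omega>)} =
    measure N {\<omega>\<in>space N. A \<omega> \<and> M' n \<omega> = i} * measure (path_law i) {y. P y}"
proof -
  have "{y\<in>space path_space. P y} \<in> sets path_space" by measurable
  then have E: "{y. P y} \<in> sets path_space" by simp
  have "{\<omega>\<in>space (past_algebra N M' X' n). A \<omega>} \<in> sets (past_algebra N M' X' n)"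
    using assms(1) by (rule predE)
  then have A: "{\<omega>\<in>space N. A \<omega>} \<in> sets (past_algebra N M' X' n)" by simp
  have "{\<omega>\<in>space N. A \<omega>} \<inter> {\<omega>\<in>space N. M' n \<omega> = i \<and> future_path n \<omega> \<in> {y. P y}} =
      {\<omega>\<in>space N. A \<omega> \<and> M' n \<omega> = i \<and> P (future_path n \<omega>)}"
    "{\<omega>\<in>space N. A \<omega>} \<inter> {\<omega>\<in>space N. M' n \<omega> = i} = {\<omega>\<in>space N. A \<omega> \<and> M' n \<omega> = i}" by auto
  then show ?thesis using markov_property[OF A E, of i] by simp
qed

lemma prob_state: "measure N {\<omega>\<in>space N. M' k \<omega> = i} = measure N {\<omega>\<in>space N. M' 0 \<omega> = i}"
  using prob_shift[of "\<lambda>y. fst (y 0) = i" k] by (simp add: two_sided_path_def)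

text \<open>The states at times 0 and 1 have the same law, and the one-step formula relates
  them.\<close>

lemma stationary_state: "stationary_distribution p (\<lambda>i. measure N {\<omega>\<in>space N. M' 0 \<omega> = i})"
  unfolding stationary_distribution_def
proof (intro conjI allI)
  show "((\<lambda>i. measure N {\<omega>\<in>space N. M' 0 \<omega> = i}) has_sum 1) UNIV"
    using N.has_sum_measure_fibres[of "\<lambda>_. True" "M' 0"] by (simp add: N.prob_space)
  fix j
  have "measure N {\<omega>\<in>space N. M' 1 \<omega> = j \<and> M' 0 \<omega> = i} = measure N {\<omega>\<in>space N. M' 0 \<omega> = i} * p i j" for i
  proof -
    have "measure (F i j) UNIV = 1"
      using mrw prob_space.prob_space[of "F i j"]
      by (metis markov_random_walk_def real_distribution.axioms(1) real_distribution.events_eq_borel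
          real_distribution.space_eq_univ)
    moreover have "space N \<inter> {\<omega>\<in>space N. M' 0 \<omega> = i} \<inter> {\<omega>\<in>space N. M' (0 + 1) \<omega> = j \<and> X' (0 + 1) \<omega> \<in> UNIV} =
        {\<omega>\<in>space N. M' 1 \<omega> = j \<and> M' 0 \<omega> = i}"
      "space N \<inter> {\<omega>\<in>space N. M' 0 \<omega> = i} = {\<omega>\<in>space N. M' 0 \<omega> = i}" by auto
    ultimately show ?thesis
      using measure_two_sided_step[of "space N" 0 UNIV i j] sets.top[of "past_algebra N M' X' 0"] by simp
  qed
  then show "((\<lambda>i. measure N {\<omega>\<in>space N. M' 0 \<omega> = i} * p i j) has_sum measure N {\<omega>\<in>space N. M' 0 \<omega> = j}) UNIV"
    using N.has_sum_measure_fibres[of "\<lambda>\<omega>. M' 1 \<omega> = j" "M' 0"] by (simp add: prob_state[of 1])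
qed simp

lemma irreducible: "\<exists>n. 0 < measure (Pr i) {\<omega>\<in>space (Pr i). M n \<omega> = j}"
  using pos_rec by (simp add: positive_recurrent_on_def)

lemma reachable: "(i, j) \<in> {(a, b). 0 < p a b}\<^sup>*"
proof -
  obtain n where n: "0 < measure (Pr i) {\<omega>\<in>space (Pr i). M n \<omega> = j}" using irreducible by auto
  have "markov_chain_from (Pr i) p i (\<lambda>n \<omega>. Some (M n \<omega>))"
    using mrw by (simp add: markov_random_walk_def)
  then show ?thesis by (rule markov_chain_from_reachable[where n = n]) (use n in auto)
qed

text \<open>\<pi> is given as some stationary distribution of \<open>p\<close>; uniqueness for the
  irreducible driving chain identifies it with the law of the state at time 0.\<close>

lemma prob_state_eq: "measure N {\<omega>\<in>space N. M' 0 \<omega> = i} = \<pi> i"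
proof -
  have "stochastic_on UNIV p" using mrw by (simp add: markov_random_walk_def)
  from stationary_distribution_unique[OF this reachable stationary_state \<pi>]
  show ?thesis by (rule fun_cong)
qed

text \<open>Permits division by the probability of any initial state, which carries statements from
  \<open>N\<close> to each \<open>Pr i\<close>.\<close>

lemma prob_state_pos: "0 < measure N {\<omega>\<in>space N. M' 0 \<omega> = i}"
proof -
  let ?\<mu> = "\<lambda>i. measure N {\<omega>\<in>space N. M' 0 \<omega> = i}"
  have sum: "(?\<mu> has_sum 1) UNIV" and inv: "\<And>j. ((\<lambda>i. ?\<mu> i * p i j) has_sum ?\<mu> j) UNIV"
    using stationary_state by (simp_all add: stationary_distribution_def)
  have "\<exists>l. 0 < ?\<mu> l"
  proof (rule ccontr)
    assume "\<not> ?thesis"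
    then have "?\<mu> l = 0" for l by (simp add: zero_less_measure_iff)
    then have "(?\<mu> has_sum 0) UNIV" by (intro has_sum_0)
    from has_sum_unique[OF sum this] show False by simp
  qed
  then obtain l where "0 < ?\<mu> l" ..
  then show ?thesis
    using invariant_positive[where d = ?\<mu>, OF measure_nonneg inv p_nonneg reachable] by blast
qed

text \<open>The Markov property at time 0 with trivial past: an almost sure event has conditional
  probability 1 given any initial state of positive probability.\<close>

lemma path_law_eq_1:
  assumes [measurable]: "Measurable.pred path_space P" and AE: "AE \<omega> in N. P (future_path 0 \<omega>)"
  shows "measure (path_law i) {y. P y} = 1"
proof -
  have "measure N {\<omega>\<in>space N. True \<and> M' 0 \<omega> = i \<and> P (future_path 0 \<omega>)} = measure N {\<omega>\<in>space N. True \<and> M' 0 \<omega> = i}"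
    by (rule N.finite_measure_eq_AE) (use AE in \<open>auto elim!: eventually_mono\<close>)
  then show ?thesis
    using markov_property_pred[of "\<lambda>_. True" 0 P i] prob_state_pos[of i] by simp
qed

lemma AE_forward:
  assumes [measurable]: "Measurable.pred path_space P" and "AE \<omega> in N. P (future_path 0 \<omega>)"
  shows "AE \<omega> in Pr i. P (forward_path M X \<omega>)"
proof -
  interpret prob_space "Pr i" by (rule prob_Pr)
  have "measure (Pr i) {\<omega>\<in>space (Pr i). P (forward_path M X \<omega>)} = 1"
    using path_law_eq_1[OF assms] by (simp add: measure_path_law)
  then show ?thesis by (subst (asm) prob_Collect_eq_1) auto
qed

lemma forward_record_future_path:
  "forward_record path_increment k (future_path m \<omega>) \<longleftrightarrow> forward_record (\<lambda>k. X' (m + int k)) k \<omega>"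
  by (simp add: future_path_def forward_record_forward_path)

lemma record_imp_forward_record:
  "record_at (m + int k) \<omega> \<Longrightarrow> forward_record path_increment k (future_path m \<omega>)"
  unfolding forward_record_future_path record_at_def by (rule past_record_imp_forward_record)

lemma forward_record_iff_record:
  "record_at (m + int r) \<omega> \<Longrightarrow> r \<le> k \<Longrightarrow> forward_record path_increment k (future_path m \<omega>) \<longleftrightarrow> record_at (m + int k) \<omega>"
  unfolding forward_record_future_path record_at_def by (rule forward_record_iff_past_record)

lemma state_future_path: "fst (future_path m \<omega> k) = M' (m + int k) \<omega>"
  by (simp add: future_path_def forward_path_def)

lemma AE_forward_record_after: "AE \<omega> in N. \<forall>n. \<exists>k>n. forward_record path_increment k (future_path 0 \<omega>)"
  using AE_record_after
proof eventually_elim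
  case (elim \<omega>)
  show ?case
  proof
    fix n
    obtain k where k: "int n < k" "record_at k \<omega>" using elim by auto
    then have "record_at (0 + int (nat k)) \<omega>" by simp
    then show "\<exists>k>n. forward_record path_increment k (future_path 0 \<omega>)"
      using k(1) record_imp_forward_record by (intro exI[of _ "nat k"]) auto
  qed
qed

text \<open>Records after time 0 are forward records, so under \<open>N\<close> there are almost
  surely infinitely many of these. This passes to every \<open>Pr i\<close>, and arbitrarily late
  records keep all ladder epochs finite.\<close>

lemma AE_ladder_chain_alive: "AE \<omega> in Pr i. \<forall>n. ladder_chain M X n \<omega> \<noteq> None"
proof -
  have "AE \<omega> in Pr i. \<forall>n. \<exists>k>n. forward_record path_increment k (forward_path M X \<omega>)"
    by (rule AE_forward[OF _ AE_forward_record_after]) measurable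
  then show ?thesis
  proof eventually_elim
    case (elim \<omega>)
    show ?case
    proof
      fix n
      obtain m where "ladder_epoch X n \<omega> = enat m"
        using ladder_epoch_finite[of X \<omega>] elim by (auto simp: forward_record_forward_path)
      then show "ladder_chain M X n \<omega> \<noteq> None" by (simp add: ladder_chain_def)
    qed
  qed
qed

lemma measurable_ladder [measurable]: "ladder_chain M X n \<in> measurable (Pr i) (count_space UNIV)"
  by (intro measurable_ladder_chain measurable_X measurable_M)

lemma ladder_stochastic: "stochastic_on UNIV R"
  unfolding stochastic_on_def
proof (intro ballI conjI)
  fix i
  interpret prob_space "Pr i" by (rule prob_Pr)
  have "((\<lambda>o'. measure (Pr i) {\<omega>\<in>space (Pr i). True \<and> ladder_chain M X 1 \<omega> = o'}) has_sum
      measure (Pr i) {\<omega>\<in>space (Pr i). True}) UNIV"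
    by (rule has_sum_measure_fibres) measurable
  moreover have "measure (Pr i) {\<omega>\<in>space (Pr i). ladder_chain M X 1 \<omega> = None} = 0"
  proof (subst prob_Collect_eq_0)
    show "AE \<omega> in Pr i. ladder_chain M X 1 \<omega> \<noteq> None"
      using AE_ladder_chain_alive[of i] by eventually_elim blast
  qed measurable
  ultimately have "((\<lambda>o'. measure (Pr i) {\<omega>\<in>space (Pr i). ladder_chain M X 1 \<omega> = o'}) has_sum 1) (range Some)"
    by (subst has_sum_cong_neutral[where T = UNIV]) (auto simp: notin_range_Some prob_space)
  then have "((\<lambda>o'. measure (Pr i) {\<omega>\<in>space (Pr i). ladder_chain M X 1 \<omega> = o'}) \<circ> Some has_sum 1) UNIV"
    by (subst (asm) has_sum_reindex) auto
  moreover have "(\<lambda>o'. measure (Pr i) {\<omega>\<in>space (Pr i). ladder_chain M X 1 \<omega> = o'}) \<circ> Some = R i"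
    by (simp add: fun_eq_iff ladder_matrix_def)
  ultimately show "(R i has_sum 1) UNIV" by simp
qed (simp add: ladder_matrix_def)

text \<open>A record at 0 is an event of the past at time 0, and the first ladder state is a
  function of the future.\<close>

lemma prob_ladder_step:
  "measure N {\<omega>\<in>space N. record_at 0 \<omega> \<and> M' 0 \<omega> = i \<and> path_ladder 1 (future_path 0 \<omega>) = Some j} =
    measure N {\<omega>\<in>space N. record_at 0 \<omega> \<and> M' 0 \<omega> = i} * R i j"
  unfolding ladder_matrix_eq by (rule markov_property_pred, rule pred_record_past, simp) measurable

text \<open>A record at 0 makes forward and two-sided records agree from 0 on, so the first ladder
  epoch is the next record. Writing it as \<open>Suc n\<close> lets \<open>n\<close> range over all
  naturals in the later series.\<close>

lemma path_ladder_1_iff: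
  assumes "record_at 0 \<omega>"
  shows "path_ladder 1 (future_path 0 \<omega>) = Some j \<longleftrightarrow>
    (\<exists>n. record_at (int (Suc n)) \<omega> \<and> (\<forall>k. 0 < k \<and> k < Suc n \<longrightarrow> \<not> record_at (int k) \<omega>) \<and> M' (int (Suc n)) \<omega> = j)"
proof -
  have iff: "forward_record path_increment k (future_path 0 \<omega>) \<longleftrightarrow> record_at (int k) \<omega>" for k
    using forward_record_iff_record[of 0 0 \<omega> k] assms by simp
  have Suc: "(\<exists>m. 0 < m \<and> G m) \<longleftrightarrow> (\<exists>n. G (Suc n))" for G :: "nat \<Rightarrow> bool"
    by (metis gr0_conv_Suc)
  show ?thesis
    unfolding ladder_chain_eq_Some_iff ladder_epoch_1_iff iff state_future_path conj_assoc Suc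
    by simp
qed

text \<open>By stationarity, a record followed by the next one after exactly \<open>n\<close> steps is as likely as a
  record preceded by the previous one exactly \<open>n\<close> steps before.\<close>
lemma prob_next_ladder:
  "measure N {\<omega>\<in>space N. record_at 0 \<omega> \<and> path_ladder 1 (future_path 0 \<omega>) = Some j} =
    measure N {\<omega>\<in>space N. record_at 0 \<omega> \<and> M' 0 \<omega> = j}"
proof -
  let ?P = "\<lambda>n y. past_record (\<lambda>l. path_increment l y) 0 \<and> past_record (\<lambda>l. path_increment l y) (int (Suc n)) \<and>
    (\<forall>k. 0 < k \<and> k < Suc n \<longrightarrow> \<not> past_record (\<lambda>l. path_increment l y) (int k)) \<and> fst (y (int (Suc n))) = j"
  let ?A = "\<lambda>m n. {\<omega>\<in>space N. ?P n (two_sided_path m \<omega>)}"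
  have P: "?P n (two_sided_path m \<omega>) \<longleftrightarrow> record_at m \<omega> \<and> record_at (m + int (Suc n)) \<omega> \<and>
    (\<forall>k. 0 < k \<and> k < Suc n \<longrightarrow> \<not> record_at (m + int k) \<omega>) \<and> M' (m + int (Suc n)) \<omega> = j" for m n \<omega>
    unfolding record_two_sided_path by (simp add: two_sided_path_def)
  have A: "?A m n \<in> sets N" for m n by measurable
  have shift: "measure N (?A m n) = measure N (?A 0 n)" for m n
    by (rule prob_shift) measurable
  have disj0: "disjoint_family (?A 0)"
    unfolding disjoint_family_on_def
  proof (intro ballI impI)
    fix m n :: nat assume "m \<noteq> n"
    then show "?A 0 m \<inter> ?A 0 n = {}"
      unfolding P by (cases m n rule: linorder_cases) fastforce+
  qed
  \<comment> \<open>The shift by -(n + 1) places the later of the two records at 0; the events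
    differ in the position of the previous record, which is unique.\<close>
  have disj1: "disjoint_family (\<lambda>n. ?A (- int (Suc n)) n)"
    unfolding disjoint_family_on_def
  proof (intro ballI impI)
    have *: "?A (- int (Suc m)) m \<inter> ?A (- int (Suc n)) n = {}" if "m < n" for m n
    proof -
      have "- int (Suc n) + int (n - m) = - int (Suc m)" "0 < n - m" "n - m < Suc n" using that by auto
      then show ?thesis unfolding P by (metis (mono_tags, lifting) Int_Collect empty_iff equals0I mem_Collect_eq)
    qed
    fix m n :: nat assume "m \<noteq> n"
    then show "?A (- int (Suc m)) m \<inter> ?A (- int (Suc n)) n = {}"
      using *[of m n] *[of n m] by (cases m n rule: linorder_cases) auto
  qed
  have "(\<lambda>n. measure N (?A 0 n)) sums measure N (\<Union>n. ?A 0 n)"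
    using A disj0 by (intro N.finite_measure_UNION) auto
  moreover have "(\<Union>n. ?A 0 n) = {\<omega>\<in>space N. record_at 0 \<omega> \<and> path_ladder 1 (future_path 0 \<omega>) = Some j}"
    unfolding P using path_ladder_1_iff[of _ j] by auto
  moreover have "(\<lambda>n. measure N (?A (- int (Suc n)) n)) sums measure N (\<Union>n. ?A (- int (Suc n)) n)"
    using A disj1 by (intro N.finite_measure_UNION) auto
  \<comment> \<open>Almost surely there is a record before 0, so a record at 0 in state
    \<open>j\<close> lies in one of the events.\<close>
  moreover have "measure N (\<Union>n. ?A (- int (Suc n)) n) = measure N {\<omega>\<in>space N. record_at 0 \<omega> \<and> M' 0 \<omega> = j}"
  proof (rule N.finite_measure_eq_AE)
    show "AE \<omega> in N. \<omega> \<in> (\<Union>n. ?A (- int (Suc n)) n) \<longleftrightarrow> \<omega> \<in> {\<omega>\<in>space N. record_at 0 \<omega> \<and> M' 0 \<omega> = j}"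
      using AE_record_before AE_space
    proof eventually_elim
      case (elim \<omega>)
      have "\<exists>n. record_at (- int (Suc n)) \<omega> \<and> (\<forall>k. 0 < k \<and> k < Suc n \<longrightarrow> \<not> record_at (- int (Suc n) + int k) \<omega>)"
      proof -
        obtain k where "k \<le> -1" "record_at k \<omega>" using elim by blast
        then obtain l where l: "l \<le> -1" "record_at l \<omega>" "\<And>j. l < j \<Longrightarrow> j \<le> -1 \<Longrightarrow> \<not> record_at j \<omega>"
          using int_greatest[of "\<lambda>k. record_at k \<omega>" k "-1"] by metis
        define n where "n = nat (- l - 1)"
        have "l = - int (Suc n)" using l(1) by (simp add: n_def)
        then show ?thesis using l(2,3) by (intro exI[of _ n]) auto
      qed
      then show ?case using elim(2) unfolding P by auto
    qed
  qed (use A in auto)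
  ultimately show ?thesis unfolding shift[of "- int (Suc _)"] by (metis (no_types, lifting) sums_unique2)
qed

text \<open>Summed over the current state, the Markov property gives the mass of records whose
  successor is in \<open>j\<close>, and by \<open>prob_next_ladder\<close> that is the mass of
  records in \<open>j\<close>. Dividing by c normalises.\<close>

lemma ladder_pi_stationary: "stationary_distribution R (ladder_pi N M' X')"
  unfolding stationary_distribution_def
proof (intro conjI allI)
  let ?q = "\<lambda>i. measure N {\<omega>\<in>space N. record_at 0 \<omega> \<and> M' 0 \<omega> = i}"
  have c: "0 < ladder_const N X'" by (rule ladder_const_pos)
  show "0 \<le> ladder_pi N M' X' i" for i using c by (simp add: ladder_pi_eq)
  have pi: "ladder_pi N M' X' = (\<lambda>i. 1 / ladder_const N X' * ?q i)" by (simp add: fun_eq_iff ladder_pi_eq)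
  have "(?q has_sum ladder_const N X') UNIV"
    unfolding ladder_const_eq by (rule N.has_sum_measure_fibres) measurable
  from has_sum_cmult_right[OF this, of "1 / ladder_const N X'"]
  show "(ladder_pi N M' X' has_sum 1) UNIV" using c by (simp add: pi)
  fix j
  have "((\<lambda>i. measure N {\<omega>\<in>space N. (record_at 0 \<omega> \<and> path_ladder 1 (future_path 0 \<omega>) = Some j) \<and> M' 0 \<omega> = i}) has_sum
      measure N {\<omega>\<in>space N. record_at 0 \<omega> \<and> path_ladder 1 (future_path 0 \<omega>) = Some j}) UNIV"
    by (rule N.has_sum_measure_fibres) measurable
  moreover have "measure N {\<omega>\<in>space N. (record_at 0 \<omega> \<and> path_ladder 1 (future_path 0 \<omega>) = Some j) \<and> M' 0 \<omega> = i} = ?q i * R i j" for i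
    using prob_ladder_step[of i j] by (simp add: conj_ac)
  ultimately have "((\<lambda>i. ?q i * R i j) has_sum ?q j) UNIV" by (simp only: prob_next_ladder)
  from has_sum_cmult_right[OF this, of "1 / ladder_const N X'"]
  show "((\<lambda>i. ladder_pi N M' X' i * R i j) has_sum ladder_pi N M' X' j) UNIV"
    by (simp add: pi mult.assoc)
qed

text \<open>Split by the value m of the n-th ladder epoch. On each piece the ladder up to n is an
  event of the past at time m, and the next ladder step is the first ladder step of the future after
  m, so the Markov property at the fixed time m applies. The argument runs under \<open>N\<close>,
  and the probability of the initial state is cancelled at the end.\<close>

lemma ladder_markov_step:
  "measure (path_law i) {y. \<forall>k\<le>Suc n. path_ladder k y = Some (h k)} =
    measure (path_law i) {y. \<forall>k\<le>n. path_ladder k y = Some (h k)} * R (h n) (h (Suc n))"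
proof -
  let ?P = "\<lambda>n y. \<forall>k\<le>n. path_ladder k y = Some (h k)"
  let ?M = "\<lambda>k. M' (int k)" and ?X = "\<lambda>k. X' (int k)"
  define Q where "Q n \<omega> \<longleftrightarrow> M' 0 \<omega> = i \<and> (\<forall>k\<le>n. ladder_chain ?M ?X k \<omega> = Some (h k))" for n \<omega>
  define A where "A m \<omega> \<longleftrightarrow> Q n \<omega> \<and> ladder_epoch ?X n \<omega> = enat m" for m \<omega>
  define S where "S m = {\<omega>\<in>space N. A m \<omega>}" for m
  define T where "T m = {\<omega>\<in>space N. A m \<omega> \<and> ladder_chain ?M ?X (Suc n) \<omega> = Some (h (Suc n))}" for m
  have ladder: "path_ladder k (future_path m \<omega>) = ladder_chain (\<lambda>k. M' (m + int k)) (\<lambda>k. X' (m + int k)) k \<omega>" for k m \<omega>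
    by (simp add: future_path_def ladder_chain_forward_path)
  have ladder0: "path_ladder k (future_path 0 \<omega>) = ladder_chain ?M ?X k \<omega>" for k \<omega>
    by (simp add: ladder)
  have Qn: "ladder_chain ?M ?X n \<omega> = Some (h n)" if "Q n \<omega>" for \<omega> n
    using that by (simp add: Q_def)
  have Q_Suc: "Q (Suc n) \<omega> \<longleftrightarrow> Q n \<omega> \<and> ladder_chain ?M ?X (Suc n) \<omega> = Some (h (Suc n))" for \<omega>
    by (auto simp: Q_def le_Suc_eq)
  have A_state: "M' (int m) \<omega> = h n" if "A m \<omega>" for m \<omega>
  proof -
    have "ladder_chain ?M ?X n \<omega> = Some (h n)" "ladder_epoch ?X n \<omega> = enat m"
      using that Qn by (auto simp: A_def)
    then show ?thesis by (simp add: ladder_chain_def)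
  qed
  have A_shift: "ladder_chain ?M ?X (Suc n) \<omega> = path_ladder 1 (future_path (int m) \<omega>)" if "A m \<omega>" for m \<omega>
  proof -
    have "ladder_epoch ?X n \<omega> = enat m" using that by (simp add: A_def)
    then show ?thesis unfolding ladder using ladder_chain_shift[of ?X n \<omega> m ?M] by simp
  qed
  \<comment> \<open>Earlier epochs are at most \<open>m\<close>, so their values can be bounded;
    this places \<open>A m\<close> in the past at time \<open>m\<close>.\<close>
  have A_iff: "A m \<omega> \<longleftrightarrow> M' 0 \<omega> = i \<and> (\<forall>k\<in>{..n}. \<exists>l\<in>{..m}. ladder_epoch ?X k \<omega> = enat l \<and> ?M l \<omega> = h k) \<and>
      ladder_epoch ?X n \<omega> = enat m" for m \<omega>
  proof -
    have "(\<exists>l. ladder_epoch ?X k \<omega> = enat l \<and> ?M l \<omega> = h k) \<longleftrightarrow> (\<exists>l\<in>{..m}. ladder_epoch ?X k \<omega> = enat l \<and> ?M l \<omega> = h k)"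
      if "ladder_epoch ?X n \<omega> = enat m" "k \<le> n" for k
      using ladder_epoch_mono[OF that] by auto
    then show ?thesis unfolding A_def Q_def ladder_chain_eq_Some_iff by (auto simp del: ladder_epoch.simps)
  qed
  have A: "Measurable.pred (past_algebra N M' X' (int m)) (A m)" for m
  proof -
    let ?C = "past_algebra N M' X' (int m)"
    have 1: "Measurable.pred ?C (\<lambda>\<omega>. ladder_epoch ?X k \<omega> = enat l)" if "l \<le> m" for k l
      using that by (intro pred_ladder_epoch_eq measurable_X'_past) auto
    have 2: "Measurable.pred ?C (\<lambda>\<omega>. ?M l \<omega> = a)" if "l \<le> m" for l a
    proof -
      have [measurable]: "?M l \<in> measurable ?C (count_space UNIV)"
        using that by (intro measurable_M'_past) simp
      show ?thesis by measurable
    qed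
    have "A m = (\<lambda>\<omega>. M' 0 \<omega> = i \<and> (\<forall>k\<in>{..n}. \<exists>l\<in>{..m}. ladder_epoch ?X k \<omega> = enat l \<and> ?M l \<omega> = h k) \<and>
      ladder_epoch ?X n \<omega> = enat m)" by (simp only: fun_eq_iff A_iff simp_thms)
    also have "Measurable.pred ?C \<dots>"
      using 1 2 2[of 0 i] by (intro pred_intros_logic pred_intros_finite) auto
    finally show ?thesis .
  qed
  have S_sets: "S m \<in> sets N" for m
    using predE[OF A[of m]] sets_past[of "S m" "int m"] by (simp add: S_def)
  have T_eq: "T m = {\<omega>\<in>space N. A m \<omega> \<and> M' (int m) \<omega> = h n \<and> path_ladder 1 (future_path (int m) \<omega>) = Some (h (Suc n))}" for m
    unfolding T_def using A_state A_shift by auto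
  have S_eq: "S m = {\<omega>\<in>space N. A m \<omega> \<and> M' (int m) \<omega> = h n}" for m
    unfolding S_def using A_state by auto
  have step: "measure N (T m) = measure N (S m) * R (h n) (h (Suc n))" for m
    unfolding T_eq S_eq ladder_matrix_eq by (rule markov_property_pred[OF A]) measurable
  have T_sets: "T m \<in> sets N" for m
  proof -
    have "{\<omega>\<in>space N. path_ladder (Suc n) (future_path 0 \<omega>) = Some (h (Suc n))} \<in> sets N" by measurable
    moreover have "T m = S m \<inter> {\<omega>\<in>space N. path_ladder (Suc n) (future_path 0 \<omega>) = Some (h (Suc n))}"
      unfolding ladder0 T_def S_def by auto
    ultimately show ?thesis using S_sets[of m] by simp
  qed
  \<comment> \<open>A live ladder state has a finite epoch, so the pieces exhaust the event.\<close>
  have alive: "\<exists>m. A m \<omega>" if "Q n \<omega>" for \<omega>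
    using Qn[OF that] that unfolding A_def ladder_chain_eq_Some_iff by blast
  have US: "(\<Union>m. S m) = {\<omega>\<in>space N. Q n \<omega>}"
    using alive unfolding S_def by (auto simp: A_def)
  have UT: "(\<Union>m. T m) = {\<omega>\<in>space N. Q (Suc n) \<omega>}"
    using alive unfolding T_def Q_Suc by (auto simp: A_def)
  have "(\<lambda>m. measure N (S m)) sums measure N (\<Union>m. S m)"
    using S_sets by (intro N.finite_measure_UNION) (auto simp: disjoint_family_on_def S_def A_def)
  then have "(\<lambda>m. measure N (T m)) sums (measure N (\<Union>m. S m) * R (h n) (h (Suc n)))"
    unfolding step by (rule sums_mult2)
  moreover have "(\<lambda>m. measure N (T m)) sums measure N (\<Union>m. T m)"
    using T_sets by (intro N.finite_measure_UNION) (auto simp: disjoint_family_on_def T_def A_def)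
  ultimately have "measure N (\<Union>m. T m) = measure N (\<Union>m. S m) * R (h n) (h (Suc n))"
    by (rule sums_unique2[symmetric])
  moreover have "measure N {\<omega>\<in>space N. Q n \<omega>} =
      measure N {\<omega>\<in>space N. M' 0 \<omega> = i} * measure (path_law i) {y. ?P n y}" for n
  proof -
    have "Measurable.pred path_space (?P n)" by measurable
    then show ?thesis
      using markov_property_pred[of "\<lambda>_. True" 0 "?P n" i] by (simp add: ladder0 Q_def)
  qed
  ultimately show ?thesis unfolding US UT using prob_state_pos[of i] by simp
qed

lemma ladder_markov_chain: "markov_chain_from (Pr i) R i (ladder_chain M X)"
  unfolding markov_chain_from_def
proof (intro conjI allI)
  show "prob_space (Pr i)" by (rule prob_Pr)
  show "AE \<omega> in Pr i. ladder_chain M X 0 \<omega> = Some i"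
  proof -
    have "AE \<omega> in Pr i. Some (M 0 \<omega>) = Some i"
      using mrw unfolding markov_random_walk_def markov_chain_from_def by blast
    then show ?thesis by (simp add: ladder_chain_def zero_enat_def)
  qed
  fix n h
  have "measure (path_law i) {y. \<forall>k\<le>n. path_ladder k y = Some (h k)} =
      measure (Pr i) {\<omega>\<in>space (Pr i). \<forall>k\<le>n. ladder_chain M X k \<omega> = Some (h k)}" for n
    by (subst measure_path_law) (auto simp: ladder_chain_forward_path)
  then show "measure (Pr i) {\<omega>\<in>space (Pr i). \<forall>k\<le>Suc n. ladder_chain M X k \<omega> = Some (h k)} =
      measure (Pr i) {\<omega>\<in>space (Pr i). \<forall>k\<le>n. ladder_chain M X k \<omega> = Some (h k)} * R (h n) (h (Suc n))"
    using ladder_markov_step[of i n h] by simp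
qed measurable

text \<open>From any record after \<open>m\<close> on, the forward records of the walk started at
  \<open>m\<close> are the two-sided records. So infinite recurrence to \<open>j\<close> along
  records can be read off from the future after any time \<open>m\<close>.\<close>

lemma AE_ladder_infinitely_often:
  "AE \<omega> in N. (\<forall>n. \<exists>k>n. record_at k \<omega> \<and> M' k \<omega> = j) \<longleftrightarrow>
    (\<forall>n. \<exists>k>n. forward_record path_increment k (future_path m \<omega>) \<and> fst (future_path m \<omega> k) = j)"
  using AE_record_after
proof eventually_elim
  case (elim \<omega>)
  obtain r' where r': "m < r'" "record_at r' \<omega>" using elim by blast
  define r where "r = nat (r' - m)"
  have r: "record_at (m + int r) \<omega>" using r' by (simp add: r_def)
  show ?case
  proof safe
    fix n assume "\<forall>n. \<exists>k>n. record_at k \<omega> \<and> M' k \<omega> = j"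
    then obtain k where k: "m + int n < k" "record_at k \<omega>" "M' k \<omega> = j" by blast
    define k' where "k' = nat (k - m)"
    have "k = m + int k'" "n < k'" using k(1) by (auto simp: k'_def)
    then show "\<exists>k>n. forward_record path_increment k (future_path m \<omega>) \<and> fst (future_path m \<omega> k) = j"
      using k record_imp_forward_record by (intro exI[of _ k']) (auto simp: state_future_path)
  next
    fix n assume *: "\<forall>n. \<exists>k>n. forward_record path_increment k (future_path m \<omega>) \<and> fst (future_path m \<omega> k) = j"
    obtain k where k: "max r (nat (n - m)) < k" "forward_record path_increment k (future_path m \<omega>)"
      "fst (future_path m \<omega> k) = j"
      using * by blast
    then have "record_at (m + int k) \<omega>" using forward_record_iff_record[OF r, of k] by simp
    then show "\<exists>k>n. record_at k \<omega> \<and> M' k \<omega> = j"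
      using k by (intro exI[of _ "m + int k"]) (auto simp: state_future_path)
  qed
qed

lemma ladder_reachable_prob:
  assumes j: "j \<in> ladder_states N M' X'"
  shows "\<exists>n. 0 < measure (Pr i) {\<omega>\<in>space (Pr i). ladder_chain M X n \<omega> = Some j}"
proof -
  let ?W = "\<lambda>\<omega>. \<forall>n. \<exists>k>n. record_at k \<omega> \<and> M' k \<omega> = j"
  let ?L = "\<lambda>y. \<forall>n. \<exists>k>n. forward_record path_increment k y \<and> fst (y k) = j"
  have L [measurable]: "Measurable.pred path_space ?L" by measurable
  have eq: "measure N {\<omega>\<in>space N. Q \<omega> \<and> ?W \<omega>} = measure N {\<omega>\<in>space N. Q \<omega> \<and> ?L (future_path m \<omega>)}"
    if [measurable]: "Measurable.pred N Q" for Q m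
    by (rule N.finite_measure_eq_AE) (use AE_ladder_infinitely_often[of j m] in \<open>auto elim!: eventually_mono\<close>)
  have "0 < measure N {\<omega>\<in>space N. record_at 0 \<omega> \<and> M' 0 \<omega> = j}" using j by (simp add: ladder_states_eq)
  \<comment> \<open>By \<open>AE_record_infinitely_often\<close> one record in state
    \<open>j\<close> almost surely entails infinitely many later ones.\<close>
  also have "\<dots> \<le> measure N {\<omega>\<in>space N. ?W \<omega>}"
    by (rule N.finite_measure_mono_AE)
      (use AE_record_infinitely_often[of "{j}"] in \<open>auto elim!: eventually_mono\<close>)
  finally have "0 < measure N {\<omega>\<in>space N. ?W \<omega>}" .
  moreover have "((\<lambda>l. measure N {\<omega>\<in>space N. ?W \<omega> \<and> M' 0 \<omega> = l}) has_sum measure N {\<omega>\<in>space N. ?W \<omega>}) UNIV"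
    by (rule N.has_sum_measure_fibres) measurable
  \<comment> \<open>Since there are countably many initial states, one of them carries positive mass
    of the event.\<close>
  ultimately obtain l where "measure N {\<omega>\<in>space N. ?W \<omega> \<and> M' 0 \<omega> = l} \<noteq> 0"
    using has_sum_0 has_sum_unique by (metis (no_types, lifting) less_irrefl)
  moreover have "measure N {\<omega>\<in>space N. ?W \<omega> \<and> M' 0 \<omega> = l} = measure N {\<omega>\<in>space N. M' 0 \<omega> = l \<and> ?W \<omega>}"
    by (intro arg_cong[where f = "measure N"]) auto
  moreover have "\<dots> = measure N {\<omega>\<in>space N. M' 0 \<omega> = l} * measure (path_law l) {y. ?L y}"
    using markov_property_pred[of "\<lambda>_. True" 0 ?L l] eq[of "\<lambda>\<omega>. M' 0 \<omega> = l" 0] by simp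
  ultimately have l: "0 < measure (path_law l) {y. ?L y}" by (auto simp: zero_less_measure_iff)
  obtain n where n: "0 < measure (Pr i) {\<omega>\<in>space (Pr i). M n \<omega> = l}" using irreducible by blast
  have "measure (path_law i) {y. fst (y n) = l} = measure (Pr i) {\<omega>\<in>space (Pr i). M n \<omega> = l}"
    by (subst measure_path_law) (simp_all add: forward_path_def)
  then have "0 < measure N {\<omega>\<in>space N. M' 0 \<omega> = i \<and> M' (int n) \<omega> = l}"
    using markov_property_pred[of "\<lambda>_. True" 0 "\<lambda>y. fst (y n) = l" i] n prob_state_pos[of i]
    by (simp add: state_future_path)
  moreover have "Measurable.pred (past_algebra N M' X' (int n)) (\<lambda>\<omega>. M' 0 \<omega> = i)"
  proof -
    have [measurable]: "M' 0 \<in> measurable (past_algebra N M' X' (int n)) (count_space UNIV)"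
      by (rule measurable_M'_past) simp
    show ?thesis by measurable
  qed
  \<comment> \<open>Travel from \<open>i\<close> to \<open>l\<close> in \<open>n\<close> steps and
    use the Markov property at time \<open>n\<close>; then the condition on the future after
    \<open>n\<close> is exchanged for the event \<open>?W\<close>, which is read off from time 0
    again.\<close>
  ultimately have "0 < measure N {\<omega>\<in>space N. M' 0 \<omega> = i \<and> M' (int n) \<omega> = l \<and> ?L (future_path (int n) \<omega>)}"
    using markov_property_pred[of "\<lambda>\<omega>. M' 0 \<omega> = i" "int n" ?L l] l by simp
  also have "\<dots> = measure N {\<omega>\<in>space N. (M' 0 \<omega> = i \<and> M' (int n) \<omega> = l) \<and> ?W \<omega>}"
    by (subst eq[of _ "int n"]) measurable
  also have "\<dots> \<le> measure N {\<omega>\<in>space N. M' 0 \<omega> = i \<and> ?W \<omega>}"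
    by (rule N.finite_measure_mono, blast) measurable
  also have "\<dots> = measure N {\<omega>\<in>space N. M' 0 \<omega> = i} * measure (path_law i) {y. ?L y}"
    using markov_property_pred[of "\<lambda>_. True" 0 ?L i] eq[of "\<lambda>\<omega>. M' 0 \<omega> = i" 0] by simp
  finally have pos: "0 < measure (path_law i) {y. ?L y}" by (auto simp: zero_less_mult_iff)
  interpret prob_space "Pr i" by (rule prob_Pr)
  show ?thesis
  proof (rule ccontr)
    assume "\<not> ?thesis"
    then have "measure (Pr i) {\<omega>\<in>space (Pr i). ladder_chain M X n \<omega> = Some j} = 0" for n
      by (simp add: zero_less_measure_iff)
    then have "AE \<omega> in Pr i. \<forall>n. ladder_chain M X n \<omega> \<noteq> Some j"
      by (subst AE_all_countable) (simp add: prob_Collect_eq_0)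
    \<comment> \<open>Forward records are ladder epochs, so a ladder that never meets
      \<open>j\<close> has no forward record in state \<open>j\<close>.\<close>
    then have "AE \<omega> in Pr i. \<not> ?L (forward_path M X \<omega>)"
    proof eventually_elim
      case (elim \<omega>)
      show ?case
      proof
        assume "?L (forward_path M X \<omega>)"
        then obtain k where k: "forward_record X k \<omega>" "M k \<omega> = j"
          unfolding forward_record_forward_path by (auto simp: forward_path_def)
        obtain n where "ladder_epoch X n \<omega> = enat k"
          using ladder_epoch_forward_record[OF k(1)] by auto
        then have "ladder_chain M X n \<omega> = Some j" using k(2) by (simp add: ladder_chain_def)
        then show False using elim by blast
      qed
    qed
    then have "measure (Pr i) {\<omega>\<in>space (Pr i). ?L (forward_path M X \<omega>)} = 0"
      by (subst prob_Collect_eq_0) auto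
    then show False using pos by (simp add: measure_path_law)
  qed
qed

lemma ladder_reachable:
  assumes "j \<in> ladder_states N M' X'"
  shows "(i, j) \<in> {(a, b). 0 < R a b}\<^sup>*"
proof -
  obtain n where "0 < measure (Pr i) {\<omega>\<in>space (Pr i). ladder_chain M X n \<omega> = Some j}"
    using ladder_reachable_prob[OF assms] by blast
  then show ?thesis by (rule markov_chain_from_reachable[OF ladder_markov_chain _ AE_ladder_chain_alive])
qed

lemma ladder_states_nonempty: "\<exists>j. j \<in> ladder_states N M' X'"
proof (rule ccontr)
  assume "\<not> ?thesis"
  then have "ladder_pi N M' X' j = 0" for j
    using ladder_pi_stationary by (force simp: ladder_states_def stationary_distribution_def order_le_less)
  then have "(ladder_pi N M' X' has_sum 0) UNIV" by (intro has_sum_0)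
  moreover have "(ladder_pi N M' X' has_sum 1) UNIV"
    using ladder_pi_stationary by (simp add: stationary_distribution_def)
  ultimately show False using has_sum_unique by fastforce
qed

text \<open>One state of the support, accessible from everywhere, settles uniqueness among all
  distributions on the whole state space.\<close>

lemma stationary_iff: "stationary_distribution R \<nu> \<longleftrightarrow> \<nu> = ladder_pi N M' X'"
proof
  obtain j where "j \<in> ladder_states N M' X'" using ladder_states_nonempty ..
  then show "\<nu> = ladder_pi N M' X'" if "stationary_distribution R \<nu>"
    using stationary_distribution_unique[OF ladder_stochastic ladder_reachable that ladder_pi_stationary] by blast
qed (simp add: ladder_pi_stationary)

text \<open>The support of an invariant measure is closed: a positive transition out of it would
  give mass to its target.\<close>

lemma ladder_stochastic_on: "stochastic_on (ladder_states N M' X') R"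
  unfolding stochastic_on_def
proof (intro ballI conjI)
  fix i assume i: "i \<in> ladder_states N M' X'"
  have R: "0 \<le> R i j" "(R i has_sum 1) UNIV" for i j using ladder_stochastic by (auto simp: stochastic_on_def)
  have inv: "0 \<le> ladder_pi N M' X' i" "((\<lambda>i. ladder_pi N M' X' i * R i j) has_sum ladder_pi N M' X' j) UNIV" for i j
    using ladder_pi_stationary by (auto simp: stationary_distribution_def)
  have "R i j = 0" if "j \<notin> ladder_states N M' X'" for j
  proof (rule ccontr)
    assume "R i j \<noteq> 0"
    then have "(i, j) \<in> {(a, b). 0 < R a b}\<^sup>*" using R(1)[of i j] by (intro r_into_rtrancl) auto
    then have "0 < ladder_pi N M' X' j"
      using invariant_positive[where d = "ladder_pi N M' X'" and R = R, OF inv(1) inv(2) R(1)] i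
      by (auto simp: ladder_states_def)
    then show False using that by (simp add: ladder_states_def)
  qed
  then show "(R i has_sum 1) (ladder_states N M' X')"
    by (subst has_sum_cong_neutral[where T = UNIV and g = "R i"]) (auto simp: R)
qed (simp add: ladder_matrix_def)

lemma ladder_positive_recurrent: "positive_recurrent_on (ladder_states N M' X') R Pr (ladder_chain M X)"
  unfolding positive_recurrent_on_def
proof (intro conjI ballI)
  show "(\<integral>\<^sup>+ \<omega>. ennreal_of_enat (hitting_time (ladder_chain M X) {i} \<omega>) \<partial>Pr i) < \<infinity>"
    if "i \<in> ladder_states N M' X'" for i
    by (rule markov_chain_from_return_time_finite[OF ladder_markov_chain AE_ladder_chain_alive ladder_pi_stationary])
      (use that in \<open>simp_all add: ladder_states_def ladder_matrix_def\<close>)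
qed (rule ladder_stochastic_on ladder_markov_chain ladder_reachable_prob; assumption)+

text \<open>For each time and each state outside the support the record event is null by
  stationarity, and there are countably many such pairs.\<close>

lemma AE_record_state: "AE \<omega> in N. \<forall>k. record_at k \<omega> \<longrightarrow> M' k \<omega> \<in> ladder_states N M' X'"
proof -
  have "AE \<omega> in N. \<not> (record_at k \<omega> \<and> M' k \<omega> = j)" if "j \<notin> ladder_states N M' X'" for k j
  proof -
    have "measure N {\<omega>\<in>space N. record_at k \<omega> \<and> M' k \<omega> = j} = 0"
      using that prob_record[of k "{j}"] by (simp add: ladder_states_eq zero_less_measure_iff)
    then show ?thesis by (subst (asm) N.prob_Collect_eq_0) auto
  qed
  then have "AE \<omega> in N. \<forall>k j. j \<notin> ladder_states N M' X' \<longrightarrow> \<not> (record_at k \<omega> \<and> M' k \<omega> = j)"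
    by (subst AE_all_countable, intro allI, subst AE_all_countable) auto
  then show ?thesis by eventually_elim blast
qed

text \<open>A two-sided record after 0 is a ladder epoch of the forward walk, and almost surely its
  state is in the support; \<open>path_law_eq_1\<close> turns this into absorption from every
  initial state.\<close>

lemma ladder_hits:
  "measure (Pr i) {\<omega>\<in>space (Pr i). hitting_time (ladder_chain M X) (ladder_states N M' X') \<omega> < \<infinity>} = 1"
proof -
  let ?S = "ladder_states N M' X'"
  have "AE \<omega> in N. \<exists>n\<ge>1. path_ladder n (future_path 0 \<omega>) \<in> Some ` ?S"
    using AE_record_state AE_record_after
  proof eventually_elim
    case (elim \<omega>)
    obtain k where k: "0 < k" "record_at k \<omega>" using elim(2) by blast
    then have r: "record_at (0 + int (nat k)) \<omega>" by simp
    obtain n where n: "ladder_epoch path_increment n (future_path 0 \<omega>) = enat (nat k)"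
      using ladder_epoch_forward_record[OF record_imp_forward_record[OF r]] by blast
    then have "path_ladder n (future_path 0 \<omega>) = Some (M' k \<omega>)"
      using k by (simp add: ladder_chain_def state_future_path)
    \<comment> \<open>\<open>nat k\<close> is positive while the ladder epoch with index 0 is 0, so
      this visit counts for the hitting time, which starts at 1.\<close>
    moreover have "n \<noteq> 0" using n k(1) by (cases n) (auto simp: zero_enat_def)
    ultimately show ?case using elim(1) k(2) by (intro exI[of _ n]) auto
  qed
  moreover have P: "Measurable.pred path_space (\<lambda>y. \<exists>n\<ge>1. path_ladder n y \<in> Some ` ?S)" by measurable
  ultimately have "measure (path_law i) {y. \<exists>n\<ge>1. path_ladder n y \<in> Some ` ?S} = 1"
    by (intro path_law_eq_1)
  then show ?thesis
    unfolding measure_path_law[OF P] ladder_chain_forward_path hitting_time_finite_iff .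
qed

end

theorem theorem2p1:
  fixes p :: "'s::countable \<Rightarrow> 's \<Rightarrow> real"
    and F :: "'s \<Rightarrow> 's \<Rightarrow> real measure"
    and \<pi> :: "'s \<Rightarrow> real"
    and Pr :: "'s \<Rightarrow> 'w measure"
    and M :: "nat \<Rightarrow> 'w \<Rightarrow> 's" and X :: "nat \<Rightarrow> 'w \<Rightarrow> real"
    and \<xi> :: "('s \<times> real) measure"
    and Pxi :: "'v measure"
    and M' :: "int \<Rightarrow> 'v \<Rightarrow> 's" and X' :: "int \<Rightarrow> 'v \<Rightarrow> real"
  assumes "markov_random_walk p F Pr M X"
    and "positive_recurrent_on UNIV p Pr (\<lambda>n \<omega>. Some (M n \<omega>))"
    and "stationary_distribution p \<pi>"
    and "stationary_law p F \<xi>"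
    and "two_sided_stationary p F \<xi> Pxi M' X'"
    and "AE \<omega> in Pxi. filterlim (\<lambda>n. dual_walk X' (int n) \<omega>) at_top sequentially"
  shows "ladder_const Pxi X' = measure Pxi {\<omega> \<in> space Pxi. sigma0 X' \<omega> = 0} \<and>
         0 < ladder_const Pxi X' \<and> ladder_const Pxi X' \<le> 1 \<and>
         (\<forall>i. ladder_pi Pxi M' X' i =
              1 / ladder_const Pxi X' *
              measure Pxi {\<omega> \<in> space Pxi. M' 0 \<omega> = i \<and> sigma0 X' \<omega> = 0}) \<and>
         (\<forall>\<nu>. stationary_distribution (ladder_matrix Pr M X) \<nu> \<longleftrightarrow> \<nu> = ladder_pi Pxi M' X') \<and>
         (\<forall>i. ladder_pi Pxi M' X' i =
              1 / ladder_const Pxi X' *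
              \<P>(\<omega> in Pxi. sigma0 X' \<omega> = 0 \<bar> M' 0 \<omega> = i) * \<pi> i) \<and>
         positive_recurrent_on (ladder_states Pxi M' X') (ladder_matrix Pr M X) Pr
           (ladder_chain M X) \<and>
         (\<forall>i. measure (Pr i) {\<omega> \<in> space (Pr i).
                hitting_time (ladder_chain M X) (ladder_states Pxi M' X') \<omega> < \<infinity>} = 1)"
proof -
  interpret dual_divergent_mrw p F \<pi> Pr M X \<xi> Pxi M' X'
    by unfold_locales (fact assms)+
  let ?c = "ladder_const Pxi X'"
  have \<sigma>0: "measure Pxi {\<omega>\<in>space Pxi. M' 0 \<omega> = i \<and> sigma0 X' \<omega> = 0} =
      measure Pxi {\<omega>\<in>space Pxi. record_at 0 \<omega> \<and> M' 0 \<omega> = i}" for i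
    using prob_sigma0[of "{i}"] by simp
  have const: "?c = measure Pxi {\<omega>\<in>space Pxi. sigma0 X' \<omega> = 0}"
    using prob_sigma0[of UNIV] by (simp add: ladder_const_eq)
  have pi: "ladder_pi Pxi M' X' i = 1 / ?c * measure Pxi {\<omega>\<in>space Pxi. M' 0 \<omega> = i \<and> sigma0 X' \<omega> = 0}" for i
    by (simp only: ladder_pi_eq \<sigma>0)
  \<comment> \<open>The state at time 0 has law \<pi> with positive weights, so multiplying by
    \<open>\<pi> i\<close> undoes the conditioning.\<close>
  have "\<P>(\<omega> in Pxi. sigma0 X' \<omega> = 0 \<bar> M' 0 \<omega> = i) * \<pi> i =
      measure Pxi {\<omega>\<in>space Pxi. M' 0 \<omega> = i \<and> sigma0 X' \<omega> = 0}" for i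
  proof -
    have "{\<omega>\<in>space Pxi. sigma0 X' \<omega> = 0 \<and> M' 0 \<omega> = i} = {\<omega>\<in>space Pxi. M' 0 \<omega> = i \<and> sigma0 X' \<omega> = 0}"
      by auto
    then show ?thesis using prob_state_pos[of i] by (simp add: cond_prob_def prob_state_eq)
  qed
  then have density: "ladder_pi Pxi M' X' i =
      1 / ?c * \<P>(\<omega> in Pxi. sigma0 X' \<omega> = 0 \<bar> M' 0 \<omega> = i) * \<pi> i" for i
    using pi[of i] by (simp only: mult.assoc)
  have "?c \<le> 1" unfolding const by (rule N.prob_le_1)
  then show ?thesis
    using const ladder_const_pos pi density stationary_iff ladder_positive_recurrent ladder_hits by blast
qed

end
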